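(* Let $(\mathsf{T},\mathsf{U},Q,D)$ be an Auslander--Gruson--Jensen (AGJ) duality triple. Let $(\mathsf{A},\mathsf{B})$ be a duality pair on the induced duality triple $(\mathrm{Mod}(\mathsf{T}^{\mathrm{c}}),\mathrm{Mod}(\mathsf{U}^{\mathrm{c}}),\partial)$. Then $(\mathsf{A}_{0},\mathsf{B}_{0})$ is a duality pair on $(\mathsf{T},\mathsf{U},Q,D)$. Moreover, if $(\mathsf{X},\mathsf{Y})$ is a duality pair on $(\mathsf{T},\mathsf{U},Q)$, then there is a duality pair $(\mathsf{A},\mathsf{B})$ on $(\mathrm{Mod}(\mathsf{T}^{\mathrm{c}}),\mathrm{Mod}(\mathsf{U}^{\mathrm{c}}),\partial)$ such that $\mathsf{A}_{0}=\mathsf{X}$ and $\mathsf{B}_{0}=\mathrm{add}(Q\mathsf{X})\subseteq\mathsf{Y}$.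
   Context: For a compactly generated triangulated category $\mathsf{T}$ with compact objects $\mathsf{T}^{\mathrm{c}}$, $\mathrm{Mod}(\mathsf{T}^{\mathrm{c}})$ is the category of additive functors $(\mathsf{T}^{\mathrm{c}})^{\mathrm{op}}\to\mathbf{Ab}$ and $\mathbf{y}X=\mathrm{Hom}_{\mathsf{T}}(-,X)|_{\mathsf{T}^{\mathrm{c}}}$. A morphism $X\to Y$ is a pure monomorphism if it sits in a triangle $X\to Y\to Z\to\Sigma X$ with $0\to\mathbf{y}X\to\mathbf{y}Y\to\mathbf{y}Z\to0$ exact; $X$ is pure injective if $\mathbf{y}X$ is injective. A duality triple $(\mathsf{T},\mathsf{U},Q)$ consists of two compactly generated triangulated categories $\mathsf{T},\mathsf{U}$ and exact functors $Q\colon\mathsf{T}^{\mathrm{op}}\to\mathsf{U}$ and $Q\colon\mathsf{U}^{\mathrm{op}}\to\mathsf{T}$ (both denoted $Q$) such that: (1) $Q(X)$ is pure injective for every $X$ in $\mathsf{T}$ or $\mathsf{U}$; (2) for every $X$ in $\mathsf{T}$ or $\mathsf{U}$ there is a natural map $i_X\colon X\to Q^2(X)$ which is a pure monomorphism; (3) $Q(i_X)\circ i_{Q(X)}$ is the identity for every $X$ in $\mathsf{T}$ or $\mathsf{U}$; (4) $Q(\bigoplus_I X_i)\simeq\prod_I Q(X_i)$ for every set of objects $\{X_i\}_I$ in $\mathsf{T}$ or in $\mathsf{U}$. An AGJ duality triple $(\mathsf{T},\mathsf{U},Q,D)$ is a duality triple together with functors $D\colon(\mathsf{T}^{\mathrm{c}})^{\mathrm{op}}\to\mathsf{U}^{\mathrm{c}}$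 and $D\colon(\mathsf{U}^{\mathrm{c}})^{\mathrm{op}}\to\mathsf{T}^{\mathrm{c}}$ such that: (1) they form an adjoint equivalence between $\mathsf{T}^{\mathrm{c}}$ and $(\mathsf{U}^{\mathrm{c}})^{\mathrm{op}}$; (2) for all $C\in\mathsf{T}^{\mathrm{c}}$, $X\in\mathsf{T}$, $C'\in\mathsf{U}^{\mathrm{c}}$, $Y\in\mathsf{U}$ there are isomorphisms $\mathrm{Hom}_{\mathbb{Z}}(\mathrm{Hom}_{\mathsf{T}}(C,X),\mathbb{Q}/\mathbb{Z})\cong\mathrm{Hom}_{\mathsf{U}}(DC,QX)$ and $\mathrm{Hom}_{\mathbb{Z}}(\mathrm{Hom}_{\mathsf{U}}(C',Y),\mathbb{Q}/\mathbb{Z})\cong\mathrm{Hom}_{\mathsf{T}}(DC',QY)$, natural in both variables. A duality pair on $(\mathsf{T},\mathsf{U},Q)$ (or on $(\mathsf{T},\mathsf{U},Q,D)$) is a pair of classes $\mathsf{X}\subseteq\mathsf{T}$, $\mathsf{Y}\subseteq\mathsf{U}$ with $M\in\mathsf{X}$ iff $Q(M)\in\mathsf{Y}$ and $\mathsf{Y}$ closed under finite coproducts and retracts. $Q\mathsf{X}=\{QX:X\in\mathsf{X}\}$ and $\mathrm{add}(Q\mathsf{X})$ is the smallest subcategory of $\mathsf{U}$ containing $Q\mathsf{X}$ and closed under retracts and finite coproducts. The contravariant functor $\partial\colon\mathrm{Mod}(\mathsf{T}^{\mathrm{c}})\to\mathrm{Mod}(\mathsf{U}^{\mathrm{c}})$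 is $\partial f=\mathrm{Hom}_{\mathbb{Z}}(f(D(-)),\mathbb{Q}/\mathbb{Z})$, and $\partial\colon\mathrm{Mod}(\mathsf{U}^{\mathrm{c}})\to\mathrm{Mod}(\mathsf{T}^{\mathrm{c}})$ is defined likewise. A duality pair on $(\mathrm{Mod}(\mathsf{T}^{\mathrm{c}}),\mathrm{Mod}(\mathsf{U}^{\mathrm{c}}),\partial)$ is a pair of classes $\mathsf{A}\subseteq\mathrm{Mod}(\mathsf{T}^{\mathrm{c}})$, $\mathsf{B}\subseteq\mathrm{Mod}(\mathsf{U}^{\mathrm{c}})$ with $f\in\mathsf{A}$ iff $\partial f\in\mathsf{B}$ and $\mathsf{B}$ closed under finite direct sums and summands. For a class $\mathsf{A}\subseteq\mathrm{Mod}(\mathsf{T}^{\mathrm{c}})$, $\mathsf{A}_0=\{X\in\mathsf{T}:\mathbf{y}X\in\mathsf{A}\}$, and similarly for $\mathsf{U}$. *)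

theory Defs
  imports "HOL-Algebra.Free_Abelian_Groups" "HOL-Algebra.Exact_Sequence"
begin

unbundle cardinal_syntax

section \<open>Universes\<close>

text \<open>
  The sets of the ambient set theory are modelled by a Grothendieck universe: a type \<open>'u\<close> whose
  cardinality is an uncountable inaccessible cardinal. A set is small if it has fewer elements
  than \<open>'u\<close>, so that (up to bijection) the small sets are the small subsets of \<open>'u\<close>. Families
  indexed by a set are families indexed by a small subset of \<open>'u\<close>.
\<close>

definition small :: "'u itself \<Rightarrow> 'a set \<Rightarrow> bool" where
  "small _ A \<longleftrightarrow> |A| <o |UNIV :: 'u set|"

definition is_universe :: "'u itself \<Rightarrow> bool" where
  "is_universe u \<longleftrightarrow>
     small u (UNIV :: nat set) \<and>
     (\<forall>A :: 'u set. small u A \<longrightarrow> small u (Pow A)) \<and>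
     (\<forall>(I :: 'u set) (A :: 'u \<Rightarrow> 'u set).
        small u I \<and> (\<forall>i\<in>I. small u (A i)) \<longrightarrow> small u (\<Union>i\<in>I. A i))"


section \<open>Preadditive categories\<close>

text \<open>
  The group operation on \<open>Hom C X Y\<close> is written multiplicatively, as everywhere in HOL-Algebra:
  \<open>\<otimes>\<close> is addition of morphisms, \<open>\<one>\<close> the zero morphism and \<open>inv\<close> the negative.
  Hom-sets of different pairs of objects need not be disjoint, which is why composition and the
  arrow part of functors take the objects as arguments;
  \<open>Comp C X Y Z g f\<close> is the composite of \<open>f\<close> from \<open>X\<close> to \<open>Y\<close> and \<open>g\<close> from \<open>Y\<close> to \<open>Z\<close>.
\<close>

record ('o, 'm) precat =
  Obj :: "'o set"
  Hom :: "'o \<Rightarrow> 'o \<Rightarrow> 'm monoid"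
  Idn :: "'o \<Rightarrow> 'm"
  Comp :: "'o \<Rightarrow> 'o \<Rightarrow> 'o \<Rightarrow> 'm \<Rightarrow> 'm \<Rightarrow> 'm"

definition category :: "('o, 'm, 'z) precat_scheme \<Rightarrow> bool" where
  "category C \<longleftrightarrow>
     (\<forall>X\<in>Obj C. Idn C X \<in> carrier (Hom C X X)) \<and>
     (\<forall>X\<in>Obj C. \<forall>Y\<in>Obj C. \<forall>Z\<in>Obj C. \<forall>f\<in>carrier (Hom C X Y). \<forall>g\<in>carrier (Hom C Y Z).
        Comp C X Y Z g f \<in> carrier (Hom C X Z)) \<and>
     (\<forall>X\<in>Obj C. \<forall>Y\<in>Obj C. \<forall>f\<in>carrier (Hom C X Y).
        Comp C X X Y f (Idn C X) = f \<and> Comp C X Y Y (Idn C Y) f = f) \<and>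
     (\<forall>W\<in>Obj C. \<forall>X\<in>Obj C. \<forall>Y\<in>Obj C. \<forall>Z\<in>Obj C.
        \<forall>f\<in>carrier (Hom C W X). \<forall>g\<in>carrier (Hom C X Y). \<forall>h\<in>carrier (Hom C Y Z).
        Comp C W X Z (Comp C X Y Z h g) f = Comp C W Y Z h (Comp C W X Y g f))"

definition preadditive :: "('o, 'm, 'z) precat_scheme \<Rightarrow> bool" where
  "preadditive C \<longleftrightarrow>
     category C \<and>
     (\<forall>X\<in>Obj C. \<forall>Y\<in>Obj C. comm_group (Hom C X Y)) \<and>
     (\<forall>X\<in>Obj C. \<forall>Y\<in>Obj C. \<forall>Z\<in>Obj C.
        (\<forall>f\<in>carrier (Hom C X Y). (\<lambda>g. Comp C X Y Z g f) \<in> hom (Hom C Y Z) (Hom C X Z)) \<and>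
        (\<forall>g\<in>carrier (Hom C Y Z). (\<lambda>f. Comp C X Y Z g f) \<in> hom (Hom C X Y) (Hom C X Z)))"

definition opposite :: "('o, 'm, 'z) precat_scheme \<Rightarrow> ('o, 'm) precat" where
  "opposite C =
     \<lparr>Obj = Obj C, Hom = (\<lambda>X Y. Hom C Y X), Idn = Idn C, Comp = (\<lambda>X Y Z g f. Comp C Z Y X f g)\<rparr>"

definition full_subcategory :: "('o, 'm, 'z) precat_scheme \<Rightarrow> 'o set \<Rightarrow> ('o, 'm) precat" where
  "full_subcategory C S = \<lparr>Obj = S, Hom = Hom C, Idn = Idn C, Comp = Comp C\<rparr>"

definition iso_arrow :: "('o, 'm, 'z) precat_scheme \<Rightarrow> 'o \<Rightarrow> 'o \<Rightarrow> 'm \<Rightarrow> bool" where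
  "iso_arrow C X Y f \<longleftrightarrow> f \<in> carrier (Hom C X Y) \<and>
     (\<exists>g\<in>carrier (Hom C Y X). Comp C X Y X g f = Idn C X \<and> Comp C Y X Y f g = Idn C Y)"

definition mono_arrow :: "('o, 'm, 'z) precat_scheme \<Rightarrow> 'o \<Rightarrow> 'o \<Rightarrow> 'm \<Rightarrow> bool" where
  "mono_arrow C X Y f \<longleftrightarrow> f \<in> carrier (Hom C X Y) \<and>
     (\<forall>W\<in>Obj C. inj_on (Comp C W X Y f) (carrier (Hom C W X)))"

definition injective_object :: "('o, 'm, 'z) precat_scheme \<Rightarrow> 'o \<Rightarrow> bool" where
  "injective_object C J \<longleftrightarrow> J \<in> Obj C \<and>
     (\<forall>X\<in>Obj C. \<forall>Y\<in>Obj C. \<forall>m. mono_arrow C X Y m \<longrightarrow>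
        (\<forall>f\<in>carrier (Hom C X J). \<exists>g\<in>carrier (Hom C Y J). Comp C X Y J g m = f))"

definition zero_object :: "('o, 'm, 'z) precat_scheme \<Rightarrow> 'o \<Rightarrow> bool" where
  "zero_object C Z \<longleftrightarrow> Z \<in> Obj C \<and>
     (\<forall>X\<in>Obj C. (\<exists>!f. f \<in> carrier (Hom C Z X)) \<and> (\<exists>!f. f \<in> carrier (Hom C X Z)))"

definition is_coproduct ::
    "('o, 'm, 'z) precat_scheme \<Rightarrow> 'i set \<Rightarrow> ('i \<Rightarrow> 'o) \<Rightarrow> 'o \<Rightarrow> ('i \<Rightarrow> 'm) \<Rightarrow> bool" where
  "is_coproduct C I X P \<iota> \<longleftrightarrow>
     P \<in> Obj C \<and> (\<forall>i\<in>I. X i \<in> Obj C \<and> \<iota> i \<in> carrier (Hom C (X i) P)) \<and>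
     (\<forall>Z\<in>Obj C. \<forall>f. (\<forall>i\<in>I. f i \<in> carrier (Hom C (X i) Z)) \<longrightarrow>
        (\<exists>!h. h \<in> carrier (Hom C P Z) \<and> (\<forall>i\<in>I. Comp C (X i) P Z h (\<iota> i) = f i)))"

definition is_product ::
    "('o, 'm, 'z) precat_scheme \<Rightarrow> 'i set \<Rightarrow> ('i \<Rightarrow> 'o) \<Rightarrow> 'o \<Rightarrow> ('i \<Rightarrow> 'm) \<Rightarrow> bool" where
  "is_product C = is_coproduct (opposite C)"

definition additive_category :: "('o, 'm, 'z) precat_scheme \<Rightarrow> bool" where
  "additive_category C \<longleftrightarrow> preadditive C \<and>
     (\<forall>(I :: nat set) X. finite I \<and> (\<forall>i\<in>I. X i \<in> Obj C) \<longrightarrow> (\<exists>P \<iota>. is_coproduct C I X P \<iota>))"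

definition retract_of :: "('o, 'm, 'z) precat_scheme \<Rightarrow> 'o \<Rightarrow> 'o \<Rightarrow> bool" where
  "retract_of C M N \<longleftrightarrow> M \<in> Obj C \<and> N \<in> Obj C \<and>
     (\<exists>s\<in>carrier (Hom C M N). \<exists>r\<in>carrier (Hom C N M). Comp C M N M r s = Idn C M)"

definition summand_of :: "('o, 'm, 'z) precat_scheme \<Rightarrow> 'o \<Rightarrow> 'o \<Rightarrow> bool" where
  "summand_of C M N \<longleftrightarrow>
     (\<exists>M' \<iota>. is_coproduct C (UNIV :: bool set) (\<lambda>b. if b then M else M') N \<iota>)"

text \<open>The empty coproduct (a zero object) counts as a finite coproduct.\<close>

definition closed_finite_coproducts :: "('o, 'm, 'z) precat_scheme \<Rightarrow> 'o set \<Rightarrow> bool" where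
  "closed_finite_coproducts C S \<longleftrightarrow>
     (\<forall>(I :: nat set) X P \<iota>. finite I \<and> (\<forall>i\<in>I. X i \<in> S) \<and> is_coproduct C I X P \<iota> \<longrightarrow> P \<in> S)"

definition closed_retracts :: "('o, 'm, 'z) precat_scheme \<Rightarrow> 'o set \<Rightarrow> bool" where
  "closed_retracts C S \<longleftrightarrow> (\<forall>M N. N \<in> S \<and> retract_of C M N \<longrightarrow> M \<in> S)"

definition closed_summands :: "('o, 'm, 'z) precat_scheme \<Rightarrow> 'o set \<Rightarrow> bool" where
  "closed_summands C S \<longleftrightarrow> (\<forall>M N. N \<in> S \<and> summand_of C M N \<longrightarrow> M \<in> S)"

definition add_closure :: "('o, 'm, 'z) precat_scheme \<Rightarrow> 'o set \<Rightarrow> 'o set" where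
  "add_closure C S =
     \<Inter> {Y. S \<subseteq> Y \<and> Y \<subseteq> Obj C \<and> closed_finite_coproducts C Y \<and> closed_retracts C Y}"


section \<open>Functors\<close>

record ('o, 'm, 'p, 'n) fctr =
  FObj :: "'o \<Rightarrow> 'p"
  FArr :: "'o \<Rightarrow> 'o \<Rightarrow> 'm \<Rightarrow> 'n"

definition is_functor ::
    "('o, 'm, 'z) precat_scheme \<Rightarrow> ('p, 'n, 'y) precat_scheme \<Rightarrow> ('o, 'm, 'p, 'n) fctr \<Rightarrow> bool" where
  "is_functor C D F \<longleftrightarrow>
     (\<forall>X\<in>Obj C. FObj F X \<in> Obj D \<and> FArr F X X (Idn C X) = Idn D (FObj F X)) \<and>
     (\<forall>X\<in>Obj C. \<forall>Y\<in>Obj C. \<forall>f\<in>carrier (Hom C X Y).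
        FArr F X Y f \<in> carrier (Hom D (FObj F X) (FObj F Y))) \<and>
     (\<forall>X\<in>Obj C. \<forall>Y\<in>Obj C. \<forall>Z\<in>Obj C. \<forall>f\<in>carrier (Hom C X Y). \<forall>g\<in>carrier (Hom C Y Z).
        FArr F X Z (Comp C X Y Z g f) =
        Comp D (FObj F X) (FObj F Y) (FObj F Z) (FArr F Y Z g) (FArr F X Y f))"

definition additive_functor ::
    "('o, 'm, 'z) precat_scheme \<Rightarrow> ('p, 'n, 'y) precat_scheme \<Rightarrow> ('o, 'm, 'p, 'n) fctr \<Rightarrow> bool" where
  "additive_functor C D F \<longleftrightarrow> is_functor C D F \<and>
     (\<forall>X\<in>Obj C. \<forall>Y\<in>Obj C. FArr F X Y \<in> hom (Hom C X Y) (Hom D (FObj F X) (FObj F Y)))"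

text \<open>
  A contravariant functor from \<open>C\<close> to \<open>D\<close> is always given as a functor \<open>F\<close> from \<open>C\<close> to
  \<open>opposite D\<close>, so that \<open>FArr F X Y\<close> takes a morphism of \<open>C\<close> from \<open>X\<close> to \<open>Y\<close> to one of \<open>D\<close> from
  \<open>FObj F Y\<close> to \<open>FObj F X\<close>. The functor \<open>opposite_functor F\<close> is the same functor, seen as going
  from \<open>opposite C\<close> to \<open>D\<close>.
\<close>

definition opposite_functor :: "('o, 'm, 'p, 'n) fctr \<Rightarrow> ('o, 'm, 'p, 'n) fctr" where
  "opposite_functor F = \<lparr>FObj = FObj F, FArr = (\<lambda>X Y. FArr F Y X)\<rparr>"

definition id_functor :: "('o, 'm, 'o, 'm) fctr" where
  "id_functor = \<lparr>FObj = (\<lambda>X. X), FArr = (\<lambda>X Y f. f)\<rparr>"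

definition comp_functor ::
    "('p, 'n, 'q, 'k) fctr \<Rightarrow> ('o, 'm, 'p, 'n) fctr \<Rightarrow> ('o, 'm, 'q, 'k) fctr" where
  "comp_functor G F =
     \<lparr>FObj = (\<lambda>X. FObj G (FObj F X)),
      FArr = (\<lambda>X Y f. FArr G (FObj F X) (FObj F Y) (FArr F X Y f))\<rparr>"

definition nat_trans ::
    "('o, 'm, 'z) precat_scheme \<Rightarrow> ('p, 'n, 'y) precat_scheme \<Rightarrow>
     ('o, 'm, 'p, 'n) fctr \<Rightarrow> ('o, 'm, 'p, 'n) fctr \<Rightarrow> ('o \<Rightarrow> 'n) \<Rightarrow> bool" where
  "nat_trans C D F G \<eta> \<longleftrightarrow>
     (\<forall>X\<in>Obj C. \<eta> X \<in> carrier (Hom D (FObj F X) (FObj G X))) \<and>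
     (\<forall>X\<in>Obj C. \<forall>Y\<in>Obj C. \<forall>f\<in>carrier (Hom C X Y).
        Comp D (FObj F X) (FObj F Y) (FObj G Y) (\<eta> Y) (FArr F X Y f) =
        Comp D (FObj F X) (FObj G X) (FObj G Y) (FArr G X Y f) (\<eta> X))"

definition nat_iso ::
    "('o, 'm, 'z) precat_scheme \<Rightarrow> ('p, 'n, 'y) precat_scheme \<Rightarrow>
     ('o, 'm, 'p, 'n) fctr \<Rightarrow> ('o, 'm, 'p, 'n) fctr \<Rightarrow> ('o \<Rightarrow> 'n) \<Rightarrow> bool" where
  "nat_iso C D F G \<eta> \<longleftrightarrow> nat_trans C D F G \<eta> \<and>
     (\<forall>X\<in>Obj C. iso_arrow D (FObj F X) (FObj G X) (\<eta> X))"

definition adjoint_equivalence ::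
    "('o, 'm, 'z) precat_scheme \<Rightarrow> ('p, 'n, 'y) precat_scheme \<Rightarrow>
     ('o, 'm, 'p, 'n) fctr \<Rightarrow> ('p, 'n, 'o, 'm) fctr \<Rightarrow> bool" where
  "adjoint_equivalence C D F G \<longleftrightarrow> is_functor C D F \<and> is_functor D C G \<and>
     (\<exists>\<eta> \<epsilon>. nat_iso C C id_functor (comp_functor G F) \<eta> \<and>
            nat_iso D D (comp_functor F G) id_functor \<epsilon> \<and>
            (\<forall>X\<in>Obj C. Comp D (FObj F X) (FObj F (FObj G (FObj F X))) (FObj F X)
               (\<epsilon> (FObj F X)) (FArr F X (FObj G (FObj F X)) (\<eta> X)) = Idn D (FObj F X)) \<and>
            (\<forall>Y\<in>Obj D. Comp C (FObj G Y) (FObj G (FObj F (FObj G Y))) (FObj G Y)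
               (FArr G (FObj F (FObj G Y)) Y (\<epsilon> Y)) (\<eta> (FObj G Y)) = Idn C (FObj G Y)))"


section \<open>Triangulated categories\<close>

text \<open>
  \<open>(X, Y, Z, u, v, w) \<in> Tri T\<close> means that \<open>X \<rightarrow> Y \<rightarrow> Z \<rightarrow> \<Sigma>X\<close> with maps \<open>u\<close>, \<open>v\<close>, \<open>w\<close> is a
  distinguished triangle. The shift is an additive self-equivalence, not necessarily an
  automorphism.
\<close>

record ('o, 'm) tricat = "('o, 'm) precat" +
  Shift :: "('o, 'm, 'o, 'm) fctr"
  Tri :: "('o \<times> 'o \<times> 'o \<times> 'm \<times> 'm \<times> 'm) set"

abbreviation ShO :: "('o, 'm, 'z) tricat_scheme \<Rightarrow> 'o \<Rightarrow> 'o" where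
  "ShO T \<equiv> FObj (Shift T)"

abbreviation ShA :: "('o, 'm, 'z) tricat_scheme \<Rightarrow> 'o \<Rightarrow> 'o \<Rightarrow> 'm \<Rightarrow> 'm" where
  "ShA T \<equiv> FArr (Shift T)"

definition candidate_triangle ::
    "('o, 'm, 'z) tricat_scheme \<Rightarrow> 'o \<times> 'o \<times> 'o \<times> 'm \<times> 'm \<times> 'm \<Rightarrow> bool" where
  "candidate_triangle T = (\<lambda>(X, Y, Z, u, v, w).
     X \<in> Obj T \<and> Y \<in> Obj T \<and> Z \<in> Obj T \<and>
     u \<in> carrier (Hom T X Y) \<and> v \<in> carrier (Hom T Y Z) \<and> w \<in> carrier (Hom T Z (ShO T X)))"

definition triangle_morphism ::
    "('o, 'm, 'z) tricat_scheme \<Rightarrow> 'o \<times> 'o \<times> 'o \<times> 'm \<times> 'm \<times> 'm \<Rightarrow>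
     'o \<times> 'o \<times> 'o \<times> 'm \<times> 'm \<times> 'm \<Rightarrow> 'm \<Rightarrow> 'm \<Rightarrow> 'm \<Rightarrow> bool" where
  "triangle_morphism T = (\<lambda>(X, Y, Z, u, v, w) (X', Y', Z', u', v', w') f g h.
     f \<in> carrier (Hom T X X') \<and> g \<in> carrier (Hom T Y Y') \<and> h \<in> carrier (Hom T Z Z') \<and>
     Comp T X Y Y' g u = Comp T X X' Y' u' f \<and>
     Comp T Y Z Z' h v = Comp T Y Y' Z' v' g \<and>
     Comp T Z (ShO T X) (ShO T X') (ShA T X X' f) w = Comp T Z Z' (ShO T X') w' h)"

definition triangulated :: "('o, 'm, 'z) tricat_scheme \<Rightarrow> bool" where
  "triangulated T \<longleftrightarrow>
     additive_category T \<and>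
     additive_functor T T (Shift T) \<and> (\<exists>G. adjoint_equivalence T T (Shift T) G) \<and>
     (\<forall>t\<in>Tri T. candidate_triangle T t) \<and>
     \<comment> \<open>TR1\<close>
     (\<forall>X Y Z u v w X' Y' Z' u' v' w' f g h.
        (X, Y, Z, u, v, w) \<in> Tri T \<and> candidate_triangle T (X', Y', Z', u', v', w') \<and>
        triangle_morphism T (X, Y, Z, u, v, w) (X', Y', Z', u', v', w') f g h \<and>
        iso_arrow T X X' f \<and> iso_arrow T Y Y' g \<and> iso_arrow T Z Z' h \<longrightarrow>
        (X', Y', Z', u', v', w') \<in> Tri T) \<and>
     (\<forall>X\<in>Obj T. \<forall>Z. zero_object T Z \<longrightarrow>
        (X, X, Z, Idn T X, \<one>\<^bsub>Hom T X Z\<^esub>, \<one>\<^bsub>Hom T Z (ShO T X)\<^esub>) \<in> Tri T) \<and>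
     (\<forall>X\<in>Obj T. \<forall>Y\<in>Obj T. \<forall>u\<in>carrier (Hom T X Y). \<exists>Z v w. (X, Y, Z, u, v, w) \<in> Tri T) \<and>
     \<comment> \<open>TR2\<close>
     (\<forall>X Y Z u v w. candidate_triangle T (X, Y, Z, u, v, w) \<longrightarrow>
        ((X, Y, Z, u, v, w) \<in> Tri T \<longleftrightarrow>
         (Y, Z, ShO T X, v, w, inv\<^bsub>Hom T (ShO T X) (ShO T Y)\<^esub> (ShA T X Y u)) \<in> Tri T)) \<and>
     \<comment> \<open>TR3\<close>
     (\<forall>X Y Z u v w X' Y' Z' u' v' w'. \<forall>f\<in>carrier (Hom T X X'). \<forall>g\<in>carrier (Hom T Y Y').
        (X, Y, Z, u, v, w) \<in> Tri T \<and> (X', Y', Z', u', v', w') \<in> Tri T \<and>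
        Comp T X Y Y' g u = Comp T X X' Y' u' f \<longrightarrow>
        (\<exists>h. triangle_morphism T (X, Y, Z, u, v, w) (X', Y', Z', u', v', w') f g h)) \<and>
     \<comment> \<open>TR4, the octahedral axiom\<close>
     (\<forall>X Y Z A B C u v a a' b b' c c'.
        (X, Y, A, u, a, a') \<in> Tri T \<and> (Y, Z, C, v, c, c') \<in> Tri T \<and>
        (X, Z, B, Comp T X Y Z v u, b, b') \<in> Tri T \<longrightarrow>
        (\<exists>f g. (A, B, C, f, g, Comp T C (ShO T Y) (ShO T A) (ShA T Y A a) c') \<in> Tri T \<and>
           Comp T Y A B f a = Comp T Y Z B b v \<and>
           Comp T A B (ShO T X) b' f = a' \<and>
           Comp T Z B C g b = c \<and>
           Comp T B C (ShO T Y) c' g =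
           Comp T B (ShO T X) (ShO T Y) (ShA T X Y u) b'))"

text \<open>
  A contravariant exact functor: an additive functor \<open>F\<close> together with a natural isomorphism
  \<open>\<phi>\<close> from \<open>F X\<close> to \<open>\<Sigma>F(\<Sigma>X)\<close>, taking a triangle
  \<open>X \<rightarrow> Y \<rightarrow> Z \<rightarrow> \<Sigma>X\<close> to the triangle \<open>F Z \<rightarrow> F Y \<rightarrow> F X \<rightarrow> \<Sigma>F Z\<close>. The sign conventions in use for
  the triangulation of an opposite category differ only by replacing \<open>\<phi>\<close> with its negative.
\<close>

definition contravariant_exact ::
    "('o, 'm, 'z) tricat_scheme \<Rightarrow> ('p, 'n, 'y) tricat_scheme \<Rightarrow> ('o, 'm, 'p, 'n) fctr \<Rightarrow> bool" where
  "contravariant_exact T U F \<longleftrightarrow>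
     additive_functor T (opposite U) F \<and>
     (\<exists>\<phi>. nat_iso T (opposite U)
            (comp_functor (opposite_functor (Shift U)) (comp_functor F (Shift T))) F \<phi> \<and>
          (\<forall>X Y Z u v w. (X, Y, Z, u, v, w) \<in> Tri T \<longrightarrow>
             (FObj F Z, FObj F Y, FObj F X, FArr F Y Z v, FArr F X Y u,
              Comp U (FObj F X) (ShO U (FObj F (ShO T X))) (ShO U (FObj F Z))
                (ShA U (FObj F (ShO T X)) (FObj F Z) (FArr F Z (ShO T X) w)) (\<phi> X)) \<in> Tri U))"


subsection \<open>Compact generation\<close>

text \<open>
  From here on the arrows of \<open>T\<close> are elements of the universe \<open>'u\<close>; the
  objects may form an arbitrary class. An object \<open>C\<close> is compact if the canonical map from the
  direct sum of the groups \<open>Hom(C, X i)\<close> to \<open>Hom(C, P)\<close>, for \<open>P\<close> a coproduct of the \<open>X i\<close>, is an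
  isomorphism.
\<close>

definition compact_object :: "('o, 'u, 'z) precat_scheme \<Rightarrow> 'o \<Rightarrow> bool" where
  "compact_object T C \<longleftrightarrow> C \<in> Obj T \<and>
     (\<forall>(I :: 'u set) X P \<iota>. small TYPE('u) I \<and> is_coproduct T I X P \<iota> \<longrightarrow>
        (\<lambda>f. gfinprod (Hom T C P) (\<lambda>i. Comp T C (X i) P (\<iota> i) (f i)) I)
          \<in> iso (sum_group I (\<lambda>i. Hom T C (X i))) (Hom T C P))"

definition compactly_generated :: "('o, 'u, 'z) tricat_scheme \<Rightarrow> bool" where
  "compactly_generated T \<longleftrightarrow>
     triangulated T \<and>
     (\<forall>X\<in>Obj T. \<forall>Y\<in>Obj T. small TYPE('u) (carrier (Hom T X Y))) \<and>
     (\<forall>(I :: 'u set) X. small TYPE('u) I \<and> (\<forall>i\<in>I. X i \<in> Obj T) \<longrightarrow>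
        (\<exists>P \<iota>. is_coproduct T I X P \<iota>)) \<and>
     (\<exists>G. small TYPE('u) G \<and> (\<forall>C\<in>G. compact_object T C) \<and>
        (\<forall>X\<in>Obj T. (\<forall>C\<in>G. carrier (Hom T C X) = {\<one>\<^bsub>Hom T C X\<^esub>}) \<longrightarrow> zero_object T X))"

definition compacts :: "('o, 'u, 'z) precat_scheme \<Rightarrow> ('o, 'u) precat" where
  "compacts T = full_subcategory T {C. compact_object T C}"


section \<open>Modules\<close>

text \<open>The abelian group of homomorphisms, with the pointwise operation.\<close>

definition hom_group ::
    "('a, 'x) monoid_scheme \<Rightarrow> ('b, 'y) monoid_scheme \<Rightarrow> ('a \<Rightarrow> 'b) monoid" where
  "hom_group G H =
     (product_group (carrier G) (\<lambda>_. H)) \<lparr>carrier := hom G H \<inter> extensional (carrier G)\<rparr>"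

definition Ab :: "('u monoid, 'u \<Rightarrow> 'u) precat" where
  "Ab = \<lparr>Obj = {G. comm_group G \<and> small TYPE('u) (carrier G)},
         Hom = hom_group,
         Idn = (\<lambda>G. \<lambda>x\<in>carrier G. x),
         Comp = (\<lambda>G H K g f. \<lambda>x\<in>carrier G. g (f x))\<rparr>"

type_synonym ('o, 'u) module = "('o, 'u, 'u monoid, 'u \<Rightarrow> 'u) fctr"

text \<open>
  The category of additive functors from the opposite of \<open>C\<close> to \<open>Ab\<close>; by the convention above
  these are given as functors from \<open>C\<close> to \<open>opposite Ab\<close>. A morphism is a natural transformation.
\<close>

definition Mod_category ::
    "('o, 'u, 'z) precat_scheme \<Rightarrow> (('o, 'u) module, 'o \<Rightarrow> 'u \<Rightarrow> 'u) precat" where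
  "Mod_category C =
     \<lparr>Obj = {F. additive_functor C (opposite Ab) F},
      Hom = (\<lambda>F G. (product_group (Obj C) (\<lambda>X. hom_group (FObj F X) (FObj G X)))
              \<lparr>carrier := {\<eta> \<in> extensional (Obj C).
                 nat_trans (opposite C) Ab (opposite_functor F) (opposite_functor G) \<eta>}\<rparr>),
      Idn = (\<lambda>F. \<lambda>X\<in>Obj C. Idn Ab (FObj F X)),
      Comp = (\<lambda>F G H \<beta> \<alpha>. \<lambda>X\<in>Obj C. Comp Ab (FObj F X) (FObj G X) (FObj H X) (\<beta> X) (\<alpha> X))\<rparr>"

abbreviation ModC :: "('o, 'u, 'z) precat_scheme \<Rightarrow> (('o, 'u) module, 'o \<Rightarrow> 'u \<Rightarrow> 'u) precat" where
  "ModC T \<equiv> Mod_category (compacts T)"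

text \<open>Exactness in a module category is pointwise exactness.\<close>

definition Mod_short_exact ::
    "('o, 'u, 'z) precat_scheme \<Rightarrow> ('o, 'u) module \<Rightarrow> ('o, 'u) module \<Rightarrow> ('o, 'u) module \<Rightarrow>
     ('o \<Rightarrow> 'u \<Rightarrow> 'u) \<Rightarrow> ('o \<Rightarrow> 'u \<Rightarrow> 'u) \<Rightarrow> bool" where
  "Mod_short_exact C F G H \<alpha> \<beta> \<longleftrightarrow>
     \<alpha> \<in> carrier (Hom (Mod_category C) F G) \<and> \<beta> \<in> carrier (Hom (Mod_category C) G H) \<and>
     (\<forall>X\<in>Obj C. short_exact_sequence (FObj H X) (FObj G X) (FObj F X) (\<beta> X) (\<alpha> X))"

definition yon :: "('o, 'u, 'z) precat_scheme \<Rightarrow> 'o \<Rightarrow> ('o, 'u) module" where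
  "yon T X =
     \<lparr>FObj = (\<lambda>C. Hom T C X),
      FArr = (\<lambda>C C' c. \<lambda>f\<in>carrier (Hom T C' X). Comp T C C' X f c)\<rparr>"

definition yon_arr :: "('o, 'u, 'z) precat_scheme \<Rightarrow> 'o \<Rightarrow> 'o \<Rightarrow> 'u \<Rightarrow> 'o \<Rightarrow> 'u \<Rightarrow> 'u" where
  "yon_arr T X Y g = (\<lambda>C\<in>Obj (compacts T). \<lambda>f\<in>carrier (Hom T C X). Comp T C X Y g f)"

definition pure_mono :: "('o, 'u, 'z) tricat_scheme \<Rightarrow> 'o \<Rightarrow> 'o \<Rightarrow> 'u \<Rightarrow> bool" where
  "pure_mono T X Y u \<longleftrightarrow>
     (\<exists>Z v w. (X, Y, Z, u, v, w) \<in> Tri T \<and>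
        Mod_short_exact (compacts T) (yon T X) (yon T Y) (yon T Z)
          (yon_arr T X Y u) (yon_arr T Y Z v))"

definition pure_injective :: "('o, 'u, 'z) tricat_scheme \<Rightarrow> 'o \<Rightarrow> bool" where
  "pure_injective T X \<longleftrightarrow> X \<in> Obj T \<and> injective_object (ModC T) (yon T X)"

definition preimage_yon ::
    "('o, 'u, 'z) precat_scheme \<Rightarrow> ('o, 'u) module set \<Rightarrow> 'o set" where
  "preimage_yon T A = {X \<in> Obj T. yon T X \<in> A}"


section \<open>Character duals\<close>

definition QZ :: "rat set monoid" where
  "QZ = \<lparr>carrier = UNIV :: rat set, mult = (+), one = 0\<rparr> Mod \<int>"

text \<open>
  The group \<open>hom_group G QZ\<close> does not live on the type \<open>'u\<close>, so it is transported to \<open>'u\<close> along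
  a chosen injection, which exists when \<open>G\<close> is small. The choice affects character duals only up
  to isomorphism.
\<close>

definition emb :: "'a set \<Rightarrow> 'a \<Rightarrow> 'u" where
  "emb A = (SOME e. inj_on e A)"

definition char_emb :: "'u monoid \<Rightarrow> ('u \<Rightarrow> rat set) \<Rightarrow> 'u" where
  "char_emb G = emb (carrier (hom_group G QZ))"

definition char_proj :: "'u monoid \<Rightarrow> 'u \<Rightarrow> ('u \<Rightarrow> rat set)" where
  "char_proj G = inv_into (carrier (hom_group G QZ)) (char_emb G)"

definition char_dual :: "'u monoid \<Rightarrow> 'u monoid" where
  "char_dual G =
     \<lparr>carrier = char_emb G ` carrier (hom_group G QZ),
      mult = (\<lambda>x y. char_emb G (char_proj G x \<otimes>\<^bsub>hom_group G QZ\<^esub> char_proj G y)),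
      one = char_emb G \<one>\<^bsub>hom_group G QZ\<^esub>\<rparr>"

definition char_dual_arr :: "'u monoid \<Rightarrow> 'u monoid \<Rightarrow> ('u \<Rightarrow> 'u) \<Rightarrow> 'u \<Rightarrow> 'u" where
  "char_dual_arr G H f =
     (\<lambda>x\<in>carrier (char_dual H). char_emb G (\<lambda>a\<in>carrier G. char_proj H x (f a)))"

text \<open>
  The functor \<open>\<partial>\<close> on objects, for \<open>D\<close> a contravariant functor from the compact objects of \<open>U\<close> to
  those of \<open>T\<close>: it takes a module \<open>F\<close> over the compacts of \<open>T\<close> to the module \<open>Hom(F(D -), \<rat>/\<int>)\<close>.
\<close>

definition dual_module ::
    "('p, 'u, 'o, 'u) fctr \<Rightarrow> ('o, 'u) module \<Rightarrow> ('p, 'u) module" where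
  "dual_module D F =
     \<lparr>FObj = (\<lambda>C. char_dual (FObj F (FObj D C))),
      FArr = (\<lambda>C C' c. char_dual_arr (FObj F (FObj D C)) (FObj F (FObj D C'))
                (FArr F (FObj D C') (FObj D C) (FArr D C C' c)))\<rparr>"


section \<open>Duality triples\<close>

text \<open>
  The two functors denoted \<open>Q\<close> (and likewise \<open>D\<close>) are separate arguments: \<open>Q\<close> goes from \<open>T\<close> to
  \<open>U\<close> and \<open>Q'\<close> from \<open>U\<close> to \<open>T\<close>. The conditions on a duality triple and on an AGJ duality triple
  are symmetric in the two categories and each is stated once for \<open>(T, U, Q, Q')\<close>.
\<close>

definition duality_unit ::
    "('o, 'u, 'z) tricat_scheme \<Rightarrow> ('o, 'u, 'p, 'u) fctr \<Rightarrow> ('p, 'u, 'o, 'u) fctr \<Rightarrow>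
     ('o \<Rightarrow> 'u) \<Rightarrow> bool" where
  "duality_unit T Q Q' i \<longleftrightarrow>
     nat_trans T T id_functor (comp_functor (opposite_functor Q') Q) i \<and>
     (\<forall>X\<in>Obj T. pure_mono T X (FObj Q' (FObj Q X)) (i X))"

definition sends_coproducts_to_products ::
    "('o, 'u, 'z) tricat_scheme \<Rightarrow> ('p, 'u, 'y) tricat_scheme \<Rightarrow> ('o, 'u, 'p, 'u) fctr \<Rightarrow> bool" where
  "sends_coproducts_to_products T U Q \<longleftrightarrow>
     (\<forall>(I :: 'u set) X P \<iota>. small TYPE('u) I \<and> is_coproduct T I X P \<iota> \<longrightarrow>
        (\<exists>\<pi>. is_product U I (\<lambda>i. FObj Q (X i)) (FObj Q P) \<pi>))"

definition duality_triple ::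
    "('o, 'u, 'z) tricat_scheme \<Rightarrow> ('p, 'u, 'y) tricat_scheme \<Rightarrow>
     ('o, 'u, 'p, 'u) fctr \<Rightarrow> ('p, 'u, 'o, 'u) fctr \<Rightarrow> bool" where
  "duality_triple T U Q Q' \<longleftrightarrow>
     compactly_generated T \<and> compactly_generated U \<and>
     contravariant_exact T U Q \<and> contravariant_exact U T Q' \<and>
     (\<forall>X\<in>Obj T. pure_injective U (FObj Q X)) \<and> (\<forall>Y\<in>Obj U. pure_injective T (FObj Q' Y)) \<and>
     (\<exists>i j. duality_unit T Q Q' i \<and> duality_unit U Q' Q j \<and>
        (\<forall>X\<in>Obj T. Comp U (FObj Q X) (FObj Q (FObj Q' (FObj Q X))) (FObj Q X)
           (FArr Q X (FObj Q' (FObj Q X)) (i X)) (j (FObj Q X)) = Idn U (FObj Q X)) \<and>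
        (\<forall>Y\<in>Obj U. Comp T (FObj Q' Y) (FObj Q' (FObj Q (FObj Q' Y))) (FObj Q' Y)
           (FArr Q' Y (FObj Q (FObj Q' Y)) (j Y)) (i (FObj Q' Y)) = Idn T (FObj Q' Y))) \<and>
     sends_coproducts_to_products T U Q \<and> sends_coproducts_to_products U T Q'"

definition AGJ_isomorphism ::
    "('o, 'u, 'z) tricat_scheme \<Rightarrow> ('p, 'u, 'y) tricat_scheme \<Rightarrow>
     ('o, 'u, 'p, 'u) fctr \<Rightarrow> ('o, 'u, 'p, 'u) fctr \<Rightarrow>
     ('o \<Rightarrow> 'o \<Rightarrow> ('u \<Rightarrow> rat set) \<Rightarrow> 'u) \<Rightarrow> bool" where
  "AGJ_isomorphism T U Q D \<Phi> \<longleftrightarrow>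
     (\<forall>C\<in>Obj (compacts T). \<forall>X\<in>Obj T.
        \<Phi> C X \<in> iso (hom_group (Hom T C X) QZ) (Hom U (FObj D C) (FObj Q X))) \<and>
     (\<forall>C\<in>Obj (compacts T). \<forall>C'\<in>Obj (compacts T). \<forall>X\<in>Obj T. \<forall>c\<in>carrier (Hom T C C').
        \<forall>\<chi>\<in>carrier (hom_group (Hom T C X) QZ).
        \<Phi> C' X (\<lambda>f\<in>carrier (Hom T C' X). \<chi> (Comp T C C' X f c)) =
        Comp U (FObj D C') (FObj D C) (FObj Q X) (\<Phi> C X \<chi>) (FArr D C C' c)) \<and>
     (\<forall>C\<in>Obj (compacts T). \<forall>X\<in>Obj T. \<forall>X'\<in>Obj T. \<forall>g\<in>carrier (Hom T X X').
        \<forall>\<chi>\<in>carrier (hom_group (Hom T C X') QZ).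
        \<Phi> C X (\<lambda>f\<in>carrier (Hom T C X). \<chi> (Comp T C X X' g f)) =
        Comp U (FObj D C) (FObj Q X') (FObj Q X) (FArr Q X X' g) (\<Phi> C X' \<chi>))"

definition AGJ_duality_triple ::
    "('o, 'u, 'z) tricat_scheme \<Rightarrow> ('p, 'u, 'y) tricat_scheme \<Rightarrow>
     ('o, 'u, 'p, 'u) fctr \<Rightarrow> ('p, 'u, 'o, 'u) fctr \<Rightarrow>
     ('o, 'u, 'p, 'u) fctr \<Rightarrow> ('p, 'u, 'o, 'u) fctr \<Rightarrow> bool" where
  "AGJ_duality_triple T U Q Q' D D' \<longleftrightarrow>
     duality_triple T U Q Q' \<and>
     adjoint_equivalence (compacts T) (opposite (compacts U)) D (opposite_functor D') \<and>
     (\<exists>\<Phi>. AGJ_isomorphism T U Q D \<Phi>) \<and> (\<exists>\<Psi>. AGJ_isomorphism U T Q' D' \<Psi>)"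


section \<open>Duality pairs\<close>

definition duality_pair ::
    "('o, 'u, 'z) tricat_scheme \<Rightarrow> ('p, 'u, 'y) tricat_scheme \<Rightarrow> ('o, 'u, 'p, 'u) fctr \<Rightarrow>
     'o set \<Rightarrow> 'p set \<Rightarrow> bool" where
  "duality_pair T U Q \<X> \<Y> \<longleftrightarrow>
     \<X> \<subseteq> Obj T \<and> \<Y> \<subseteq> Obj U \<and> (\<forall>M\<in>Obj T. M \<in> \<X> \<longleftrightarrow> FObj Q M \<in> \<Y>) \<and>
     closed_finite_coproducts U \<Y> \<and> closed_retracts U \<Y>"

definition Mod_duality_pair ::
    "('o, 'u, 'z) tricat_scheme \<Rightarrow> ('p, 'u, 'y) tricat_scheme \<Rightarrow> ('p, 'u, 'o, 'u) fctr \<Rightarrow>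
     ('o, 'u) module set \<Rightarrow> ('p, 'u) module set \<Rightarrow> bool" where
  "Mod_duality_pair T U D' \<A> \<B> \<longleftrightarrow>
     \<A> \<subseteq> Obj (ModC T) \<and> \<B> \<subseteq> Obj (ModC U) \<and>
     (\<forall>F\<in>Obj (ModC T). F \<in> \<A> \<longleftrightarrow> dual_module D' F \<in> \<B>) \<and>
     closed_finite_coproducts (ModC U) \<B> \<and> closed_summands (ModC U) \<B>"

end

theory Submission
  imports Defs
begin

text \<open>
  The character isomorphisms identify \<open>\<partial>(\<^bold>yX)\<close> with \<open>\<^bold>y(QX)\<close>. Since \<open>\<^bold>y\<close> preserves finite
  coproducts, and retracts in triangulated categories split off, duality pairs restrict along \<open>\<^bold>y\<close>.
  Conversely, given \<open>(\<X>, \<Y>)\<close>, take for \<open>\<B>\<close> the summands of the modules \<open>\<^bold>yY\<close> with \<open>Y\<close> in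
  \<open>add(Q\<X>)\<close> and for \<open>\<A>\<close> the modules whose dual lies in \<open>\<B>\<close>. If \<open>\<^bold>yZ\<close> is a summand of \<open>\<^bold>yY\<close>,
  then both are injective, and the splitting lifts to the triangulated category because
  \<open>Hom(X, E) \<rightarrow> Hom(\<^bold>yX, \<^bold>yE)\<close> is bijective for \<open>E\<close> pure injective.

  That bijectivity is proved without Brown representability. Cover \<open>X\<close> by a coproduct of objects
  of a small family \<open>S\<close> of compact objects that detects isomorphisms, let \<open>X \<rightarrow> X\<^sub>1\<close> be the cone,
  and iterate. Both sides are cohomological in \<open>X\<close> and agree on coproducts of compact objects, so
  a defect of bijectivity at \<open>X\<close> moves up the tower \<open>X \<rightarrow> X\<^sub>1 \<rightarrow> X\<^sub>2 \<rightarrow> \<dots>\<close>. The maps of the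
  tower vanish on \<open>S\<close>, so \<open>1 - shift\<close> on the coproduct of the tower is an isomorphism, which makes
  the defect zero.
\<close>


section \<open>Categories\<close>

text \<open>For the converse, \<A> is forced by \<B>, so the content lies in the two preimages. If
  QX is in add(Q\<X>), it is in \<Y>, hence X is in \<X>; so \<B> must meet the representable
  modules in nothing beyond add(Q\<X>), and this is why retracts have to be lifted. The obstacle in
  the lifting is that the cover of X reaches only maps from the small family S, whereas modules are
  tested on all compact objects. Vanishing on S still makes 1 - s invertible, where s is the shift
  on the coproduct of the tower, and invertibility no longer refers to S. It is used three times. A
  sequence of phantoms compatible with the tower is fixed by s, hence zero. A module map sheds a
  morphism at each stage, and the formal infinite sum of these morphisms is the solution h of h = f
  + h s. Finally, solving y = \<iota> 0 x + s y for a map x from a compact object yields a y with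
  finitely many components, which are the images of x in the tower; so x dies at a finite stage and
  h has the right value on it.\<close>

abbreviation arr :: "('o, 'm, 'z) precat_scheme \<Rightarrow> 'o \<Rightarrow> 'o \<Rightarrow> 'm set" where
  "arr C X Y \<equiv> carrier (Hom C X Y)"

abbreviation zero_arr :: "('o, 'm, 'z) precat_scheme \<Rightarrow> 'o \<Rightarrow> 'o \<Rightarrow> 'm" where
  "zero_arr C X Y \<equiv> \<one>\<^bsub>Hom C X Y\<^esub>"

locale cat =
  fixes C :: "('o, 'm, 'z) precat_scheme"
  assumes category: "category C"
begin

lemma idn_closed [simp]: "X \<in> Obj C \<Longrightarrow> Idn C X \<in> arr C X X"
  using category by (simp add: category_def)

lemma comp_closed [simp]:
  "\<lbrakk>X \<in> Obj C; Y \<in> Obj C; Z \<in> Obj C; f \<in> arr C X Y; g \<in> arr C Y Z\<rbrakk> \<Longrightarrow>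
     Comp C X Y Z g f \<in> arr C X Z"
  using category by (simp add: category_def)

lemma comp_idn [simp]:
  assumes "X \<in> Obj C" "Y \<in> Obj C" "f \<in> arr C X Y"
  shows "Comp C X X Y f (Idn C X) = f" "Comp C X Y Y (Idn C Y) f = f"
  using category assms by (simp_all add: category_def)

lemma comp_assoc:
  "\<lbrakk>W \<in> Obj C; X \<in> Obj C; Y \<in> Obj C; Z \<in> Obj C; f \<in> arr C W X;
    g \<in> arr C X Y; h \<in> arr C Y Z\<rbrakk> \<Longrightarrow>
     Comp C W X Z (Comp C X Y Z h g) f = Comp C W Y Z h (Comp C W X Y g f)"
  using category by (simp add: category_def)

lemma coproductD:
  assumes "is_coproduct C I X P \<iota>"
  shows "P \<in> Obj C" "i \<in> I \<Longrightarrow> X i \<in> Obj C" "i \<in> I \<Longrightarrow> \<iota> i \<in> arr C (X i) P"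
  using assms by (auto simp: is_coproduct_def)

lemma coproduct_lift:
  assumes "is_coproduct C I X P \<iota>" "Z \<in> Obj C" "\<And>i. i \<in> I \<Longrightarrow> f i \<in> arr C (X i) Z"
  obtains h where "h \<in> arr C P Z" "\<And>i. i \<in> I \<Longrightarrow> Comp C (X i) P Z h (\<iota> i) = f i"
  using assms unfolding is_coproduct_def by metis

lemma coproduct_eqI:
  assumes "is_coproduct C I X P \<iota>" "Z \<in> Obj C"
    and "g \<in> arr C P Z" "h \<in> arr C P Z"
    and "\<And>i. i \<in> I \<Longrightarrow> Comp C (X i) P Z g (\<iota> i) = Comp C (X i) P Z h (\<iota> i)"
  shows "g = h"
proof -
  have "\<forall>i\<in>I. Comp C (X i) P Z h (\<iota> i) \<in> arr C (X i) Z"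
    using assms coproductD by (meson comp_closed)
  then have "\<exists>!k. k \<in> arr C P Z \<and>
      (\<forall>i\<in>I. Comp C (X i) P Z k (\<iota> i) = Comp C (X i) P Z h (\<iota> i))"
    using assms(1)[unfolded is_coproduct_def, THEN conjunct2, THEN conjunct2, rule_format,
        OF assms(2), of "\<lambda>i. Comp C (X i) P Z h (\<iota> i)"] by simp
  then show ?thesis
  proof (elim ex1E)
    fix k
    assume k: "\<forall>k'. k' \<in> arr C P Z \<and>
      (\<forall>i\<in>I. Comp C (X i) P Z k' (\<iota> i) = Comp C (X i) P Z h (\<iota> i)) \<longrightarrow> k' = k"
    show "g = h"
      using k[rule_format, of g] k[rule_format, of h] assms(3-5) by simp
  qed
qed


lemma isoE:
  assumes "iso_arrow C X Y f"
  obtains g where "f \<in> arr C X Y" "g \<in> arr C Y X"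
    "Comp C X Y X g f = Idn C X" "Comp C Y X Y f g = Idn C Y"
  using assms unfolding iso_arrow_def by blast

lemma left_inverse_cancel:
  assumes "W \<in> Obj C" "X \<in> Obj C" "Y \<in> Obj C" "f \<in> arr C W X"
    "g \<in> arr C X Y" "h \<in> arr C Y X" "Comp C X Y X h g = Idn C X"
  shows "Comp C W Y X h (Comp C W X Y g f) = f"
  using assms by (simp flip: comp_assoc)

lemma right_inverse_cancel:
  assumes "W \<in> Obj C" "X \<in> Obj C" "Y \<in> Obj C" "f \<in> arr C X W"
    "g \<in> arr C Y X" "h \<in> arr C X Y" "Comp C X Y X g h = Idn C X"
  shows "Comp C X Y W (Comp C Y X W f g) h = f"
  using assms by (simp add: comp_assoc)

lemma retract_ofE:
  assumes "retract_of C M N"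
  obtains s r where "M \<in> Obj C" "N \<in> Obj C" "s \<in> arr C M N" "r \<in> arr C N M"
    "Comp C M N M r s = Idn C M"
  using assms by (auto simp: retract_of_def)

lemma retract_ofI:
  "\<lbrakk>M \<in> Obj C; N \<in> Obj C; s \<in> arr C M N; r \<in> arr C N M;
    Comp C M N M r s = Idn C M\<rbrakk> \<Longrightarrow> retract_of C M N"
  by (auto simp: retract_of_def)

lemma retract_of_refl: "X \<in> Obj C \<Longrightarrow> retract_of C X X"
  by (rule retract_ofI[of _ _ "Idn C X" "Idn C X"]) simp_all

lemma retract_of_trans:
  assumes "retract_of C L M" "retract_of C M N"
  shows "retract_of C L N"
proof -
  obtain s r where sr [simp]: "L \<in> Obj C" "M \<in> Obj C" "s \<in> arr C L M"
    "r \<in> arr C M L" "Comp C L M L r s = Idn C L"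
    using assms(1) by (rule retract_ofE)
  obtain s' r' where sr' [simp]: "N \<in> Obj C" "s' \<in> arr C M N"
    "r' \<in> arr C N M" "Comp C M N M r' s' = Idn C M"
    using assms(2) by (rule retract_ofE)
  have "Comp C L N L (Comp C N M L r r') (Comp C L M N s' s) = Idn C L"
    by (simp add: comp_assoc left_inverse_cancel)
  then show ?thesis by (intro retract_ofI[of _ _ "Comp C L M N s' s" "Comp C N M L r r'"]) simp_all
qed

lemma coproduct_retract:
  assumes P: "is_coproduct C I X P \<iota>" and N: "is_coproduct C I Y N \<kappa>"
    and "\<And>i. i \<in> I \<Longrightarrow> retract_of C (X i) (Y i)"
  shows "retract_of C P N"
proof -
  note [simp] = coproductD[OF P] coproductD[OF N]
  have "\<exists>s r. s \<in> arr C (X i) (Y i) \<and> r \<in> arr C (Y i) (X i) \<and>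
      Comp C (X i) (Y i) (X i) r s = Idn C (X i)" if "i \<in> I" for i
    using assms(3)[OF that] by (auto simp: retract_of_def)
  then obtain s r where [simp]: "\<And>i. i \<in> I \<Longrightarrow> s i \<in> arr C (X i) (Y i)"
      "\<And>i. i \<in> I \<Longrightarrow> r i \<in> arr C (Y i) (X i)"
      "\<And>i. i \<in> I \<Longrightarrow> Comp C (X i) (Y i) (X i) (r i) (s i) = Idn C (X i)"
    by metis
  obtain u where u [simp]: "u \<in> arr C P N"
      "\<And>i. i \<in> I \<Longrightarrow> Comp C (X i) P N u (\<iota> i) = Comp C (X i) (Y i) N (\<kappa> i) (s i)"
    by (rule coproduct_lift[OF P, of N "\<lambda>i. Comp C (X i) (Y i) N (\<kappa> i) (s i)"]) simp_all
  obtain v where v [simp]: "v \<in> arr C N P"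
      "\<And>i. i \<in> I \<Longrightarrow> Comp C (Y i) N P v (\<kappa> i) = Comp C (Y i) (X i) P (\<iota> i) (r i)"
    by (rule coproduct_lift[OF N, of P "\<lambda>i. Comp C (Y i) (X i) P (\<iota> i) (r i)"]) simp_all
  have "Comp C P N P v u = Idn C P"
  proof (rule coproduct_eqI[OF P])
    fix i assume [simp]: "i \<in> I"
    have "Comp C (X i) P P (Comp C P N P v u) (\<iota> i) =
        Comp C (X i) (Y i) P (Comp C (Y i) N P v (\<kappa> i)) (s i)"
      by (simp add: comp_assoc del: v(2))
    also have "\<dots> = Comp C (X i) P P (Idn C P) (\<iota> i)"
      by (simp add: comp_assoc)
    finally show "Comp C (X i) P P (Comp C P N P v u) (\<iota> i) = Comp C (X i) P P (Idn C P) (\<iota> i)" .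
  qed simp_all
  then show ?thesis by (intro retract_ofI[of _ _ u v]) simp_all
qed

text \<open>Lets closure under finite coproducts stand for closure under isomorphism, so that
  membership of a dual module in \<B> can be tested on an isomorphic module.\<close>

lemma iso_singleton_coproduct:
  assumes f: "iso_arrow C X Y f" and [simp]: "X \<in> Obj C" "Y \<in> Obj C"
  shows "is_coproduct C {i} (\<lambda>_. X) Y (\<lambda>_. f)"
proof -
  obtain g where [simp]: "f \<in> arr C X Y" "g \<in> arr C Y X"
    "Comp C X Y X g f = Idn C X" and fg: "Comp C Y X Y f g = Idn C Y"
    using f by (rule isoE)
  have "\<exists>!h. h \<in> arr C Y Z \<and> Comp C X Y Z h f = k"
    if [simp]: "Z \<in> Obj C" "k \<in> arr C X Z" for Z k
  proof (intro ex1I conjI)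
    show "Comp C Y X Z k g \<in> arr C Y Z" by simp
    show "Comp C X Y Z (Comp C Y X Z k g) f = k" by (simp add: comp_assoc)
    fix h assume h: "h \<in> arr C Y Z \<and> Comp C X Y Z h f = k"
    then show "h = Comp C Y X Z k g"
      using right_inverse_cancel[of Z Y X h f g] fg by simp
  qed
  then show ?thesis by (simp add: is_coproduct_def)
qed

lemma closed_finite_coproductsD:
  "\<lbrakk>closed_finite_coproducts C S; finite (I :: nat set); \<And>i. i \<in> I \<Longrightarrow>
      X i \<in> S; is_coproduct C I X P \<iota>\<rbrakk>
     \<Longrightarrow> P \<in> S"
  unfolding closed_finite_coproducts_def by auto

lemma closed_finite_coproducts_iso:
  assumes S: "closed_finite_coproducts C S" and f: "iso_arrow C X Y f" and X: "X \<in> Obj C"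
      and Y: "Y \<in> Obj C"
  shows "X \<in> S \<longleftrightarrow> Y \<in> S"
proof
  show "Y \<in> S" if "X \<in> S"
    by (rule closed_finite_coproductsD[OF S _ _ iso_singleton_coproduct[OF f X Y,
        of 0]]) (use that in simp_all)
  obtain g where g: "iso_arrow C Y X g" using f by (auto simp: iso_arrow_def)
  show "X \<in> S" if "Y \<in> S"
    by (rule closed_finite_coproductsD[OF S _ _ iso_singleton_coproduct[OF g Y X,
        of 0]]) (use that in simp_all)
qed

text \<open>The extension is found in the larger object: extend \<open>s\<close> after
  \<open>f\<close> along \<open>m\<close>, then come back by \<open>r\<close>.\<close>

lemma injective_retract:
  assumes "retract_of C M N" "injective_object C N"
  shows "injective_object C M"
proof -
  obtain s r where [simp]: "M \<in> Obj C" "N \<in> Obj C" "s \<in> arr C M N"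
    "r \<in> arr C N M" "Comp C M N M r s = Idn C M"
    using assms(1) by (rule retract_ofE)
  have "\<exists>g\<in>arr C Y M. Comp C X Y M g m = f"
    if [simp]: "X \<in> Obj C" "Y \<in> Obj C" and m: "mono_arrow C X Y m" and [simp]: "f \<in> arr C X M"
    for X Y m f
  proof -
    have [simp]: "m \<in> arr C X Y" using m by (simp add: mono_arrow_def)
    have "Comp C X M N s f \<in> arr C X N" by simp
    then obtain g where [simp]: "g \<in> arr C Y N" "Comp C X Y N g m = Comp C X M N s f"
      using assms(2) m 
      unfolding injective_object_def by (metis \<open>X \<in> Obj C\<close> \<open>Y \<in> Obj C\<close>)
    have "Comp C X Y M (Comp C Y N M r g) m = f"
      by (simp add: comp_assoc left_inverse_cancel)
    then show ?thesis by (intro bexI[of _ "Comp C Y N M r g"]) simp_all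
  qed
  then show ?thesis by (simp add: injective_object_def)
qed

end


section \<open>Preadditive categories\<close>

locale preadd =
  fixes C :: "('o, 'm, 'z) precat_scheme"
  assumes preadditive: "preadditive C"
begin

sublocale cat C
  using preadditive by unfold_locales (simp add: preadditive_def)

lemma hom_comm_group: "X \<in> Obj C \<Longrightarrow> Y \<in> Obj C \<Longrightarrow> comm_group (Hom C X Y)"
  using preadditive by (simp add: preadditive_def)

lemma hom_group: "X \<in> Obj C \<Longrightarrow> Y \<in> Obj C \<Longrightarrow> group (Hom C X Y)"
  using hom_comm_group comm_group_def by blast

lemma comp_hom_left:
  "\<lbrakk>X \<in> Obj C; Y \<in> Obj C; Z \<in> Obj C; f \<in> arr C X Y\<rbrakk> \<Longrightarrow>
     (\<lambda>g. Comp C X Y Z g f) \<in> hom (Hom C Y Z) (Hom C X Z)"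
  using preadditive by (simp add: preadditive_def)

lemma comp_hom_right:
  "\<lbrakk>X \<in> Obj C; Y \<in> Obj C; Z \<in> Obj C; g \<in> arr C Y Z\<rbrakk> \<Longrightarrow>
     Comp C X Y Z g \<in> hom (Hom C X Y) (Hom C X Z)"
  using preadditive by (simp add: preadditive_def)

lemma comp_group_hom_left:
  "\<lbrakk>X \<in> Obj C; Y \<in> Obj C; Z \<in> Obj C; f \<in> arr C X Y\<rbrakk> \<Longrightarrow>
     group_hom (Hom C Y Z) (Hom C X Z) (\<lambda>g. Comp C X Y Z g f)"
  by (simp add: group_hom_def group_hom_axioms_def hom_group comp_hom_left)

lemma comp_group_hom_right:
  "\<lbrakk>X \<in> Obj C; Y \<in> Obj C; Z \<in> Obj C; g \<in> arr C Y Z\<rbrakk> \<Longrightarrow>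
     group_hom (Hom C X Y) (Hom C X Z) (Comp C X Y Z g)"
  by (simp add: group_hom_def group_hom_axioms_def hom_group comp_hom_right)

lemma one_closed [simp]: "\<lbrakk>X \<in> Obj C; Y \<in> Obj C\<rbrakk> \<Longrightarrow> zero_arr C X Y \<in> arr C X Y"
  by (simp add: hom_group group.is_monoid monoid.one_closed)

lemma mult_closed [simp]:
  "\<lbrakk>X \<in> Obj C; Y \<in> Obj C; f \<in> arr C X Y; g \<in> arr C X Y\<rbrakk> \<Longrightarrow>
     f \<otimes>\<^bsub>Hom C X Y\<^esub> g \<in> arr C X Y"
  by (simp add: hom_group group.is_monoid monoid.m_closed)

lemma inv_closed [simp]:
  "\<lbrakk>X \<in> Obj C; Y \<in> Obj C; f \<in> arr C X Y\<rbrakk> \<Longrightarrow> inv\<^bsub>Hom C X Y\<^esub> f \<in> arr C X Y"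
  by (simp add: hom_group group.inv_closed)

lemma comp_one [simp]:
  assumes "X \<in> Obj C" "Y \<in> Obj C" "Z \<in> Obj C"
  shows "f \<in> arr C X Y \<Longrightarrow> Comp C X Y Z (zero_arr C Y Z) f = zero_arr C X Z"
    and "g \<in> arr C Y Z \<Longrightarrow> Comp C X Y Z g (zero_arr C X Y) = zero_arr C X Z"
  using assms
  by (simp_all add: group_hom.hom_one[OF comp_group_hom_left] group_hom.hom_one[OF
      comp_group_hom_right])

lemma comp_mult:
  assumes "X \<in> Obj C" "Y \<in> Obj C" "Z \<in> Obj C"
  shows "\<lbrakk>f \<in> arr C X Y; g \<in> arr C Y Z; h \<in> arr C Y Z\<rbrakk> \<Longrightarrow>
      Comp C X Y Z (g \<otimes>\<^bsub>Hom C Y Z\<^esub> h) f = Comp C X Y Z g f \<otimes>\<^bsub>Hom C X Z\<^esub> Comp C X Y Z h f"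
    and "\<lbrakk>f \<in> arr C Y Z; g \<in> arr C X Y; h \<in> arr C X Y\<rbrakk> \<Longrightarrow>
      Comp C X Y Z f (g \<otimes>\<^bsub>Hom C X Y\<^esub> h) = Comp C X Y Z f g \<otimes>\<^bsub>Hom C X Z\<^esub> Comp C X Y Z f h"
  using assms
  by (simp_all add: group_hom.hom_mult[OF comp_group_hom_left] group_hom.hom_mult[OF
      comp_group_hom_right])

lemma comp_inv:
  assumes "X \<in> Obj C" "Y \<in> Obj C" "Z \<in> Obj C" "f \<in> arr C X Y" "g \<in> arr C Y Z"
  shows "Comp C X Y Z (inv\<^bsub>Hom C Y Z\<^esub> g) f = inv\<^bsub>Hom C X Z\<^esub> Comp C X Y Z g f"
    and "Comp C X Y Z g (inv\<^bsub>Hom C X Y\<^esub> f) = inv\<^bsub>Hom C X Z\<^esub> Comp C X Y Z g f"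
  using assms
  by (simp_all add: group_hom.hom_inv[OF comp_group_hom_left] group_hom.hom_inv[OF
      comp_group_hom_right])

lemma eq_iff_diff:
  assumes "X \<in> Obj C" "Y \<in> Obj C" "f \<in> arr C X Y" "g \<in> arr C X Y"
  shows "f = g \<longleftrightarrow> f \<otimes>\<^bsub>Hom C X Y\<^esub> inv\<^bsub>Hom C X Y\<^esub> g = zero_arr C X Y"
proof -
  interpret group "Hom C X Y" using assms hom_group by blast
  show ?thesis using assms by (metis inv_equality inv_inv local.inv_closed r_inv)
qed

lemma comp_diff:
  assumes "X \<in> Obj C" "Y \<in> Obj C" "Z \<in> Obj C"
  shows "\<lbrakk>f \<in> arr C X Y; g \<in> arr C Y Z; h \<in> arr C Y Z\<rbrakk> \<Longrightarrow>
      Comp C X Y Z (g \<otimes>\<^bsub>Hom C Y Z\<^esub> inv\<^bsub>Hom C Y Z\<^esub> h) f =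
      Comp C X Y Z g f \<otimes>\<^bsub>Hom C X Z\<^esub> inv\<^bsub>Hom C X Z\<^esub> Comp C X Y Z h f"
    and "\<lbrakk>f \<in> arr C Y Z; g \<in> arr C X Y; h \<in> arr C X Y\<rbrakk> \<Longrightarrow>
      Comp C X Y Z f (g \<otimes>\<^bsub>Hom C X Y\<^esub> inv\<^bsub>Hom C X Y\<^esub> h) =
      Comp C X Y Z f g \<otimes>\<^bsub>Hom C X Z\<^esub> inv\<^bsub>Hom C X Z\<^esub> Comp C X Y Z f h"
  using assms by (simp_all add: comp_mult comp_inv)

lemma diff_eq_iff:
  assumes "X \<in> Obj C" "Y \<in> Obj C" "f \<in> arr C X Y" "g \<in> arr C X Y" "h \<in> arr C X Y"
  shows "f \<otimes>\<^bsub>Hom C X Y\<^esub> inv\<^bsub>Hom C X Y\<^esub> g = h \<longleftrightarrow> f = h \<otimes>\<^bsub>Hom C X Y\<^esub> g"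
proof -
  interpret group "Hom C X Y" using assms by (simp add: hom_group)
  show ?thesis using assms(3-) by (metis inv_solve_right)
qed

lemma mult_one [simp]:
  assumes "X \<in> Obj C" "Y \<in> Obj C" "f \<in> arr C X Y"
  shows "f \<otimes>\<^bsub>Hom C X Y\<^esub> (zero_arr C X Y) = f" "zero_arr C X Y \<otimes>\<^bsub>Hom C X Y\<^esub> f = f"
proof -
  interpret group "Hom C X Y" using assms by (simp add: hom_group)
  show "f \<otimes>\<^bsub>Hom C X Y\<^esub> (zero_arr C X Y) = f" "zero_arr C X Y \<otimes>\<^bsub>Hom C X Y\<^esub> f = f"
    using assms by simp_all
qed

lemma comp_finprod:
  assumes "X \<in> Obj C" "Y \<in> Obj C" "Z \<in> Obj C"
  shows "\<lbrakk>f \<in> arr C X Y; g \<in> I \<rightarrow> arr C Y Z\<rbrakk> \<Longrightarrow>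
      Comp C X Y Z (finprod (Hom C Y Z) g I) f = finprod (Hom C X Z) (\<lambda>i. Comp C X Y Z (g i) f) I"
    and "\<lbrakk>f \<in> arr C Y Z; g \<in> I \<rightarrow> arr C X Y\<rbrakk> \<Longrightarrow>
      Comp C X Y Z f (finprod (Hom C X Y) g I) = finprod (Hom C X Z) (\<lambda>i. Comp C X Y Z f (g i)) I"
proof -
  interpret YZ: comm_group "Hom C Y Z" using assms hom_comm_group by blast
  interpret XY: comm_group "Hom C X Y" using assms hom_comm_group by blast
  interpret XZ: comm_group "Hom C X Z" using assms hom_comm_group by blast
  show "Comp C X Y Z (finprod (Hom C Y Z) g I) f = finprod (Hom C X Z) (\<lambda>i. Comp C X Y Z (g i) f) I"
    if "f \<in> arr C X Y" "g \<in> I \<rightarrow> arr C Y Z"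
    using that assms
  proof (induction I rule: infinite_finite_induct)
    case (insert i I)
    then show ?case
      by (subst YZ.finprod_insert XZ.finprod_insert; simp add: Pi_iff comp_mult)+
  qed simp_all
  show "Comp C X Y Z f (finprod (Hom C X Y) g I) = finprod (Hom C X Z) (\<lambda>i. Comp C X Y Z f (g i)) I"
    if "f \<in> arr C Y Z" "g \<in> I \<rightarrow> arr C X Y"
    using that assms
  proof (induction I rule: infinite_finite_induct)
    case (insert i I)
    then show ?case
      by (subst XY.finprod_insert XZ.finprod_insert; simp add: Pi_iff comp_mult)+
  qed simp_all
qed

text \<open>The mediating map is the sum of the \<open>f i\<close> after \<open>\<pi> i\<close>, and
  composing any candidate with the decomposition \<open>sum\<close> of the identity shows that no
  other is possible. It serves to recognise a coproduct from the maps of a split triangle.\<close>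

lemma biproduct_coproduct:
  assumes I: "finite I" and P: "P \<in> Obj C" and X: "\<And>i. i \<in> I \<Longrightarrow> X i \<in> Obj C"
    and \<iota>: "\<And>i. i \<in> I \<Longrightarrow> \<iota> i \<in> arr C (X i) P"
    and \<pi>: "\<And>i. i \<in> I \<Longrightarrow> \<pi> i \<in> arr C P (X i)"
      "\<And>i. i \<in> I \<Longrightarrow> Comp C (X i) P (X i) (\<pi> i) (\<iota> i) = Idn C (X i)"
      "\<And>i j. i \<in> I \<Longrightarrow> j \<in> I \<Longrightarrow> i \<noteq> j \<Longrightarrow>
        Comp C (X i) P (X j) (\<pi> j) (\<iota> i) = zero_arr C (X i) (X j)"
    and sum: "finprod (Hom C P P) (\<lambda>i. Comp C P (X i) P (\<iota> i) (\<pi> i)) I = Idn C P"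
  shows "is_coproduct C I X P \<iota>"
proof -
  note [simp] = P X \<iota> \<pi>(1)
  have "\<exists>!h. h \<in> arr C P Z \<and> (\<forall>i\<in>I. Comp C (X i) P Z h (\<iota> i) = f i)"
    if Z [simp]: "Z \<in> Obj C" and "\<forall>i\<in>I. f i \<in> arr C (X i) Z" for Z f
  proof -
    have f [simp]: "\<And>i. i \<in> I \<Longrightarrow> f i \<in> arr C (X i) Z" using that by simp
    interpret PZ: comm_group "Hom C P Z" by (rule hom_comm_group) simp_all
    let ?h = "finprod (Hom C P Z) (\<lambda>i. Comp C P (X i) Z (f i) (\<pi> i)) I"
    have h: "?h \<in> arr C P Z" by (rule PZ.finprod_closed) simp
    show ?thesis
    proof (rule ex1I[of _ ?h], intro conjI h ballI)
      fix j assume j [simp]: "j \<in> I"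
      interpret XZ: comm_group "Hom C (X j) Z" by (rule hom_comm_group) simp_all
      have "Comp C (X j) P Z ?h (\<iota> j) = finprod (Hom C (X j) Z) (\<lambda>i. Comp C (X j) P Z
          (Comp C P (X i) Z (f i) (\<pi> i)) (\<iota> j)) I"
        by (rule comp_finprod) simp_all
      also have "\<dots> = finprod (Hom C (X j) Z) (\<lambda>i. if j = i then f j else zero_arr C (X j) Z) I"
        by (rule XZ.finprod_cong') (auto simp: comp_assoc \<pi>)
      also have "\<dots> = f j" using XZ.finprod_singleton[OF j I, of "\<lambda>_. f j"] by simp
      finally show "Comp C (X j) P Z ?h (\<iota> j) = f j" .
    next
      fix k assume k: "k \<in> arr C P Z \<and> (\<forall>i\<in>I. Comp C (X i) P Z k (\<iota> i) = f i)"
      then have "k = Comp C P P Z k (finprod (Hom C P P) (\<lambda>i. Comp C P (X i) P (\<iota> i) (\<pi> i)) I)"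
        by (simp add: sum)
      also have "\<dots> = finprod (Hom C P Z) (\<lambda>i. Comp C P P Z k (Comp C P (X i) P (\<iota> i) (\<pi> i))) I"
        by (rule comp_finprod) (use k in simp_all)
      also have "\<dots> = ?h"
        by (rule PZ.finprod_cong') (use k in \<open>auto simp flip: comp_assoc\<close>)
      finally show "k = ?h" .
    qed
  qed
  then show ?thesis by (simp add: is_coproduct_def)
qed

text \<open>Preadditivity supplies projections for a coproduct over any index set, the infinite
  towers included: zero maps are the off-diagonal components of a cocone into
  \<open>X j\<close>.\<close>

lemma coproduct_proj:
  assumes P: "is_coproduct C I X P \<iota>"
  obtains \<pi> where "\<And>i. i \<in> I \<Longrightarrow> \<pi> i \<in> arr C P (X i)"
    and "\<And>i. i \<in> I \<Longrightarrow> Comp C (X i) P (X i) (\<pi> i) (\<iota> i) = Idn C (X i)"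
    and "\<And>i j. i \<in> I \<Longrightarrow> j \<in> I \<Longrightarrow> i \<noteq> j \<Longrightarrow>
      Comp C (X i) P (X j) (\<pi> j) (\<iota> i) = zero_arr C (X i) (X j)"
proof -
  note [simp] = coproductD[OF P]
  have "\<exists>h. h \<in> arr C P (X j) \<and> (\<forall>i\<in>I. Comp C (X i) P (X j) h (\<iota> i) =
      (if i = j then Idn C (X i) else zero_arr C (X i) (X j)))" if "j \<in> I" for j
  proof (rule coproduct_lift[OF P])
    show "X j \<in> Obj C" using that by simp
    show "(if i = j then Idn C (X i) else zero_arr C (X i) (X j)) \<in> arr C (X i) (X j)"
      if "i \<in> I" for i
      using that \<open>j \<in> I\<close> by simp
  qed blast
  then obtain \<pi> where "\<And>j. j \<in> I \<Longrightarrow> \<pi> j \<in> arr C P (X j) \<and>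
      (\<forall>i\<in>I. Comp C (X i) P (X j) (\<pi> j) (\<iota> i) =
        (if i = j then Idn C (X i) else zero_arr C (X i) (X j)))"
    by metis
  then show ?thesis using that[of \<pi>] by (metis)
qed

text \<open>Both sides have the same restriction to every summand.\<close>

lemma finite_coproduct_sum:
  assumes P: "is_coproduct C I X P \<iota>" and "finite I"
    and \<pi>: "\<And>i. i \<in> I \<Longrightarrow> \<pi> i \<in> arr C P (X i)"
      "\<And>i. i \<in> I \<Longrightarrow> Comp C (X i) P (X i) (\<pi> i) (\<iota> i) = Idn C (X i)"
      "\<And>i j. i \<in> I \<Longrightarrow> j \<in> I \<Longrightarrow> i \<noteq> j \<Longrightarrow>
      Comp C (X i) P (X j) (\<pi> j) (\<iota> i) = zero_arr C (X i) (X j)"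
  shows "finprod (Hom C P P) (\<lambda>i. Comp C P (X i) P (\<iota> i) (\<pi> i)) I = Idn C P"
proof (rule coproduct_eqI[OF P])
  note [simp] = coproductD[OF P]
  show P': "P \<in> Obj C" by simp
  interpret PP: comm_group "Hom C P P" using P' hom_comm_group by blast
  have f: "(\<lambda>i. Comp C P (X i) P (\<iota> i) (\<pi> i)) \<in> I \<rightarrow> arr C P P"
    using \<pi> by auto
  then show "finprod (Hom C P P) (\<lambda>i. Comp C P (X i) P (\<iota> i) (\<pi> i)) I \<in> arr C P P"
    using PP.finprod_closed by blast
  show "Idn C P \<in> arr C P P" by simp
  fix j assume j: "j \<in> I"
  interpret XP: comm_group "Hom C (X j) P" using P' j hom_comm_group by simp
  have "Comp C (X j) P P (finprod (Hom C P P) (\<lambda>i. Comp C P (X i) P (\<iota> i) (\<pi> i)) I) (\<iota> j)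
      = finprod (Hom C (X j) P) (\<lambda>i. Comp C (X j) P P (Comp C P (X i) P (\<iota> i) (\<pi> i)) (\<iota> j)) I"
    using j f by (simp add: comp_finprod)
  also have "\<dots> = finprod (Hom C (X j) P) (\<lambda>i. if j = i then \<iota> i else zero_arr C (X j) P) I"
    using j \<pi> by (intro XP.finprod_cong') (auto simp: comp_assoc)
  also have "\<dots> = \<iota> j"
  proof -
    have "finprod (Hom C (X j) P) (\<lambda>i. if j = i then \<iota> i else zero_arr C (X j) P) I
        = finprod (Hom C (X j) P) (\<lambda>i. if j = i then \<iota> j else zero_arr C (X j) P) I"
      by (rule arg_cong[where f="\<lambda>f. finprod (Hom C (X j) P) f I"]) auto
    then show ?thesis
      using XP.finprod_singleton[OF j \<open>finite I\<close>, of "\<lambda>_. \<iota> j"] j by simp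
  qed
  finally show "Comp C (X j) P P (finprod (Hom C P P) (\<lambda>i. Comp C P (X i) P (\<iota> i) (\<pi> i)) I) (\<iota> j)
      = Comp C (X j) P P (Idn C P) (\<iota> j)"
    using j by simp
qed

end

section \<open>Equivalences of categories\<close>

locale cat_functor = C: cat C + D: cat D
  for C :: "('o, 'm, 'z) precat_scheme" and D :: "('p, 'n, 'y) precat_scheme"
    and F :: "('o, 'm, 'p, 'n) fctr" +
  assumes is_functor: "is_functor C D F"
begin

lemma functor_simps [simp]:
  "X \<in> Obj C \<Longrightarrow> FObj F X \<in> Obj D"
  "X \<in> Obj C \<Longrightarrow> FArr F X X (Idn C X) = Idn D (FObj F X)"
  "\<lbrakk>X \<in> Obj C; Y \<in> Obj C; f \<in> arr C X Y\<rbrakk> \<Longrightarrow>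
     FArr F X Y f \<in> arr D (FObj F X) (FObj F Y)"
  using is_functor by (simp_all add: is_functor_def)

lemma functor_comp:
  "\<lbrakk>X \<in> Obj C; Y \<in> Obj C; Z \<in> Obj C; f \<in> arr C X Y; g \<in> arr C Y Z\<rbrakk> \<Longrightarrow>
     FArr F X Z (Comp C X Y Z g f) =
     Comp D (FObj F X) (FObj F Y) (FObj F Z) (FArr F Y Z g) (FArr F X Y f)"
  using is_functor by (simp add: is_functor_def)

lemma preserves_retract:
  assumes "retract_of C M N"
  shows "retract_of D (FObj F M) (FObj F N)"
proof -
  obtain s r where [simp]: "M \<in> Obj C" "N \<in> Obj C" "s \<in> arr C M N"
    "r \<in> arr C N M" "Comp C M N M r s = Idn C M"
    using assms by (rule C.retract_ofE)
  show ?thesis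
    by (rule D.retract_ofI[of _ _ "FArr F M N s" "FArr F N M r"]) (simp_all flip: functor_comp)
qed

end

text \<open>The shift is an equivalence and need not be invertible on the nose, so desuspension is
  available only in this form: arrows come back uniquely, objects up to isomorphism.\<close>

locale category_equivalence = cat_functor C D F
  for C :: "('o, 'm, 'z) precat_scheme" and D :: "('p, 'n, 'y) precat_scheme"
    and F :: "('o, 'm, 'p, 'n) fctr" +
  assumes faithful: "\<And>X Y f g. \<lbrakk>X \<in> Obj C; Y \<in> Obj C; f \<in> arr C X Y; g \<in> arr C X Y;
      FArr F X Y f = FArr F X Y g\<rbrakk> \<Longrightarrow> f = g"
    and full: "\<And>X Y g. \<lbrakk>X \<in> Obj C; Y \<in> Obj C; g \<in> arr D (FObj F X) (FObj F Y)\<rbrakk> \<Longrightarrow>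
      \<exists>f\<in>arr C X Y. FArr F X Y f = g"
    and ess_surj: "\<And>Y. Y \<in> Obj D \<Longrightarrow> \<exists>X\<in>Obj C. \<exists>f. iso_arrow D (FObj F X) Y f"
begin

lemma fullE:
  assumes "X \<in> Obj C" "Y \<in> Obj C" "g \<in> arr D (FObj F X) (FObj F Y)"
  obtains f where "f \<in> arr C X Y" "FArr F X Y f = g"
  using full[OF assms] by blast

lemma ess_surjE:
  assumes "Y \<in> Obj D"
  obtains X f g where "X \<in> Obj C" "f \<in> arr D (FObj F X) Y" "g \<in> arr D Y (FObj F X)"
    "Comp D (FObj F X) Y (FObj F X) g f = Idn D (FObj F X)" "Comp D Y (FObj F X) Y f g = Idn D Y"
  using ess_surj[OF assms] D.isoE by metis

text \<open>A target \<open>Z\<close> of a cocone is first replaced by an isomorphic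
  \<open>FObj F Z'\<close>. The cocone then comes from \<open>C\<close>, and faithfulness turns
  uniqueness there into uniqueness here.\<close>

lemma preserves_coproduct:
  assumes P: "is_coproduct C I X P \<iota>"
  shows "is_coproduct D I (\<lambda>i. FObj F (X i)) (FObj F P) (\<lambda>i. FArr F (X i) P (\<iota> i))"
proof -
  note [simp] = C.coproductD[OF P]
  have "\<exists>!h. h \<in> arr D (FObj F P) Z \<and>
      (\<forall>i\<in>I. Comp D (FObj F (X i)) (FObj F P) Z h (FArr F (X i) P (\<iota> i)) = f i)"
    if [simp]: "Z \<in> Obj D" and "\<forall>i\<in>I. f i \<in> arr D (FObj F (X i)) Z" for Z f
  proof -
    have f [simp]: "\<And>i. i \<in> I \<Longrightarrow> f i \<in> arr D (FObj F (X i)) Z" using that by blast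
    obtain Z' a b where ab [simp]: "Z' \<in> Obj C" "a \<in> arr D (FObj F Z') Z"
      "b \<in> arr D Z (FObj F Z')"
      "Comp D (FObj F Z') Z (FObj F Z') b a = Idn D (FObj F Z')" "Comp D Z (FObj F Z') Z a b =
          Idn D Z"
      by (rule ess_surjE[of Z]) simp_all
    have "\<forall>i\<in>I. \<exists>f'. f' \<in> arr C (X i) Z' \<and>
        FArr F (X i) Z' f' = Comp D (FObj F (X i)) Z (FObj F Z') b (f i)"
      using full[of "X _" Z' "Comp D (FObj F (X _)) Z (FObj F Z') b (f _)"]
      by (meson C.coproductD D.comp_closed P ab f functor_simps(1) that(1))
    then obtain f' where f' [simp]: "\<And>i. i \<in> I \<Longrightarrow> f' i \<in> arr C (X i) Z'"
        "\<And>i. i \<in> I \<Longrightarrow> FArr F (X i) Z' (f' i) = Comp D (FObj F (X i)) Z (FObj F Z') b (f i)"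
      by metis
    obtain h' where h' [simp]: "h' \<in> arr C P Z'"
        "\<And>i. i \<in> I \<Longrightarrow> Comp C (X i) P Z' h' (\<iota> i) = f' i"
      by (rule C.coproduct_lift[OF P, of Z' f']) simp_all
    show ?thesis
    proof (intro ex1I conjI ballI)
      show "Comp D (FObj F P) (FObj F Z') Z a (FArr F P Z' h') \<in> arr D (FObj F P) Z" by simp
      fix i assume [simp]: "i \<in> I"
      show "Comp D (FObj F (X i)) (FObj F P) Z (Comp D (FObj F P) (FObj F Z') Z a (FArr F P Z' h'))
         (FArr F (X i) P (\<iota> i)) = f i"
        by (simp add: D.comp_assoc D.left_inverse_cancel flip: functor_comp)
    next
      fix h assume h: "h \<in> arr D (FObj F P) Z \<and>
         (\<forall>i\<in>I. Comp D (FObj F (X i)) (FObj F P) Z h (FArr F (X i) P (\<iota> i)) = f i)"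
      then have [simp]: "h \<in> arr D (FObj F P) Z" by simp
      obtain k where k [simp]: "k \<in> arr C P Z'" "FArr F P Z' k =
          Comp D (FObj F P) Z (FObj F Z') b h"
        by (rule fullE[of P Z' "Comp D (FObj F P) Z (FObj F Z') b h"]) simp_all
      have "k = h'"
      proof (rule C.coproduct_eqI[OF P])
        fix i assume [simp]: "i \<in> I"
        have "FArr F (X i) Z' (Comp C (X i) P Z' k (\<iota> i)) = FArr F (X i) Z' (f' i)"
          using h by (simp add: functor_comp D.comp_assoc)
        then have "Comp C (X i) P Z' k (\<iota> i) = f' i"
          by (intro faithful[of "X i" Z']) simp_all
        then show "Comp C (X i) P Z' k (\<iota> i) = Comp C (X i) P Z' h' (\<iota> i)" by simp
      qed simp_all
      then have "Comp D (FObj F P) (FObj F Z') Z a (FArr F P Z' h') =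
          Comp D (FObj F P) (FObj F Z') Z a (Comp D (FObj F P) Z (FObj F Z') b h)"
        using k by simp
      then show "h = Comp D (FObj F P) (FObj F Z') Z a (FArr F P Z' h')"
        by (simp add: D.left_inverse_cancel)
    qed
  qed
  then show ?thesis by (simp add: is_coproduct_def)
qed

text \<open>The coproduct in \<open>D\<close> may consist of arbitrary objects \<open>Y i\<close>
  and \<open>N\<close>, with isomorphisms \<alpha> and \<beta> from values of \<open>F\<close>. This
  is the situation when a coproduct is desuspended.\<close>

lemma reflects_coproduct:
  assumes N: "is_coproduct D I Y N \<kappa>" and P [simp]: "P \<in> Obj C"
    and \<beta> [simp]: "\<beta> \<in> arr D (FObj F P) N" "\<beta>' \<in> arr D N (FObj F P)"
      "Comp D (FObj F P) N (FObj F P) \<beta>' \<beta> = Idn D (FObj F P)" "Comp D N (FObj F P) N \<beta> \<beta>' =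
          Idn D N"
    and X [simp]: "\<And>i. i \<in> I \<Longrightarrow> X i \<in> Obj C"
    and \<alpha> [simp]: "\<And>i. i \<in> I \<Longrightarrow> \<alpha> i \<in> arr D (FObj F (X i)) (Y i)"
      "\<And>i. i \<in> I \<Longrightarrow> \<alpha>' i \<in> arr D (Y i) (FObj F (X i))"
      "\<And>i. i \<in> I \<Longrightarrow> Comp D (FObj F (X i)) (Y i) (FObj F (X i)) (\<alpha>' i) (\<alpha> i) = Idn D (FObj F (X i))"
      "\<And>i. i \<in> I \<Longrightarrow> Comp D (Y i) (FObj F (X i)) (Y i) (\<alpha> i) (\<alpha>' i) = Idn D (Y i)"
    and \<iota> [simp]: "\<And>i. i \<in> I \<Longrightarrow> \<iota> i \<in> arr C (X i) P"
      "\<And>i. i \<in> I \<Longrightarrow> FArr F (X i) P (\<iota> i) =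
        Comp D (FObj F (X i)) N (FObj F P) \<beta>' (Comp D (FObj F (X i)) (Y i) N (\<kappa> i) (\<alpha> i))"
  shows "is_coproduct C I X P \<iota>"
proof -
  note [simp] = D.coproductD[OF N]
  have "\<exists>!h. h \<in> arr C P Z \<and> (\<forall>i\<in>I. Comp C (X i) P Z h (\<iota> i) = f i)"
    if [simp]: "Z \<in> Obj C" and "\<forall>i\<in>I. f i \<in> arr C (X i) Z" for Z f
  proof -
    have [simp]: "\<And>i. i \<in> I \<Longrightarrow> f i \<in> arr C (X i) Z" using that by blast
    obtain k where k [simp]: "k \<in> arr D N (FObj F Z)"
      "\<And>i. i \<in> I \<Longrightarrow> Comp D (Y i) N (FObj F Z) k (\<kappa> i) =
         Comp D (Y i) (FObj F (X i)) (FObj F Z) (FArr F (X i) Z (f i)) (\<alpha>' i)"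
      by (rule D.coproduct_lift[OF N, of "FObj F Z"
            "\<lambda>i. Comp D (Y i) (FObj F (X i)) (FObj F Z) (FArr F (X i) Z (f i)) (\<alpha>' i)"]) simp_all
    obtain h where h [simp]: "h \<in> arr C P Z" "FArr F P Z h = Comp D (FObj F P) N (FObj F Z) k \<beta>"
      by (rule fullE[of P Z "Comp D (FObj F P) N (FObj F Z) k \<beta>"]) simp_all
    show ?thesis
    proof (intro ex1I conjI ballI)
      show "h \<in> arr C P Z" by simp
      fix i assume i [simp]: "i \<in> I"
      have "FArr F (X i) Z (Comp C (X i) P Z h (\<iota> i)) =
          Comp D (FObj F (X i)) (Y i) (FObj F Z) (Comp D (Y i) N (FObj F Z) k (\<kappa> i)) (\<alpha> i)"
        by (simp add: functor_comp D.comp_assoc D.left_inverse_cancel del: k(2))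
      also have "\<dots> = FArr F (X i) Z (f i)" by (simp add: D.comp_assoc)
      finally show "Comp C (X i) P Z h (\<iota> i) = f i"
        by (intro faithful[of "X i" Z]) simp_all
    next
      fix h' assume "h' \<in> arr C P Z \<and> (\<forall>i\<in>I. Comp C (X i) P Z h' (\<iota> i) = f i)"
      then have h' [simp]: "h' \<in> arr C P Z" and fi: "\<And>i. i \<in> I \<Longrightarrow> Comp C (X i) P Z h' (\<iota> i) = f i"
        by simp_all
      have "Comp D N (FObj F P) (FObj F Z) (FArr F P Z h') \<beta>' = k"
      proof (rule D.coproduct_eqI[OF N])
        fix i assume i [simp]: "i \<in> I"
        have "FArr F (X i) Z (f i) =
            Comp D (FObj F (X i)) (FObj F P) (FObj F Z) (FArr F P Z h') (FArr F (X i) P (\<iota> i))"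
          using fi[OF i] by (metis P X \<iota>(1) functor_comp h' i that(1))
        then show "Comp D (Y i) N (FObj F Z) (Comp D N (FObj F P) (FObj F Z) (FArr F P Z h') \<beta>')
            (\<kappa> i) =
            Comp D (Y i) N (FObj F Z) k (\<kappa> i)"
          by (simp add: D.comp_assoc)
      qed simp_all
      then have "FArr F P Z h' = FArr F P Z h"
        using D.right_inverse_cancel[of "FObj F Z" "FObj F P" N "FArr F P Z h'" \<beta>' \<beta>] by simp
      then show "h' = h" by (intro faithful[of P Z]) simp_all
    qed
  qed
  then show ?thesis by (simp add: is_coproduct_def)
qed

end

text \<open>Naturality of \<eta> makes \<open>F\<close> faithful and naturality of \<epsilon> makes
  \<open>G\<close> faithful. Fullness of \<open>F\<close> needs the latter, because a candidate
  preimage can be compared with \<open>g\<close> only after applying \<open>G\<close>.\<close>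

lemma adjoint_equivalence_imp_category_equivalence:
  assumes C: "category C" and D: "category D" and "adjoint_equivalence C D F G"
  shows "category_equivalence C D F"
proof -
  interpret C: cat C by unfold_locales (rule C)
  interpret D: cat D by unfold_locales (rule D)
  interpret F: cat_functor C D F
    by unfold_locales (use assms(3) in \<open>simp add: adjoint_equivalence_def\<close>)
  interpret G: cat_functor D C G
    by unfold_locales (use assms(3) in \<open>simp add: adjoint_equivalence_def\<close>)
  obtain \<eta> \<epsilon> where e: "nat_iso C C id_functor (comp_functor G F) \<eta>"
    "nat_iso D D (comp_functor F G) id_functor \<epsilon>"
    using assms(3) by (auto simp: adjoint_equivalence_def)
  have \<eta>: "iso_arrow C X (FObj G (FObj F X)) (\<eta> X)" if "X \<in> Obj C" for X
    using e(1) that by (simp add: nat_iso_def comp_functor_def id_functor_def)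
  have \<eta>_nat: "Comp C X Y (FObj G (FObj F Y)) (\<eta> Y) f =
      Comp C X (FObj G (FObj F X)) (FObj G (FObj F Y)) (FArr G (FObj F X) (FObj F Y)
          (FArr F X Y f)) (\<eta> X)"
    if "X \<in> Obj C" "Y \<in> Obj C" "f \<in> arr C X Y" for X Y f
    using e(1) that by (simp add: nat_iso_def nat_trans_def comp_functor_def id_functor_def)
  have \<epsilon>: "iso_arrow D (FObj F (FObj G Y)) Y (\<epsilon> Y)" if "Y \<in> Obj D" for Y
    using e(2) that by (simp add: nat_iso_def comp_functor_def id_functor_def)
  have \<epsilon>_nat: "Comp D (FObj F (FObj G X)) (FObj F (FObj G Y)) Y (\<epsilon> Y) (FArr F (FObj G X)
      (FObj G Y) (FArr G X Y f)) =
      Comp D (FObj F (FObj G X)) X Y f (\<epsilon> X)"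
    if "X \<in> Obj D" "Y \<in> Obj D" "f \<in> arr D X Y" for X Y f
    using e(2) that by (simp add: nat_iso_def nat_trans_def comp_functor_def id_functor_def)
  have G_faithful: "f = g"
    if [simp]: "X \<in> Obj D" "Y \<in> Obj D" "f \<in> arr D X Y" "g \<in> arr D X Y"
      and eq: "FArr G X Y f = FArr G X Y g" for X Y f g
  proof -
    obtain k where [simp]: "\<epsilon> X \<in> arr D (FObj F (FObj G X)) X"
        "k \<in> arr D X (FObj F (FObj G X))"
        "Comp D X (FObj F (FObj G X)) X (\<epsilon> X) k = Idn D X"
      using \<epsilon>[of X] by (auto elim: D.isoE)
    let ?X = "FObj F (FObj G X)"
    have *: "Comp D ?X X Y f (\<epsilon> X) = Comp D ?X X Y g (\<epsilon> X)"
      using \<epsilon>_nat[of X Y f] \<epsilon>_nat[of X Y g] eq by simp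
    have "f = Comp D X ?X Y (Comp D ?X X Y f (\<epsilon> X)) k"
      by (simp add: D.right_inverse_cancel)
    also have "\<dots> = Comp D X ?X Y (Comp D ?X X Y g (\<epsilon> X)) k" by (simp only: *)
    also have "\<dots> = g" by (simp add: D.right_inverse_cancel)
    finally show ?thesis .
  qed
  show ?thesis
  proof
    fix X Y f g
    assume [simp]: "X \<in> Obj C" "Y \<in> Obj C" "f \<in> arr C X Y" "g \<in> arr C X Y"
      and eq: "FArr F X Y f = FArr F X Y g"
    obtain k where [simp]: "\<eta> Y \<in> arr C Y (FObj G (FObj F Y))"
        "k \<in> arr C (FObj G (FObj F Y)) Y"
        "Comp C Y (FObj G (FObj F Y)) Y k (\<eta> Y) = Idn C Y"
      using \<eta>[of Y] by (auto elim: C.isoE)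
    let ?Y = "FObj G (FObj F Y)"
    have *: "Comp C X Y ?Y (\<eta> Y) f = Comp C X Y ?Y (\<eta> Y) g"
      using \<eta>_nat[of X Y f] \<eta>_nat[of X Y g] eq by simp
    have "f = Comp C X ?Y Y k (Comp C X Y ?Y (\<eta> Y) f)"
      by (simp add: C.left_inverse_cancel)
    also have "\<dots> = Comp C X ?Y Y k (Comp C X Y ?Y (\<eta> Y) g)" by (simp only: *)
    also have "\<dots> = g" by (simp add: C.left_inverse_cancel)
    finally show "f = g" .
  next
    fix X Y g
    assume [simp]: "X \<in> Obj C" "Y \<in> Obj C" "g \<in> arr D (FObj F X) (FObj F Y)"
    let ?GX = "FObj G (FObj F X)" and ?GY = "FObj G (FObj F Y)"
    obtain k where [simp]: "\<eta> Y \<in> arr C Y ?GY"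
        "k \<in> arr C ?GY Y" "Comp C ?GY Y ?GY (\<eta> Y) k = Idn C ?GY"
      using \<eta>[of Y] by (auto elim: C.isoE)
    obtain l where [simp]: "\<eta> X \<in> arr C X ?GX"
        "l \<in> arr C ?GX X" "Comp C ?GX X ?GX (\<eta> X) l = Idn C ?GX"
      using \<eta>[of X] by (auto elim: C.isoE)
    let ?g = "FArr G (FObj F X) (FObj F Y) g"
    \<comment> \<open>The candidate is G g conjugated by \<eta>. Naturality yields G(F f) = G g, and
      faithfulness of \<open>G\<close> removes the outer \<open>G\<close>.\<close>
    let ?f = "Comp C X ?GY Y k (Comp C X ?GX ?GY ?g (\<eta> X))"
    let ?h = "FArr G (FObj F X) (FObj F Y) (FArr F X Y ?f)"
    have *: "Comp C X ?GX ?GY ?h (\<eta> X) = Comp C X ?GX ?GY ?g (\<eta> X)"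
      using \<eta>_nat[of X Y ?f] C.left_inverse_cancel[of X ?GY Y "Comp C X ?GX ?GY ?g (\<eta> X)" k "\<eta> Y"]
        by simp
    have "?h = Comp C ?GX X ?GY (Comp C X ?GX ?GY ?h (\<eta> X)) l"
      by (simp add: C.right_inverse_cancel)
    also have "\<dots> = Comp C ?GX X ?GY (Comp C X ?GX ?GY ?g (\<eta> X)) l" by (simp only: *)
    also have "\<dots> = ?g" by (simp add: C.right_inverse_cancel)
    finally have "FArr F X Y ?f = g" by (intro G_faithful[of "FObj F X" "FObj F Y"]) simp_all
    then show "\<exists>f\<in>arr C X Y. FArr F X Y f = g" by (intro bexI[of _ ?f]) simp_all
  next
    fix Y assume "Y \<in> Obj D"
    then show "\<exists>X\<in>Obj C. \<exists>f. iso_arrow D (FObj F X) Y f"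
      using \<epsilon> G.functor_simps(1) by blast
  qed
qed

section \<open>Triangulated categories\<close>

locale triang =
  fixes T :: "('o, 'm, 'z) tricat_scheme"
  assumes triangulated: "triangulated T"

sublocale triang \<subseteq> preadd T
  using triangulated by unfold_locales (simp add: triangulated_def additive_category_def)

sublocale triang \<subseteq> Sh: category_equivalence T T "Shift T"
proof -
  obtain G where "adjoint_equivalence T T (Shift T) G"
    using triangulated by (auto simp: triangulated_def)
  then show "category_equivalence T T (Shift T)"
    using adjoint_equivalence_imp_category_equivalence category by blast
qed

context triang
begin

lemma finite_coproduct_exists:
  assumes "finite (I :: nat set)" "\<And>i. i \<in> I \<Longrightarrow> X i \<in> Obj T"
  obtains P \<iota> where "is_coproduct T I X P \<iota>"
  using triangulated assms unfolding triangulated_def additive_category_def by metis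

lemma zero_objectD:
  assumes "zero_object T Z" "X \<in> Obj T"
  shows "f \<in> arr T Z X \<Longrightarrow> f = zero_arr T Z X" "f \<in> arr T X Z \<Longrightarrow> f = zero_arr T X Z"
proof -
  have Z: "Z \<in> Obj T" "\<exists>!f. f \<in> arr T Z X" "\<exists>!f. f \<in> arr T X Z"
    using assms by (auto simp: zero_object_def)
  show "f \<in> arr T Z X \<Longrightarrow> f = zero_arr T Z X"
    using Z(2) one_closed[OF Z(1) assms(2)] by auto
  show "f \<in> arr T X Z \<Longrightarrow> f = zero_arr T X Z"
    using Z(3) one_closed[OF assms(2) Z(1)] by auto
qed

lemma zero_objectI:
  assumes [simp]: "Z \<in> Obj T" and 1: "Idn T Z = zero_arr T Z Z"
  shows "zero_object T Z"
proof -
  have "(\<exists>!f. f \<in> arr T Z X) \<and> (\<exists>!f. f \<in> arr T X Z)" if [simp]: "X \<in> Obj T" for X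
  proof (intro conjI ex1I)
    fix f assume f: "f \<in> arr T Z X"
    then have "f = Comp T Z Z X f (Idn T Z)" by simp
    also have "\<dots> = zero_arr T Z X" using f by (simp only: 1) simp
    finally show "f = zero_arr T Z X" .
  next
    fix f assume f: "f \<in> arr T X Z"
    then have "f = Comp T X Z Z (Idn T Z) f" by simp
    also have "\<dots> = zero_arr T X Z" using f by (simp only: 1) simp
    finally show "f = zero_arr T X Z" .
  qed simp_all
  then show ?thesis by (simp add: zero_object_def)
qed

lemma zero_object_exists:
  obtains Z where "zero_object T Z" "Z \<in> Obj T"
proof -
  obtain Z \<iota> where "is_coproduct T ({} :: nat set) (\<lambda>_. undefined) Z \<iota>"
    by (rule finite_coproduct_exists[of "{}" "\<lambda>_. undefined"]) auto
  then have Z: "Z \<in> Obj T" "\<exists>!h. h \<in> arr T Z Z"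
    by (auto simp: is_coproduct_def)
  then have "zero_object T Z"
    by (intro zero_objectI) auto
  then show ?thesis using Z that by blast
qed

lemma shift_hom:
  "X \<in> Obj T \<Longrightarrow> Y \<in> Obj T \<Longrightarrow> ShA T X Y \<in> hom (Hom T X Y) (Hom T (ShO T X) (ShO T Y))"
  using triangulated by (simp add: triangulated_def additive_functor_def)

lemma shift_group_hom:
  "X \<in> Obj T \<Longrightarrow> Y \<in> Obj T \<Longrightarrow> group_hom (Hom T X Y) (Hom T (ShO T X) (ShO T Y)) (ShA T X Y)"
  by (simp add: group_hom_def group_hom_axioms_def hom_group shift_hom)

lemma shift_one [simp]:
  "X \<in> Obj T \<Longrightarrow> Y \<in> Obj T \<Longrightarrow> ShA T X Y (zero_arr T X Y) = zero_arr T (ShO T X) (ShO T Y)"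
  by (simp add: group_hom.hom_one[OF shift_group_hom])

lemma shift_inv:
  "X \<in> Obj T \<Longrightarrow> Y \<in> Obj T \<Longrightarrow> f \<in> arr T X Y \<Longrightarrow>
    ShA T X Y (inv\<^bsub>Hom T X Y\<^esub> f) = inv\<^bsub>Hom T (ShO T X) (ShO T Y)\<^esub> ShA T X Y f"
  by (simp add: group_hom.hom_inv[OF shift_group_hom])

lemma inv_inv [simp]:
  assumes "X \<in> Obj T" "Y \<in> Obj T" "f \<in> arr T X Y"
  shows "inv\<^bsub>Hom T X Y\<^esub> (inv\<^bsub>Hom T X Y\<^esub> f) = f"
  using assms by (simp add: group.inv_inv hom_group)

lemma inv_one [simp]:
  assumes "X \<in> Obj T" "Y \<in> Obj T"
  shows "inv\<^bsub>Hom T X Y\<^esub> (zero_arr T X Y) = zero_arr T X Y"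
  using assms by (simp add: monoid.inv_one group.is_monoid hom_group)

lemma shift_zero_object:
  assumes "zero_object T Z"
  shows "zero_object T (ShO T Z)"
proof (rule zero_objectI)
  have Z: "Z \<in> Obj T" using assms by (simp add: zero_object_def)
  then show "ShO T Z \<in> Obj T" by simp
  have 1: "Idn T Z = zero_arr T Z Z" using zero_objectD(1)[OF assms Z] Z by simp
  have "Idn T (ShO T Z) = ShA T Z Z (Idn T Z)" using Z by simp
  also have "\<dots> = zero_arr T (ShO T Z) (ShO T Z)" using Z by (simp only: 1 shift_one)
  finally show "Idn T (ShO T Z) = zero_arr T (ShO T Z) (ShO T Z)" .
qed

section \<open>The triangle axioms as rules\<close>

lemma triD:
  assumes "(X, Y, Z, u, v, w) \<in> Tri T"
  shows "X \<in> Obj T" "Y \<in> Obj T" "Z \<in> Obj T"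
    "u \<in> arr T X Y" "v \<in> arr T Y Z" "w \<in> arr T Z (ShO T X)"
proof -
  have "\<forall>t\<in>Tri T. candidate_triangle T t"
    using triangulated unfolding triangulated_def by (elim conjE)
  from this[rule_format, OF assms] have "candidate_triangle T (X, Y, Z, u, v, w)" .
  then show "X \<in> Obj T" "Y \<in> Obj T" "Z \<in> Obj T"
    "u \<in> arr T X Y" "v \<in> arr T Y Z" "w \<in> arr T Z (ShO T X)"
    by (simp_all add: candidate_triangle_def)
qed

lemma tri_rotate_iff:
  assumes "X \<in> Obj T" "Y \<in> Obj T" "Z \<in> Obj T"
    "u \<in> arr T X Y" "v \<in> arr T Y Z" "w \<in> arr T Z (ShO T X)"
  shows "(X, Y, Z, u, v, w) \<in> Tri T \<longleftrightarrow>
    (Y, Z, ShO T X, v, w, inv\<^bsub>Hom T (ShO T X) (ShO T Y)\<^esub> (ShA T X Y u)) \<in> Tri T"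
proof -
  have "\<forall>X Y Z u v w. candidate_triangle T (X, Y, Z, u, v, w) \<longrightarrow>
        ((X, Y, Z, u, v, w) \<in> Tri T \<longleftrightarrow>
         (Y, Z, ShO T X, v, w, inv\<^bsub>Hom T (ShO T X) (ShO T Y)\<^esub> (ShA T X Y u)) \<in> Tri T)"
    using triangulated unfolding triangulated_def by (elim conjE)
  from this[rule_format, of X Y Z u v w] show ?thesis
    using assms by (simp only: candidate_triangle_def prod.case simp_thms)
qed

lemma tri_rotate:
  "(X, Y, Z, u, v, w) \<in> Tri T \<Longrightarrow>
    (Y, Z, ShO T X, v, w, inv\<^bsub>Hom T (ShO T X) (ShO T Y)\<^esub> (ShA T X Y u)) \<in> Tri T"
  by (rule tri_rotate_iff[THEN iffD1]) (simp_all add: triD)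

lemma tri_idn:
  assumes "X \<in> Obj T" "zero_object T Z"
  shows "(X, X, Z, Idn T X, zero_arr T X Z, zero_arr T Z (ShO T X)) \<in> Tri T"
proof -
  have "\<forall>X\<in>Obj T. \<forall>Z. zero_object T Z \<longrightarrow>
        (X, X, Z, Idn T X, zero_arr T X Z, zero_arr T Z (ShO T X)) \<in> Tri T"
    using triangulated unfolding triangulated_def by (elim conjE)
  then show ?thesis using assms by blast
qed

lemma tri_complete:
  assumes "X \<in> Obj T" "Y \<in> Obj T" "u \<in> arr T X Y"
  obtains Z v w where "(X, Y, Z, u, v, w) \<in> Tri T"
proof -
  have "\<forall>X\<in>Obj T. \<forall>Y\<in>Obj T. \<forall>u\<in>arr T X Y. \<exists>Z v w. (X, Y, Z, u, v, w) \<in> Tri T"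
    using triangulated unfolding triangulated_def by (elim conjE)
  then show ?thesis using assms that by blast
qed

lemma tri_fill:
  assumes "(X, Y, Z, u, v, w) \<in> Tri T" "(X', Y', Z', u', v', w') \<in> Tri T"
    "f \<in> arr T X X'" "g \<in> arr T Y Y'" "Comp T X Y Y' g u = Comp T X X' Y' u' f"
  obtains h where "h \<in> arr T Z Z'"
    "Comp T Y Z Z' h v = Comp T Y Y' Z' v' g"
    "Comp T Z (ShO T X) (ShO T X') (ShA T X X' f) w = Comp T Z Z' (ShO T X') w' h"
proof -
  have "\<forall>X Y Z u v w X' Y' Z' u' v' w'. \<forall>f\<in>arr T X X'. \<forall>g\<in>arr T Y Y'.
        (X, Y, Z, u, v, w) \<in> Tri T \<and> (X', Y', Z', u', v', w') \<in> Tri T \<and>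
        Comp T X Y Y' g u = Comp T X X' Y' u' f \<longrightarrow>
        (\<exists>h. triangle_morphism T (X, Y, Z, u, v, w) (X', Y', Z', u', v', w') f g h)"
    using triangulated unfolding triangulated_def by (elim conjE)
  from this[THEN spec[of _ X], THEN spec[of _ Y], THEN spec[of _ Z], THEN spec[of _ u],
      THEN spec[of _ v], THEN spec[of _ w], THEN spec[of _ X'], THEN spec[of _ Y'],
          THEN spec[of _ Z'], THEN spec[of _ u'], THEN spec[of _ v'], THEN spec[of _ w']] obtain h
              where
    "triangle_morphism T (X, Y, Z, u, v, w) (X', Y', Z', u', v', w') f g h"
    using assms by auto
  then show ?thesis by (intro that[of h]) (simp_all add: triangle_morphism_def)
qed

lemma tri_iso:
  assumes "(X, Y, Z, u, v, w) \<in> Tri T"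
    "X' \<in> Obj T" "Y' \<in> Obj T" "Z' \<in> Obj T"
    "u' \<in> arr T X' Y'" "v' \<in> arr T Y' Z'" "w' \<in> arr T Z' (ShO T X')"
    "triangle_morphism T (X, Y, Z, u, v, w) (X', Y', Z', u', v', w') f g h"
    "iso_arrow T X X' f" "iso_arrow T Y Y' g" "iso_arrow T Z Z' h"
  shows "(X', Y', Z', u', v', w') \<in> Tri T"
proof -
  have "\<forall>X Y Z u v w X' Y' Z' u' v' w' f g h.
        (X, Y, Z, u, v, w) \<in> Tri T \<and> candidate_triangle T (X', Y', Z', u', v', w') \<and>
        triangle_morphism T (X, Y, Z, u, v, w) (X', Y', Z', u', v', w') f g h \<and>
        iso_arrow T X X' f \<and> iso_arrow T Y Y' g \<and> iso_arrow T Z Z' h \<longrightarrow>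
        (X', Y', Z', u', v', w') \<in> Tri T"
    using triangulated unfolding triangulated_def by (elim conjE)
  from this[rule_format, of X Y Z u v w X' Y' Z' u' v' w' f g h] assms show ?thesis
    by (simp add: candidate_triangle_def)
qed

section \<open>Exactness of Hom on triangles, split triangles and fibres\<close>

lemma tri_comp_zero:
  assumes t: "(X, Y, Z, u, v, w) \<in> Tri T"
  shows "Comp T X Y Z v u = zero_arr T X Z"
proof -
  note [simp] = triD[OF t]
  obtain N where N: "zero_object T N" "N \<in> Obj T" by (rule zero_object_exists)
  \<comment> \<open>Comparison with the identity triangle on \<open>X\<close> factors v u through
    the zero object \<open>N\<close>.\<close>
  obtain h where h: "h \<in> arr T N Z" "Comp T X N Z h (zero_arr T X N) = Comp T X Y Z v u"
    by (rule tri_fill[OF tri_idn[OF triD(1)[OF t] N(1)] t, of "Idn T X" u]) simp_all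
  then show ?thesis using N by simp
qed

text \<open>This is exactness of Hom(-, E) at \<open>Y\<close>. The pair (0, f) is completed to a
  morphism into a triangle with vertices N, E, E, where \<open>N\<close> is zero; its third
  component is the extension.\<close>

lemma tri_extend:
  assumes t: "(X, Y, Z, u, v, w) \<in> Tri T" and [simp]: "E \<in> Obj T" "f \<in> arr T Y E"
    and fu: "Comp T X Y E f u = zero_arr T X E"
  obtains g where "g \<in> arr T Z E" "Comp T Y Z E g v = f"
proof -
  note [simp] = triD[OF t]
  obtain N where N: "zero_object T N" and [simp]: "N \<in> Obj T" by (rule zero_object_exists)
  \<comment> \<open>Obtained backwards by rotation from the identity triangle on \<open>E\<close>:
    the third vertex there has to be the shift of \<open>N\<close>, which is again zero.\<close>
  have "(N, E, E, zero_arr T N E, Idn T E, zero_arr T E (ShO T N)) \<in> Tri T"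
    using tri_rotate_iff[of N E E "zero_arr T N E" "Idn T E" "zero_arr T E (ShO T N)"]
      tri_idn[of E, OF _ shift_zero_object[OF N]] by simp
  from tri_fill[OF t this, of "zero_arr T X N" f] fu obtain h where
    "h \<in> arr T Z E" "Comp T Y Z E h v = Comp T Y E E (Idn T E) f"
    by auto
  then show ?thesis using that by simp
qed

lemma tri_lift:
  assumes t: "(X, Y, Z, u, v, w) \<in> Tri T" and [simp]: "E \<in> Obj T" "f \<in> arr T E Y"
    and vf: "Comp T E Y Z v f = zero_arr T E Z"
  obtains g where "g \<in> arr T E X" "Comp T E X Y u g = f"
proof -
  note [simp] = triD[OF t]
  obtain N where N: "zero_object T N" and [simp]: "N \<in> Obj T" by (rule zero_object_exists)
  have "(E, N, ShO T E, zero_arr T E N, zero_arr T N (ShO T E),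
      inv\<^bsub>Hom T (ShO T E) (ShO T E)\<^esub> (ShA T E E (Idn T E))) \<in> Tri T"
    by (rule tri_rotate[OF tri_idn[OF _ N]]) simp
  from tri_fill[OF this tri_rotate[OF t], of f "zero_arr T N Z"] vf obtain h where
    h [simp]: "h \<in> arr T (ShO T E) (ShO T X)" and
    "Comp T (ShO T E) (ShO T E) (ShO T Y) (ShA T E Y f) (inv\<^bsub>Hom T (ShO T E) (ShO T E)\<^esub>
        (ShA T E E (Idn T E)))
      = Comp T (ShO T E) (ShO T X) (ShO T Y) (inv\<^bsub>Hom T (ShO T X) (ShO T Y)\<^esub> ShA T X Y u) h"
    by auto
  then have "inv\<^bsub>Hom T (ShO T E) (ShO T Y)\<^esub> (ShA T E Y f) =
      inv\<^bsub>Hom T (ShO T E) (ShO T Y)\<^esub> (Comp T (ShO T E) (ShO T X) (ShO T Y) (ShA T X Y u) h)"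
    by (simp add: comp_inv)
  then have *: "ShA T E Y f = Comp T (ShO T E) (ShO T X) (ShO T Y) (ShA T X Y u) h"
    using inv_inv[of "ShO T E" "ShO T Y"]
      by (metis Sh.functor_simps(1,3) assms(2,3) comp_closed h triD(1,2,4)[OF t])
  obtain g where g [simp]: "g \<in> arr T E X" "ShA T E X g = h"
    by (rule Sh.fullE[of E X h]) simp_all
  have "Comp T E X Y u g = f"
    by (rule Sh.faithful[of E Y]) (simp_all add: * Sh.functor_comp)
  then show ?thesis using that g by blast
qed

text \<open>In an additive category a retract need not have a complement. Here the complement is the
  cone \<open>K\<close> of the section \<open>s\<close>, because the triangle on a split
  monomorphism splits.\<close>

lemma retract_imp_coproduct:
  assumes "retract_of T M N"
  obtains K \<iota> where "is_coproduct T UNIV (\<lambda>b. if b then M else K) N \<iota>"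
proof -
  obtain s r where [simp]: "M \<in> Obj T" "N \<in> Obj T" "s \<in> arr T M N" "r \<in> arr T N M"
    and rs [simp]: "Comp T M N M r s = Idn T M"
    using assms by (rule retract_ofE)
  obtain K v w where t: "(M, N, K, s, v, w) \<in> Tri T" by (rule tri_complete[of M N s]) simp_all
  note [simp] = triD[OF t]
  have t': "(N, K, ShO T M, v, w, inv\<^bsub>Hom T (ShO T M) (ShO T N)\<^esub> ShA T M N s) \<in> Tri T"
    by (rule tri_rotate[OF t])
  \<comment> \<open>1 - s r vanishes on \<open>s\<close> and hence factors through the cone; the
    factor \<open>p\<close> becomes the inclusion of the complement.\<close>
  have "Comp T M N N (Comp T N M N s r) s = s" by (simp add: comp_assoc)
  then have "Comp T M N N (Idn T N \<otimes>\<^bsub>Hom T N N\<^esub> inv\<^bsub>Hom T N N\<^esub> Comp T N M N s r) s = zero_arr T M N"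
    by (simp add: comp_mult comp_inv flip: eq_iff_diff)
  then obtain p where p [simp]: "p \<in> arr T K N"
    and pv: "Comp T N K N p v = Idn T N \<otimes>\<^bsub>Hom T N N\<^esub> inv\<^bsub>Hom T N N\<^esub> Comp T N M N s r"
    by (rule tri_extend[OF t, of N, rotated 2]) simp_all
  have "inv\<^bsub>Hom T K (ShO T N)\<^esub> (Comp T K (ShO T M) (ShO T N) (ShA T M N s) w) =
      zero_arr T K (ShO T N)"
    using tri_comp_zero[OF tri_rotate[OF t']] by (simp add: comp_inv)
  then have "inv\<^bsub>Hom T K (ShO T N)\<^esub> (inv\<^bsub>Hom T K (ShO T N)\<^esub> (Comp T K (ShO T M) (ShO T N)
      (ShA T M N s) w)) = zero_arr T K (ShO T N)"
    by simp
  then have sw: "Comp T K (ShO T M) (ShO T N) (ShA T M N s) w = zero_arr T K (ShO T N)" by simp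
  \<comment> \<open>\<Sigma>s has the left inverse \<Sigma>r, and \<Sigma>s after \<open>w\<close>
    is zero, so \<open>w\<close> is zero. By exactness \<open>v\<close> is then right cancellable,
    and the identities for \<open>p\<close> can be checked after composing with
    \<open>v\<close>.\<close>
  have "w = Comp T K (ShO T N) (ShO T M) (ShA T N M r) (Comp T K (ShO T M) (ShO T N) (ShA T M N s)
      w)"
    by (rule left_inverse_cancel[symmetric]) (simp_all flip: Sh.functor_comp)
  then have w: "w = zero_arr T K (ShO T M)" by (simp add: sw)
  have v_epi: "f = zero_arr T K E"
    if [simp]: "E \<in> Obj T" "f \<in> arr T K E" and fv: "Comp T N K E f v = zero_arr T N E" for E f
  proof -
    obtain g where "g \<in> arr T (ShO T M) E" "Comp T K (ShO T M) E g w = f"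
      by (rule tri_extend[OF t' _ _ fv]) simp_all
    then show ?thesis by (simp add: w)
  qed
  have vs: "Comp T M N K v s = zero_arr T M K" by (rule tri_comp_zero[OF t])
  have rp: "Comp T K N M r p = zero_arr T K M"
  proof (rule v_epi)
    have "Comp T N N M r (Comp T N M N s r) = r" by (simp add: left_inverse_cancel)
    then show "Comp T N K M (Comp T K N M r p) v = zero_arr T N M"
      by (simp add: comp_assoc pv comp_mult comp_inv flip: eq_iff_diff)
  qed simp_all
  have vp: "Comp T K N K v p = Idn T K"
  proof -
    have "Comp T N N K v (Comp T N M N s r) = zero_arr T N K"
      using vs by (simp flip: comp_assoc)
    then have "Comp T N K K (Comp T K N K v p) v = v"
      by (simp add: comp_assoc pv comp_mult comp_inv)
    then have "Comp T K N K v p \<otimes>\<^bsub>Hom T K K\<^esub> inv\<^bsub>Hom T K K\<^esub> Idn T K = zero_arr T K K"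
      by (intro v_epi) (simp_all add: comp_mult comp_inv flip: eq_iff_diff)
    then show ?thesis by (subst eq_iff_diff) simp_all
  qed
  interpret NN: comm_group "Hom T N N" by (rule hom_comm_group) simp_all
  have "is_coproduct T UNIV (\<lambda>b. if b then M else K) N (\<lambda>b. if b then s else p)"
    by (rule biproduct_coproduct[where \<pi> = "\<lambda>b. if b then r else v"])
      (auto simp: rs vp vs rp UNIV_bool pv NN.m_assoc)
  then show ?thesis by (rule that)
qed

text \<open>TR1 completes a morphism to the right only. The third vertex is desuspended, which is
  possible up to isomorphism, and the triangle is moved to the replacement before it is rotated
  back.\<close>

lemma tri_fibre:
  assumes [simp]: "X \<in> Obj T" "Y \<in> Obj T" "p \<in> arr T X Y"
  obtains W k w where "(W, X, Y, k, p, w) \<in> Tri T"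
proof -
  obtain Z v w where t: "(X, Y, Z, p, v, w) \<in> Tri T"
    by (rule tri_complete[of X Y p]) simp_all
  note [simp] = triD[OF t]
  obtain W a b where ab [simp]: "W \<in> Obj T" "a \<in> arr T (ShO T W) Z"
    "b \<in> arr T Z (ShO T W)"
    "Comp T (ShO T W) Z (ShO T W) b a = Idn T (ShO T W)" "Comp T Z (ShO T W) Z a b = Idn T Z"
    by (rule Sh.ess_surjE[of Z]) simp_all
  let ?w = "Comp T (ShO T W) Z (ShO T X) w a" and ?v = "Comp T Y Z (ShO T W) b v"
  obtain k where k [simp]: "k \<in> arr T W X" "ShA T W X k = ?w"
    by (rule Sh.fullE[of W X ?w]) simp_all
  have iso: "iso_arrow T V V (Idn T V)" if "V \<in> Obj T" for V
    using that by (auto simp: iso_arrow_def intro!: bexI[of _ "Idn T V"])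
  have "(X, Y, ShO T W, p, ?v, ?w) \<in> Tri T"
  proof (rule tri_iso[OF t])
    show "triangle_morphism T (X, Y, Z, p, v, w) (X, Y, ShO T W, p, ?v, ?w) (Idn T X) (Idn T Y) b"
      by (simp add: triangle_morphism_def right_inverse_cancel)
    show "iso_arrow T Z (ShO T W) b"
      by (auto simp: iso_arrow_def intro!: bexI[of _ a])
  qed (simp_all add: iso)
  \<comment> \<open>Rotation negates the shifted map, so the first map has to be minus
    \<open>k\<close>.\<close>
  then have "(W, X, Y, inv\<^bsub>Hom T W X\<^esub> k, p, ?v) \<in> Tri T"
    by (subst tri_rotate_iff) (simp_all add: shift_inv)
  then show ?thesis using that by blast
qed

end

section \<open>Smallness\<close>

lemma small_image:
  assumes "small u A"
  shows "small u (f ` A)"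
  using assms card_of_image ordLeq_ordLess_trans unfolding small_def by blast

lemma small_subset:
  assumes "small u A" "B \<subseteq> A"
  shows "small u B"
  using assms card_of_mono1 ordLeq_ordLess_trans unfolding small_def by blast

text \<open>Coproducts in \<open>T\<close> and compactness are stated for index sets inside the
  universe type; this brings any small index set there.\<close>

lemma small_bij:
  assumes "small TYPE('u) A"
  obtains I :: "'u set" and b where "bij_betw b I A" "small TYPE('u) I"
proof -
  have "|A| \<le>o |UNIV :: 'u set|" using assms ordLess_imp_ordLeq by (auto simp: small_def)
  then obtain f :: "'a \<Rightarrow> 'u" where "inj_on f A" using card_of_ordLeq[of A "UNIV :: 'u set"] by auto
  then have "bij_betw (inv_into A f) (f ` A) A" by (simp add: bij_betw_inv_into inj_on_imp_bij_betw)
  then show ?thesis using that small_image[OF assms] by blast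
qed

lemma small_nat:
  assumes "is_universe TYPE('u)"
  shows "small TYPE('u) (UNIV :: nat set)"
  using assms by (simp add: is_universe_def)

lemma small_Un:
  assumes "is_universe TYPE('u)" "small TYPE('u) A" "small TYPE('u) B"
  shows "small TYPE('u) (A \<union> B)"
proof -
  have "\<not> finite (UNIV :: 'u set)"
    using small_nat[OF assms(1)] ordLess_imp_ordLeq card_of_ordLeq_finite infinite_UNIV_nat
    unfolding small_def by blast
  then show ?thesis
    using assms(2,3) card_of_Un_ordLess_infinite unfolding small_def by blast
qed

text \<open>The cover of an object is indexed by pairs of a compact object and a map. The universe
  axioms speak of subsets of \<open>'u\<close> only, so pairs are coded by an injection from pairs
  over \<open>'u\<close> into \<open>'u\<close>, which exists because \<open>'u\<close> is
  infinite.\<close>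

lemma small_Sigma:
  assumes u: "is_universe TYPE('u)" and I: "small TYPE('u) I"
      and A: "\<And>i. i \<in> I \<Longrightarrow> small TYPE('u) (A i)"
  shows "small TYPE('u) (SIGMA i:I. A i)"
proof -
  have "\<not> finite (UNIV :: 'u set)"
    using small_nat[OF u] ordLess_imp_ordLeq card_of_ordLeq_finite infinite_UNIV_nat
    unfolding small_def by blast
  then have "|(UNIV :: 'u set) \<times> (UNIV :: 'u set)| \<le>o |UNIV :: 'u set|"
    using card_of_Times_same_infinite ordIso_imp_ordLeq by blast
  then obtain p :: "'u \<times> 'u \<Rightarrow> 'u" where p: "inj p"
    using card_of_ordLeq[of "(UNIV :: 'u set) \<times> (UNIV :: 'u set)" "UNIV :: 'u set"] by auto
  obtain J :: "'u set" and b where b: "bij_betw b J I" "small TYPE('u) J"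
    using small_bij[OF I] .
  have bj: "b j \<in> I" if "j \<in> J" for j using b(1) that by (auto simp: bij_betw_def)
  have "\<exists>(K :: 'u set) c. bij_betw c K (A i) \<and> small TYPE('u) K" if "i \<in> I" for i
    using small_bij[OF A[OF that]] by metis
  then obtain K :: "_ \<Rightarrow> 'u set" and c where
    c: "\<And>i. i \<in> I \<Longrightarrow> bij_betw (c i) (K i) (A i) \<and> small TYPE('u) (K i)" by metis
  let ?B = "\<Union>j\<in>J. (\<lambda>k. p (j, k)) ` K (b j)"
  have "\<forall>(I :: 'u set) (A :: 'u \<Rightarrow> 'u set).
        small TYPE('u) I \<and> (\<forall>i\<in>I. small TYPE('u) (A i)) \<longrightarrow> small TYPE('u) (\<Union>i\<in>I. A i)"
    using u unfolding is_universe_def by (elim conjE)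
  from this[rule_format, of J "\<lambda>j. (\<lambda>k. p (j, k)) ` K (b j)"]
  have "small TYPE('u) ?B"
    using b(2) c bj by (simp add: small_image)
  moreover have "(SIGMA i:I. A i) \<subseteq> (\<lambda>x. case inv_into UNIV p x of (j, k) \<Rightarrow> (b j, c (b j) k)) ` ?B"
  proof
    fix x assume "x \<in> (SIGMA i:I. A i)"
    then obtain i a where x: "x = (i, a)" "i \<in> I" "a \<in> A i" by auto
    obtain j where j: "j \<in> J" "b j = i" using b(1) x(2) by (auto simp: bij_betw_def)
    have "a \<in> c i ` K i" using c[OF x(2)] x(3) by (simp add: bij_betw_def)
    then obtain k where k: "k \<in> K i" "c i k = a" by auto
    have "x = (case inv_into UNIV p (p (j, k)) of (j, k) \<Rightarrow> (b j, c (b j) k))"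
      using p j k x by simp
    moreover have "p (j, k) \<in> ?B" using j k by auto
    ultimately show "x \<in> (\<lambda>x. case inv_into UNIV p x of (j, k) \<Rightarrow> (b j, c (b j) k)) ` ?B"
      by (rule image_eqI)
  qed
  ultimately show ?thesis by (rule small_subset[OF small_image])
qed

lemma (in cat) coproduct_reindex:
  assumes b: "bij_betw b I J"
  shows "is_coproduct C I (\<lambda>i. X (b i)) P (\<lambda>i. \<iota> (b i)) \<longleftrightarrow> is_coproduct C J X P \<iota>"
proof -
  have bI: "b ` I = J" and inv: "\<And>i. i \<in> I \<Longrightarrow> inv_into I b (b i) = i"
    using b by (auto simp: bij_betw_def)
  have ball: "(\<forall>j\<in>J. R j) \<longleftrightarrow> (\<forall>i\<in>I. R (b i))" for R
    using bI by blast
  have "(\<forall>f. (\<forall>i\<in>I. f i \<in> arr C (X (b i)) Z) \<longrightarrow>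
        (\<exists>!h. h \<in> arr C P Z \<and> (\<forall>i\<in>I. Comp C (X (b i)) P Z h (\<iota> (b i)) = f i))) \<longleftrightarrow>
    (\<forall>f. (\<forall>i\<in>I. f (b i) \<in> arr C (X (b i)) Z) \<longrightarrow>
        (\<exists>!h. h \<in> arr C P Z \<and> (\<forall>i\<in>I. Comp C (X (b i)) P Z h (\<iota> (b i)) = f (b i))))" (is "?L \<longleftrightarrow>
            ?R") for Z
  proof
    assume L: ?L
    show ?R
    proof (intro allI impI)
      fix f assume "\<forall>i\<in>I. f (b i) \<in> arr C (X (b i)) Z"
      then show "\<exists>!h. h \<in> arr C P Z \<and> (\<forall>i\<in>I. Comp C (X (b i)) P Z h (\<iota> (b i)) = f (b i))"
        using L[rule_format, of "\<lambda>i. f (b i)"] by simp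
    qed
  next
    assume R: ?R
    show ?L
    proof (intro allI impI)
      fix f assume "\<forall>i\<in>I. f i \<in> arr C (X (b i)) Z"
      then show "\<exists>!h. h \<in> arr C P Z \<and> (\<forall>i\<in>I. Comp C (X (b i)) P Z h (\<iota> (b i)) = f i)"
        using R[rule_format, of "\<lambda>j. f (inv_into I b j)"] inv by simp
    qed
  qed
  then show ?thesis
    unfolding is_coproduct_def ball by simp
qed


section \<open>Compact objects\<close>

text \<open>Compactness is used in the form that these maps generate the group of maps into the
  coproduct. Generation passes along surjective homomorphisms, which suits desuspension better than
  an isomorphism from \<open>sum_group\<close>.\<close>

definition coproduct_maps ::
    "('o, 'm, 'z) precat_scheme \<Rightarrow> 'o \<Rightarrow> 'i set \<Rightarrow> ('i \<Rightarrow> 'o) \<Rightarrow> 'o \<Rightarrow> ('i \<Rightarrow> 'm) \<Rightarrow> 'm set" where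
  "coproduct_maps T C I X P \<iota> =
     (\<Union>i\<in>I. Comp T C (X i) P (\<iota> i) ` arr T C (X i))"

lemma (in preadd) coproduct_maps_closed:
  assumes "is_coproduct C I X P \<iota>" "K \<in> Obj C"
  shows "coproduct_maps C K I X P \<iota> \<subseteq> arr C K P"
  using coproductD[OF assms(1)] assms(2) by (auto simp: coproduct_maps_def)

lemma (in comm_group) finprod_in_subgroup:
  assumes "subgroup H G" "f \<in> A \<rightarrow> H"
  shows "finprod G f A \<in> H"
  using assms(2)
proof (induction A rule: infinite_finite_induct)
  case (insert a A)
  then have f: "f \<in> A \<rightarrow> H" "f a \<in> H" by auto
  then have "f \<in> A \<rightarrow> carrier G" "f a \<in> carrier G" using subgroup.subset[OF assms(1)] by auto
  then show ?case using insert f subgroup.m_closed[OF assms(1)] by simp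
qed (use subgroup.one_closed[OF assms(1)] in auto)

context preadd
begin

lemma compact_object_generate_universe:
  fixes I :: "'m set"
  assumes K: "compact_object C K" and I: "small TYPE('m) I" and P: "is_coproduct C I X P \<iota>"
  shows "arr C K P \<subseteq> generate (Hom C K P) (coproduct_maps C K I X P \<iota>)"
proof
  fix f assume f: "f \<in> arr C K P"
  have [simp]: "K \<in> Obj C" using K by (simp add: compact_object_def)
  note [simp] = coproductD[OF P]
  let ?\<Theta> = "\<lambda>f. gfinprod (Hom C K P) (\<lambda>i. Comp C K (X i) P (\<iota> i) (f i)) I"
  have "?\<Theta> \<in> iso (sum_group I (\<lambda>i. Hom C K (X i))) (Hom C K P)"
    using K I P by (simp add: compact_object_def)
  then have "f \<in> ?\<Theta> ` carrier (sum_group I (\<lambda>i. Hom C K (X i)))"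
    using f by (simp add: iso_def bij_betw_def)
  then obtain g where g: "g \<in> carrier (sum_group I (\<lambda>i. Hom C K (X i)))" and f_eq: "f = ?\<Theta> g"
    by (rule imageE)
  have g': "\<And>i. i \<in> I \<Longrightarrow> g i \<in> arr C K (X i)"
    using g by (subst (asm) carrier_sum_group) (auto simp: hom_group)
  interpret G: comm_group "Hom C K P" by (rule hom_comm_group) simp_all
  let ?S = "coproduct_maps C K I X P \<iota>"
  have S: "subgroup (generate (Hom C K P) ?S) (Hom C K P)"
    by (rule G.generate_is_subgroup[OF coproduct_maps_closed[OF P]]) simp
  have "Comp C K (X i) P (\<iota> i) (g i) \<in> generate (Hom C K P) ?S" if "i \<in> I" for i
    by (rule generate.incl) (use that g' in \<open>auto simp: coproduct_maps_def\<close>)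
  then show "f \<in> generate (Hom C K P) ?S"
    \<comment> \<open>\<open>gfinprod\<close> is a finite product over the support, or one by
      default; both lie in the generated subgroup.\<close>
    unfolding f_eq gfinprod_def
    by (auto intro: subgroup.one_closed[OF S] G.finprod_in_subgroup[OF S])
qed

lemma compact_object_generate:
  assumes K: "compact_object C K" and I: "small TYPE('m) I" and P: "is_coproduct C I X P \<iota>"
  shows "arr C K P \<subseteq> generate (Hom C K P) (coproduct_maps C K I X P \<iota>)"
proof -
  obtain J :: "'m set" and b where b: "bij_betw b J I"
      and J: "small TYPE('m) J" using small_bij[OF I] .
  have "is_coproduct C J (\<lambda>i. X (b i)) P (\<lambda>i. \<iota> (b i))"
    using coproduct_reindex[OF b] P by blast
  from compact_object_generate_universe[OF K J this]
  have "arr C K P \<subseteq>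
      generate (Hom C K P) (coproduct_maps C K J (\<lambda>i. X (b i)) P (\<lambda>i. \<iota> (b i)))" .
  also have "coproduct_maps C K J (\<lambda>i. X (b i)) P (\<lambda>i. \<iota> (b i)) = coproduct_maps C K I X P \<iota>"
    using b by (auto simp: coproduct_maps_def bij_betw_def)
  finally show ?thesis .
qed

text \<open>Generation is surjectivity of the canonical map from the direct sum. Its injectivity
  holds for every object \<open>K\<close>, since the projections of the coproduct recover the
  components.\<close>

lemma compact_objectI:
  assumes [simp]: "K \<in> Obj C" and gen: "\<And>(I :: 'm set) X P \<iota>.
      \<lbrakk>small TYPE('m) I; is_coproduct C I X P \<iota>\<rbrakk> \<Longrightarrow>
      arr C K P \<subseteq> generate (Hom C K P) (coproduct_maps C K I X P \<iota>)"
  shows "compact_object C K"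
  unfolding compact_object_def
proof (intro conjI allI impI)
  fix I :: "'m set" and X P \<iota>
  assume "small TYPE('m) I \<and> is_coproduct C I X P \<iota>"
  then have I: "small TYPE('m) I" and P: "is_coproduct C I X P \<iota>" by auto
  note [simp] = coproductD[OF P]
  interpret G: comm_group "Hom C K P" by (rule hom_comm_group) simp_all
  let ?S = "sum_group I (\<lambda>i. Hom C K (X i))"
  let ?c = "\<lambda>f i. Comp C K (X i) P (\<iota> i) (f i)"
  let ?\<Theta> = "\<lambda>f. gfinprod (Hom C K P) (?c f) I"
  have S: "carrier ?S = {x \<in> \<Pi>\<^sub>E i\<in>I. arr C K (X i). finite {i \<in> I. x i \<noteq> zero_arr C K (X i)}}"
    by (rule carrier_sum_group) (simp add: hom_group)
  have f_closed: "f i \<in> arr C K (X i)" if "f \<in> carrier ?S" "i \<in> I" for f i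
    using that S by auto
  have c: "?c f \<in> I \<rightarrow> arr C K P" if "f \<in> carrier ?S" for f
    using f_closed[OF that] by simp
  have fin: "finite {i \<in> I. ?c f i \<noteq> zero_arr C K P}" if f: "f \<in> carrier ?S" for f
  proof (rule finite_subset)
    show "{i \<in> I. ?c f i \<noteq> zero_arr C K P} \<subseteq> {i \<in> I. f i \<noteq> zero_arr C K (X i)}" by auto
    show "finite {i \<in> I. f i \<noteq> zero_arr C K (X i)}" using f S by simp
  qed
  have hom: "?\<Theta> \<in> hom ?S (Hom C K P)"
  proof (rule homI)
    fix f g assume f: "f \<in> carrier ?S" and g: "g \<in> carrier ?S"
    have "?\<Theta> (f \<otimes>\<^bsub>?S\<^esub> g) = gfinprod (Hom C K P) (\<lambda>i. ?c f i \<otimes>\<^bsub>Hom C K P\<^esub> ?c g i) I"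
    proof -
      have "?c (f \<otimes>\<^bsub>?S\<^esub> g) i = ?c f i \<otimes>\<^bsub>Hom C K P\<^esub> ?c g i" if "i \<in> I" for i
        using that f_closed[OF f that] f_closed[OF g that] by (simp add: comp_mult)
      then show ?thesis
        using c[OF f] c[OF g] by (intro G.gfinprod_cong) (auto simp: simp_implies_def Pi_iff)
    qed
    also have "\<dots> = ?\<Theta> f \<otimes>\<^bsub>Hom C K P\<^esub> ?\<Theta> g"
      by (rule G.gfinprod_distrib) (use f g fin c in auto)
    finally show "?\<Theta> (f \<otimes>\<^bsub>?S\<^esub> g) = ?\<Theta> f \<otimes>\<^bsub>Hom C K P\<^esub> ?\<Theta> g" .
  qed (rule G.gfinprod_closed[OF c])
  interpret \<Theta>: group_hom ?S "Hom C K P" ?\<Theta>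
    using hom by (simp add: group_hom_def group_hom_axioms_def hom_group)
  obtain \<pi> where \<pi> [simp]: "\<And>i. i \<in> I \<Longrightarrow> \<pi> i \<in> arr C P (X i)"
    "\<And>i. i \<in> I \<Longrightarrow> Comp C (X i) P (X i) (\<pi> i) (\<iota> i) = Idn C (X i)"
    "\<And>i j. i \<in> I \<Longrightarrow> j \<in> I \<Longrightarrow> i \<noteq> j \<Longrightarrow>
      Comp C (X i) P (X j) (\<pi> j) (\<iota> i) = zero_arr C (X i) (X j)"
    using coproduct_proj[OF P] by metis
  have inj: "inj_on ?\<Theta> (carrier ?S)"
  proof (rule \<Theta>.inj_on_one_iff[THEN iffD2], intro allI impI)
    fix f assume f: "f \<in> carrier ?S" and 0: "?\<Theta> f = zero_arr C K P"
    have f': "\<And>i. i \<in> I \<Longrightarrow> f i \<in> arr C K (X i)" using f S by auto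
    have "f j = zero_arr C K (X j)" if j [simp]: "j \<in> I" for j
    proof (rule ccontr)
      assume ne: "f j \<noteq> zero_arr C K (X j)"
      let ?A = "{i \<in> I. ?c f i \<noteq> zero_arr C K P}"
      interpret H: comm_group "Hom C K (X j)" by (rule hom_comm_group) simp_all
      have fj: "Comp C K P (X j) (\<pi> j) (?c f j) = f j"
        using f' by (simp add: left_inverse_cancel)
      then have jA: "j \<in> ?A" using ne by auto
      \<comment> \<open>The projection to \<open>X j\<close> kills every term of the sum except the
        one with index \<open>j\<close>, so \<open>f j\<close> would be zero.\<close>
      have "zero_arr C K (X j) = Comp C K P (X j) (\<pi> j) (finprod (Hom C K P) (?c f) ?A)"
        using 0 fin[OF f] by (simp add: gfinprod_def)
      also have "\<dots> = finprod (Hom C K (X j)) (\<lambda>i. Comp C K P (X j) (\<pi> j) (?c f i)) ?A"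
        by (rule comp_finprod) (use f' in auto)
      also have "\<dots> = finprod (Hom C K (X j)) (\<lambda>i. if j = i then f j else zero_arr C K (X j)) ?A"
      proof (rule H.finprod_cong')
        fix i assume "i \<in> ?A"
        then have i [simp]: "i \<in> I" by simp
        show "Comp C K P (X j) (\<pi> j) (?c f i) = (if j = i then f j else zero_arr C K (X j))"
          using f' fj by (auto simp flip: comp_assoc)
      qed (use f' in auto)
      also have "\<dots> = f j"
        using H.finprod_singleton[OF jA fin[OF f], of "\<lambda>_. f j"] f' by simp
      finally show False using ne by simp
    qed
    then show "f = \<one>\<^bsub>?S\<^esub>"
      using f S by (auto simp: PiE_iff extensional_def fun_eq_iff)
  qed
  have "generate (Hom C K P) (coproduct_maps C K I X P \<iota>) \<subseteq> ?\<Theta> ` carrier ?S"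
  proof (rule G.generate_subgroup_incl[OF subsetI \<Theta>.img_is_subgroup])
    fix x assume "x \<in> coproduct_maps C K I X P \<iota>"
    then obtain j g where j [simp]: "j \<in> I" and g [simp]: "g \<in> arr C K (X j)"
      and x: "x = Comp C K (X j) P (\<iota> j) g"
      by (auto simp: coproduct_maps_def)
    let ?f = "\<lambda>i\<in>I. if i = j then g else zero_arr C K (X i)"
    have "{i \<in> I. ?f i \<noteq> zero_arr C K (X i)} \<subseteq> {j}" by auto
    then have "finite {i \<in> I. ?f i \<noteq> zero_arr C K (X i)}" by (rule finite_subset) simp
    moreover have "?f \<in> (\<Pi>\<^sub>E i\<in>I. arr C K (X i))" by simp
    ultimately have f: "?f \<in> carrier ?S" unfolding S by (intro CollectI conjI)
    have "?\<Theta> ?f = gfinprod (Hom C K P) (?c ?f) {j}"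
      using c[OF f] by (intro G.gfinprod_mono_neutral_cong_right) simp_all
    also have "\<dots> = x" using x by simp
    finally show "x \<in> ?\<Theta> ` carrier ?S" using f by (intro image_eqI[of _ _ ?f]) (simp_all only:)
  qed
  then have "?\<Theta> ` carrier ?S = arr C K P"
    using gen[OF I P] \<Theta>.hom_closed by auto
  then show "?\<Theta> \<in> iso ?S (Hom C K P)"
    using hom inj by (simp add: iso_def bij_betw_def)
qed simp

end

context triang
begin

text \<open>Serves to show \<open>L\<close> compact from a compact \<open>K\<close>. A surjective
  homomorphism carries a generating set to a generating set, and \<open>maps\<close> says that maps
  through a single summand stay such.\<close>

lemma compact_generate_transfer:
  assumes K: "compact_object T K" and I: "small TYPE('m) I"
    and P: "is_coproduct T I X P \<iota>" and N: "is_coproduct T I Y N \<kappa>" and L: "L \<in> Obj T"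
    and \<psi>: "\<psi> \<in> hom (Hom T K P) (Hom T L N)"
    and surj: "arr T L N \<subseteq> \<psi> ` arr T K P"
    and maps: "\<And>i g. \<lbrakk>i \<in> I; g \<in> arr T K (X i)\<rbrakk> \<Longrightarrow>
      \<exists>h\<in>arr T L (Y i). \<psi> (Comp T K (X i) P (\<iota> i) g) = Comp T L (Y i) N (\<kappa> i) h"
  shows "arr T L N \<subseteq> generate (Hom T L N) (coproduct_maps T L I Y N \<kappa>)"
proof -
  have [simp]: "K \<in> Obj T" "P \<in> Obj T" "N \<in> Obj T"
    using K coproductD(1)[OF P] coproductD(1)[OF N] by (simp_all add: compact_object_def)
  interpret group_hom "Hom T K P" "Hom T L N" \<psi>
    using \<psi> L by (simp add: group_hom_def group_hom_axioms_def hom_group)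
  have "arr T L N \<subseteq> \<psi> ` generate (Hom T K P) (coproduct_maps T K I X P \<iota>)"
    using surj compact_object_generate[OF K I P] by (rule subset_trans[OF _ image_mono])
  also have "\<dots> = generate (Hom T L N) (\<psi> ` coproduct_maps T K I X P \<iota>)"
    by (rule generate_img[symmetric]) (rule coproduct_maps_closed[OF P], simp)
  also have "\<dots> \<subseteq> generate (Hom T L N) (coproduct_maps T L I Y N \<kappa>)"
  proof (rule H.mono_generate, rule image_subsetI)
    fix x assume "x \<in> coproduct_maps T K I X P \<iota>"
    then obtain i g where i: "i \<in> I" "g \<in> arr T K (X i)" and x: "x = Comp T K (X i) P (\<iota> i) g"
      by (auto simp: coproduct_maps_def)
    show "\<psi> x \<in> coproduct_maps T L I Y N \<kappa>"
      using maps[OF i] i(1) by (auto simp: x coproduct_maps_def)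
  qed
  finally show ?thesis .
qed

text \<open>A coproduct tested by maps from \<Sigma>K is desuspended, together with its summands, to
  one tested by maps from \<open>K\<close>. The result is needed because the shift of the cover of
  an object occurs in its rotated triangle.\<close>

lemma compact_shift:
  assumes K: "compact_object T K"
  shows "compact_object T (ShO T K)"
proof (rule compact_objectI)
  have [simp]: "K \<in> Obj T" using K by (auto simp: compact_object_def)
  show "ShO T K \<in> Obj T" by simp
  fix I :: "'m set" and Y N \<kappa>
  assume I: "small TYPE('m) I" and N: "is_coproduct T I Y N \<kappa>"
  note [simp] = coproductD[OF N]
  obtain P \<beta> \<beta>' where \<beta> [simp]: "P \<in> Obj T" "\<beta> \<in> arr T (ShO T P) N" "\<beta>' \<in> arr T N (ShO T P)"
      "Comp T (ShO T P) N (ShO T P) \<beta>' \<beta> = Idn T (ShO T P)" "Comp T N (ShO T P) N \<beta> \<beta>' = Idn T N"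
    by (rule Sh.ess_surjE[of N]) simp_all
  have "\<exists>X \<alpha> \<alpha>'. X \<in> Obj T \<and> \<alpha> \<in> arr T (ShO T X) (Y i) \<and> \<alpha>' \<in> arr T (Y i) (ShO T X) \<and>
      Comp T (ShO T X) (Y i) (ShO T X) \<alpha>' \<alpha> = Idn T (ShO T X) \<and>
      Comp T (Y i) (ShO T X) (Y i) \<alpha> \<alpha>' = Idn T (Y i)" if "i \<in> I" for i
    by (rule Sh.ess_surjE[of "Y i"]) (use that in auto)
  then obtain X \<alpha> \<alpha>' where \<alpha> [simp]: "\<And>i. i \<in> I \<Longrightarrow> X i \<in> Obj T"
      "\<And>i. i \<in> I \<Longrightarrow> \<alpha> i \<in> arr T (ShO T (X i)) (Y i)"
      "\<And>i. i \<in> I \<Longrightarrow> \<alpha>' i \<in> arr T (Y i) (ShO T (X i))"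
      "\<And>i. i \<in> I \<Longrightarrow> Comp T (ShO T (X i)) (Y i) (ShO T (X i)) (\<alpha>' i) (\<alpha> i) = Idn T (ShO T (X i))"
      "\<And>i. i \<in> I \<Longrightarrow> Comp T (Y i) (ShO T (X i)) (Y i) (\<alpha> i) (\<alpha>' i) = Idn T (Y i)"
    by metis
  let ?c = "\<lambda>i. Comp T (ShO T (X i)) N (ShO T P) \<beta>' (Comp T (ShO T (X i)) (Y i) N (\<kappa> i) (\<alpha> i))"
  have "\<exists>\<iota>. \<iota> \<in> arr T (X i) P \<and> ShA T (X i) P \<iota> = ?c i" if "i \<in> I" for i
    using Sh.full[of "X i" P "?c i"] that by auto
  then obtain \<iota> where \<iota> [simp]: "\<And>i. i \<in> I \<Longrightarrow> \<iota> i \<in> arr T (X i) P"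
      "\<And>i. i \<in> I \<Longrightarrow> ShA T (X i) P (\<iota> i) = ?c i"
    by metis
  have P: "is_coproduct T I X P \<iota>"
    by (rule Sh.reflects_coproduct[OF N, where \<alpha> = \<alpha> and \<alpha>' = \<alpha>' and \<beta> = \<beta> and \<beta>' = \<beta>']) simp_all
  let ?\<psi> = "\<lambda>f. Comp T (ShO T K) (ShO T P) N \<beta> (ShA T K P f)"
  show "arr T (ShO T K) N \<subseteq> generate (Hom T (ShO T K) N) (coproduct_maps T (ShO T K) I Y N \<kappa>)"
  proof (rule compact_generate_transfer[OF K I P N, of _ ?\<psi>])
    show "?\<psi> \<in> hom (Hom T K P) (Hom T (ShO T K) N)"
      using hom_compose[OF shift_hom[of K P] comp_hom_right[of "ShO T K" "ShO T P" N \<beta>]]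
        by (simp add: comp_def)
    show "arr T (ShO T K) N \<subseteq> ?\<psi> ` arr T K P"
    proof
      fix g assume [simp]: "g \<in> arr T (ShO T K) N"
      obtain f where f [simp]: "f \<in> arr T K P" "ShA T K P f = Comp T (ShO T K) N (ShO T P) \<beta>' g"
        by (rule Sh.fullE[of K P "Comp T (ShO T K) N (ShO T P) \<beta>' g"]) simp_all
      show "g \<in> ?\<psi> ` arr T K P"
        by (rule image_eqI[of _ _ f]) (simp_all add: left_inverse_cancel)
    qed
    fix i g assume i [simp]: "i \<in> I" "g \<in> arr T K (X i)"
    show "\<exists>h\<in>arr T (ShO T K) (Y i). ?\<psi> (Comp T K (X i) P (\<iota> i) g) =
        Comp T (ShO T K) (Y i) N (\<kappa> i) h"
      by (rule bexI[of _ "Comp T (ShO T K) (ShO T (X i)) (Y i) (\<alpha> i) (ShA T K (X i) g)"])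
        (simp_all add: Sh.functor_comp comp_assoc left_inverse_cancel)
  qed simp
qed

text \<open>Desuspended generators enter the family that detects isomorphisms. Shifting is a
  bijection from the maps out of \<open>L\<close> to those out of \<Sigma>L, and its inverse carries
  the compactness of \<open>K\<close> over.\<close>

lemma compact_unshift:
  assumes K: "compact_object T K" and [simp]: "L \<in> Obj T"
    and \<alpha> [simp]: "\<alpha> \<in> arr T (ShO T L) K" "\<alpha>' \<in> arr T K (ShO T L)"
      "Comp T (ShO T L) K (ShO T L) \<alpha>' \<alpha> = Idn T (ShO T L)"
  shows "compact_object T L"
proof (rule compact_objectI)
  have [simp]: "K \<in> Obj T" using K by (auto simp: compact_object_def)
  fix I :: "'m set" and X P \<iota>
  assume I: "small TYPE('m) I" and P: "is_coproduct T I X P \<iota>"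
  note [simp] = coproductD[OF P]
  have bij: "bij_betw (ShA T L Z) (arr T L Z) (arr T (ShO T L) (ShO T Z))" if "Z \<in> Obj T" for Z
  proof (rule bij_betwI')
    show "ShA T L Z f \<in> arr T (ShO T L) (ShO T Z)" if "f \<in> arr T L Z" for f
      using that \<open>Z \<in> Obj T\<close> by simp
    show "ShA T L Z f = ShA T L Z g \<longleftrightarrow> f = g" if "f \<in> arr T L Z" "g \<in> arr T L Z" for f g
      using Sh.faithful[of L Z f g] that \<open>Z \<in> Obj T\<close> by auto
    show "\<exists>f\<in>arr T L Z. g = ShA T L Z f" if g: "g \<in> arr T (ShO T L) (ShO T Z)" for g
      by (rule Sh.fullE[OF assms(2) \<open>Z \<in> Obj T\<close> g]) auto
  qed
  let ?u = "\<lambda>Z. inv_into (arr T L Z) (ShA T L Z)"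
  let ?\<psi> = "\<lambda>g. ?u P (Comp T (ShO T L) K (ShO T P) g \<alpha>)"
  have u: "?u Z g \<in> arr T L Z" "ShA T L Z (?u Z g) = g"
    if "Z \<in> Obj T" "g \<in> arr T (ShO T L) (ShO T Z)" for Z g
    using bij[OF that(1)] that(2) by (auto simp: bij_betw_def inv_into_into f_inv_into_f)
  have u_eq: "?u Z (ShA T L Z f) = f" if "Z \<in> Obj T" "f \<in> arr T L Z" for Z f
    using bij[OF that(1)] that(2) by (simp add: bij_betw_def)
  show "arr T L P \<subseteq> generate (Hom T L P) (coproduct_maps T L I X P \<iota>)"
  proof (rule compact_generate_transfer[OF K I Sh.preserves_coproduct[OF P] P, of _ ?\<psi>])
    have iso: "ShA T L P \<in> iso (Hom T L P) (Hom T (ShO T L) (ShO T P))"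
      using bij[of P] shift_hom[of L P] by (simp add: iso_def)
    have "group (Hom T L P)" by (rule hom_group) simp_all
    from group.iso_set_sym[OF this iso] have "?u P \<in> hom (Hom T (ShO T L) (ShO T P)) (Hom T L P)"
      by (simp add: iso_def)
    then show "?\<psi> \<in> hom (Hom T K (ShO T P)) (Hom T L P)"
      using hom_compose[OF comp_hom_left[of "ShO T L" K "ShO T P" \<alpha>]] by (simp add: comp_def)
    show "arr T L P \<subseteq> ?\<psi> ` arr T K (ShO T P)"
    proof
      fix f assume f [simp]: "f \<in> arr T L P"
      show "f \<in> ?\<psi> ` arr T K (ShO T P)"
        by (rule image_eqI[of _ _ "Comp T K (ShO T L) (ShO T P) (ShA T L P f) \<alpha>'"])
          (simp_all add: right_inverse_cancel u_eq)
    qed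
    fix i g assume i [simp]: "i \<in> I" "g \<in> arr T K (ShO T (X i))"
    let ?h = "?u (X i) (Comp T (ShO T L) K (ShO T (X i)) g \<alpha>)"
    have h: "?h \<in> arr T L (X i)" "ShA T L (X i) ?h = Comp T (ShO T L) K (ShO T (X i)) g \<alpha>"
      by (rule u; simp)+
    have "Comp T (ShO T L) K (ShO T P) (Comp T K (ShO T (X i)) (ShO T P) (ShA T (X i) P (\<iota> i)) g)
        \<alpha> =
        ShA T L P (Comp T L (X i) P (\<iota> i) ?h)"
      using h by (simp add: Sh.functor_comp comp_assoc)
    then show "\<exists>h\<in>arr T L (X i).
        ?\<psi> (Comp T K (ShO T (X i)) (ShO T P) (ShA T (X i) P (\<iota> i)) g) = Comp T L (X i) P (\<iota> i) h"
      using h(1) by (intro bexI[of _ ?h]) (simp_all add: u_eq)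
  qed (use assms in simp_all)
qed (use assms in simp)

end

section \<open>Maps into pure injective objects\<close>

lemma (in group_hom) eq_on_generate:
  assumes "group_hom G H k" "A \<subseteq> carrier G" "\<And>a. a \<in> A \<Longrightarrow> h a = k a" "x \<in> generate G A"
  shows "h x = k x"
proof -
  interpret k: group_hom G H k by fact
  have "x \<in> carrier G \<and> h x = k x"
    using assms(4) by induction (use assms(2,3) in auto)
  then show ?thesis ..
qed

context preadd
begin

text \<open>Homomorphisms out of Hom(K, P) are determined on the maps through one summand, since
  these generate. As \<phi> and \<psi> can be any homomorphisms, module maps can be compared with
  morphisms.\<close>

lemma compact_comp_eqI:
  assumes K: "compact_object C K" and I: "small TYPE('m) I" and P: "is_coproduct C I X P \<iota>"
    and E: "E \<in> Obj C" and \<phi>: "\<phi> \<in> hom (Hom C K P) (Hom C K E)"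
        and \<psi>: "\<psi> \<in> hom (Hom C K P) (Hom C K E)"
    and eq: "\<And>i g. i \<in> I \<Longrightarrow> g \<in> arr C K (X i) \<Longrightarrow>
      \<phi> (Comp C K (X i) P (\<iota> i) g) = \<psi> (Comp C K (X i) P (\<iota> i) g)"
    and x: "x \<in> arr C K P"
  shows "\<phi> x = \<psi> x"
proof -
  note [simp] = coproductD[OF P] E
  have [simp]: "K \<in> Obj C" using K by (simp add: compact_object_def)
  interpret group_hom "Hom C K P" "Hom C K E" \<phi>
    using \<phi> by (simp add: group_hom_def group_hom_axioms_def hom_group)
  show ?thesis
  proof (rule eq_on_generate)
    show "group_hom (Hom C K P) (Hom C K E) \<psi>"
      using \<psi> by (simp add: group_hom_def group_hom_axioms_def hom_group)
    show "coproduct_maps C K I X P \<iota> \<subseteq> arr C K P"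
      by (rule coproduct_maps_closed[OF P]) simp
    show "x \<in> generate (Hom C K P) (coproduct_maps C K I X P \<iota>)"
      using compact_object_generate[OF K I P] x by (rule subsetD)
    show "\<phi> a = \<psi> a" if "a \<in> coproduct_maps C K I X P \<iota>" for a
      using that eq by (auto simp: coproduct_maps_def)
  qed
qed

end

text \<open>Morphisms of modules from \<open>yon T X\<close> to \<open>yon T Y\<close>, freed from
  the extensionality that \<open>Mod_category\<close> imposes, so that explicit lambda terms
  qualify.\<close>

definition module_map :: "('o, 'm, 'z) precat_scheme \<Rightarrow> 'o \<Rightarrow> 'o \<Rightarrow> ('o \<Rightarrow> 'm \<Rightarrow> 'm) \<Rightarrow> bool" where
  "module_map T X Y \<phi> \<longleftrightarrow>
     (\<forall>C. compact_object T C \<longrightarrow> \<phi> C \<in> hom (Hom T C X) (Hom T C Y)) \<and>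
     (\<forall>C C' c x. compact_object T C \<and> compact_object T C' \<and>
        c \<in> arr T C C' \<and> x \<in> arr T C' X \<longrightarrow>
        \<phi> C (Comp T C C' X x c) = Comp T C C' Y (\<phi> C' x) c)"

text \<open>
  The injectivity of \<open>\<^bold>yE\<close> enters only in the form that the functor sending \<open>X\<close> to the group of
  module maps from \<open>\<^bold>yX\<close> to \<open>\<^bold>yE\<close> is cohomological.
\<close>

definition extends_module_maps :: "('o, 'm, 'z) tricat_scheme \<Rightarrow> 'o \<Rightarrow> bool" where
  "extends_module_maps T E \<longleftrightarrow>
     (\<forall>X Y Z u v w \<psi>. (X, Y, Z, u, v, w) \<in> Tri T \<and> module_map T Y E \<psi> \<and>
        (\<forall>C x. compact_object T C \<and> x \<in> arr T C X \<longrightarrow>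
           \<psi> C (Comp T C X Y u x) = zero_arr T C E) \<longrightarrow>
        (\<exists>\<psi>'. module_map T Z E \<psi>' \<and>
           (\<forall>C y. compact_object T C \<and> y \<in> arr T C Y \<longrightarrow>
              \<psi>' C (Comp T C Y Z v y) = \<psi> C y)))"

definition detects_isos :: "('o, 'm, 'z) precat_scheme \<Rightarrow> 'o set \<Rightarrow> bool" where
  "detects_isos T S \<longleftrightarrow>
     (\<forall>X\<in>Obj T. \<forall>Y\<in>Obj T. \<forall>f\<in>arr T X Y.
        (\<forall>C\<in>S. bij_betw (Comp T C X Y f) (arr T C X) (arr T C Y)) \<longrightarrow>
        iso_arrow T X Y f)"

locale comp_gen =
  fixes T :: "('o, 'u, 'z) tricat_scheme"
  assumes compactly_generated: "compactly_generated T"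
    and universe: "is_universe TYPE('u)"

sublocale comp_gen \<subseteq> triang T
  using compactly_generated by unfold_locales (simp add: compactly_generated_def)

context preadd
begin

lemma compact_obj [simp]: "compact_object C K \<Longrightarrow> K \<in> Obj C"
  by (simp add: compact_object_def)

lemma module_mapD:
  assumes "module_map C X Y \<phi>" "compact_object C K"
  shows "\<phi> K \<in> hom (Hom C K X) (Hom C K Y)"
    and "x \<in> arr C K X \<Longrightarrow> \<phi> K x \<in> arr C K Y"
    and "\<lbrakk>compact_object C L; c \<in> arr C L K; x \<in> arr C K X\<rbrakk> \<Longrightarrow>
      \<phi> L (Comp C L K X x c) = Comp C L K Y (\<phi> K x) c"
  using assms by (auto simp: module_map_def hom_def)

lemma module_map_one:
  assumes "module_map C X Y \<phi>" "compact_object C K" "X \<in> Obj C" "Y \<in> Obj C"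
  shows "\<phi> K (zero_arr C K X) = zero_arr C K Y"
  using hom_one[OF module_mapD(1)[OF assms(1,2)]] assms by (simp add: hom_group)

lemma module_map_comp:
  assumes "X \<in> Obj C" "Y \<in> Obj C" "f \<in> arr C X Y"
  shows "module_map C X Y (\<lambda>K. Comp C K X Y f)"
  using assms by (simp add: module_map_def comp_hom_right comp_assoc)

text \<open>The Yoneda lemma on each compact summand gives the component
  \<open>\<phi> (F i) (\<iota> i)\<close> of \<open>f\<close>. Compactness of the test object
  extends the agreement from single summands to all of \<open>P\<close>.\<close>

lemma module_map_lift_coproduct:
  assumes I: "small TYPE('m) I" and P: "is_coproduct C I F P \<iota>"
      and F: "\<And>i. i \<in> I \<Longrightarrow> compact_object C (F i)"
    and E [simp]: "E \<in> Obj C" and \<phi>: "module_map C P E \<phi>"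
  obtains f where "f \<in> arr C P E"
    "\<And>K x. compact_object C K \<Longrightarrow> x \<in> arr C K P \<Longrightarrow> \<phi> K x = Comp C K P E f x"
proof -
  note [simp] = coproductD[OF P] F
  have [simp]: "\<phi> (F i) (\<iota> i) \<in> arr C (F i) E" if "i \<in> I" for i
    by (rule module_mapD(2)[OF \<phi>]) (use that in simp_all)
  obtain f where f [simp]: "f \<in> arr C P E"
    "\<And>i. i \<in> I \<Longrightarrow> Comp C (F i) P E f (\<iota> i) = \<phi> (F i) (\<iota> i)"
    by (rule coproduct_lift[OF P E, of "\<lambda>i. \<phi> (F i) (\<iota> i)"]) simp_all
  have "\<phi> K x = Comp C K P E f x" if K [simp]: "compact_object C K" and x: "x \<in> arr C K P" for K x
  proof (rule compact_comp_eqI[OF K I P E module_mapD(1)[OF \<phi> K] comp_hom_right _ x])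
    fix i g assume i [simp]: "i \<in> I" "g \<in> arr C K (F i)"
    have "\<phi> K (Comp C K (F i) P (\<iota> i) g) = Comp C K (F i) E (\<phi> (F i) (\<iota> i)) g"
      by (rule module_mapD(3)[OF \<phi>]) simp_all
    also have "\<dots> = Comp C K P E f (Comp C K (F i) P (\<iota> i) g)"
      by (simp flip: comp_assoc)
    finally show "\<phi> K (Comp C K (F i) P (\<iota> i) g) = Comp C K P E f (Comp C K (F i) P (\<iota> i) g)" .
  qed simp_all
  then show ?thesis using that f(1) by blast
qed

end

section \<open>Small coproducts, a family detecting isomorphisms, and ghost covers\<close>

context comp_gen
begin

lemma small_hom: "X \<in> Obj T \<Longrightarrow> Y \<in> Obj T \<Longrightarrow> small TYPE('u) (arr T X Y)"
  using compactly_generated by (simp add: compactly_generated_def)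

lemma small_coproduct_exists:
  assumes J: "small TYPE('u) J" and X: "\<And>j. j \<in> J \<Longrightarrow> X j \<in> Obj T"
  obtains P \<iota> where "is_coproduct T J X P \<iota>"
proof -
  obtain I :: "'u set" and b where b: "bij_betw b I J"
      and I: "small TYPE('u) I" using small_bij[OF J] .
  have "\<forall>(I :: 'u set) X. small TYPE('u) I \<and> (\<forall>i\<in>I. X i \<in> Obj T) \<longrightarrow> (\<exists>P \<iota>. is_coproduct T I X P \<iota>)"
    using compactly_generated by (simp add: compactly_generated_def)
  moreover have "\<forall>i\<in>I. X (b i) \<in> Obj T" using b X by (auto simp: bij_betw_def)
  ultimately obtain P \<iota> where P: "is_coproduct T I (\<lambda>i. X (b i)) P \<iota>" using I by metis
  have inv: "\<And>i. i \<in> I \<Longrightarrow> inv_into I b (b i) = i" using b by (auto simp: bij_betw_def)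
  have "is_coproduct T I (\<lambda>i. X (b i)) P (\<lambda>i. (\<iota> \<circ> inv_into I b) (b i))"
    using P inv by (simp add: is_coproduct_def)
  then have "is_coproduct T J X P (\<iota> \<circ> inv_into I b)"
    by (rule coproduct_reindex[OF b, THEN iffD1])
  then show ?thesis using that by blast
qed

text \<open>The generators detect only zero objects. To see from Hom(C, f) that the cone of
  \<open>f\<close> vanishes at \<open>C\<close>, injectivity is needed on maps from the desuspension
  of \<open>C\<close>; hence the family of all generators and their desuspensions.\<close>

lemma conservative_family:
  obtains S where "small TYPE('u) S" "\<And>C. C \<in> S \<Longrightarrow> compact_object T C"
    "detects_isos T S"
proof -
  obtain G where G: "small TYPE('u) G" "\<And>C. C \<in> G \<Longrightarrow> compact_object T C"
    and zero: "\<And>X. X \<in> Obj T \<Longrightarrow> \<forall>C\<in>G. arr T C X = {zero_arr T C X} \<Longrightarrow> zero_object T X"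
    using compactly_generated unfolding compactly_generated_def by auto
  have "\<exists>L \<alpha> \<alpha>'. L \<in> Obj T \<and> \<alpha> \<in> arr T (ShO T L) C \<and> \<alpha>' \<in> arr T C (ShO T L) \<and>
      Comp T (ShO T L) C (ShO T L) \<alpha>' \<alpha> = Idn T (ShO T L) \<and>
      Comp T C (ShO T L) C \<alpha> \<alpha>' = Idn T C" if "C \<in> G" for C
    by (rule Sh.ess_surjE[of C]) (use that G in auto)
  then obtain L \<alpha> \<alpha>' where L [simp]: "\<And>C. C \<in> G \<Longrightarrow> L C \<in> Obj T"
      "\<And>C. C \<in> G \<Longrightarrow> \<alpha> C \<in> arr T (ShO T (L C)) C"
      "\<And>C. C \<in> G \<Longrightarrow> \<alpha>' C \<in> arr T C (ShO T (L C))"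
      "\<And>C. C \<in> G \<Longrightarrow> Comp T (ShO T (L C)) C (ShO T (L C)) (\<alpha>' C) (\<alpha> C) = Idn T (ShO T (L C))"
      "\<And>C. C \<in> G \<Longrightarrow> Comp T C (ShO T (L C)) C (\<alpha> C) (\<alpha>' C) = Idn T C"
    by metis
  let ?S = "G \<union> L ` G"
  have small: "small TYPE('u) ?S"
    by (intro small_Un universe small_image G)
  have compact: "compact_object T C" if "C \<in> ?S" for C
  proof -
    have "compact_object T (L C)" if "C \<in> G" for C
      by (rule compact_unshift[of C "L C" "\<alpha> C" "\<alpha>' C"]) (use that G in simp_all)
    then show ?thesis using that G(2) by auto
  qed
  \<comment> \<open>The vanishing of the cone is used only for a right inverse. A right inverse is
    again bijective on the family, so it has a right inverse itself, and \<open>f\<close> is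
    invertible.\<close>
  have split: "\<exists>g\<in>arr T Y X. Comp T Y X Y f g = Idn T Y"
    if [simp]: "X \<in> Obj T" "Y \<in> Obj T" "f \<in> arr T X Y"
      and bij: "\<And>C. C \<in> ?S \<Longrightarrow> bij_betw (Comp T C X Y f) (arr T C X) (arr T C Y)"
    for X Y f
  proof -
    obtain Z v w where t: "(X, Y, Z, f, v, w) \<in> Tri T"
      by (rule tri_complete[of X Y f]) simp_all
    note [simp] = triD[OF t]
    let ?m = "inv\<^bsub>Hom T (ShO T X) (ShO T Y)\<^esub> ShA T X Y f"
    have t': "(Y, Z, ShO T X, v, w, ?m) \<in> Tri T" by (rule tri_rotate[OF t])
    have "Comp T Z (ShO T X) (ShO T Y) ?m w = zero_arr T Z (ShO T Y)"
      by (rule tri_comp_zero[OF tri_rotate[OF t']])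
    then have "inv\<^bsub>Hom T Z (ShO T Y)\<^esub> (inv\<^bsub>Hom T Z (ShO T Y)\<^esub> Comp T Z (ShO T X) (ShO T Y)
        (ShA T X Y f) w) =
        zero_arr T Z (ShO T Y)"
      by (simp add: comp_inv)
    then have fw: "Comp T Z (ShO T X) (ShO T Y) (ShA T X Y f) w = zero_arr T Z (ShO T Y)"
      by simp
    have "zero_object T Z"
    proof (rule zero)
      show "\<forall>C\<in>G. arr T C Z = {zero_arr T C Z}"
      proof
        fix C assume C [simp]: "C \<in> G"
        have [simp]: "C \<in> Obj T" using G(2)[OF C] by simp
        have "z = zero_arr T C Z" if z [simp]: "z \<in> arr T C Z" for z
        proof -
          let ?L = "ShO T (L C)"
          let ?wz = "Comp T C Z (ShO T X) w z"
          \<comment> \<open>w z composed with \<alpha> desuspends to \<open>s\<close>. Since f s is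
            zero and \<open>f\<close> is injective on maps from \<open>L C\<close>, first
            \<open>s\<close> and then w z vanish, so \<open>z\<close> lifts along
            \<open>v\<close>.\<close>
          obtain s where s [simp]: "s \<in> arr T (L C) X"
            "ShA T (L C) X s = Comp T ?L C (ShO T X) ?wz (\<alpha> C)"
            by (rule Sh.fullE[of "L C" X "Comp T ?L C (ShO T X) ?wz (\<alpha> C)"]) simp_all
          have "ShA T (L C) Y (Comp T (L C) X Y f s) =
              Comp T ?L C (ShO T Y) (Comp T C Z (ShO T Y) (Comp T Z (ShO T X) (ShO T Y)
                  (ShA T X Y f) w) z) (\<alpha> C)"
            by (simp add: Sh.functor_comp comp_assoc)
          also have "\<dots> = ShA T (L C) Y (Comp T (L C) X Y f (zero_arr T (L C) X))"
            by (simp add: fw)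
          finally have eq: "Comp T (L C) X Y f s = Comp T (L C) X Y f (zero_arr T (L C) X)"
            by (rule Sh.faithful[rotated 4]) simp_all
          have inj: "inj_on (Comp T (L C) X Y f) (arr T (L C) X)"
            using bij[of "L C"] by (simp add: bij_betw_def)
          have s1: "s = zero_arr T (L C) X"
            by (rule inj_onD[OF inj eq]) simp_all
          have "?wz = Comp T C ?L (ShO T X) (Comp T ?L C (ShO T X) ?wz (\<alpha> C)) (\<alpha>' C)"
            by (simp add: right_inverse_cancel)
          also have "Comp T ?L C (ShO T X) ?wz (\<alpha> C) = zero_arr T ?L (ShO T X)"
            using s(2) by (simp add: s1)
          finally have "?wz = zero_arr T C (ShO T X)" by simp
          then obtain z' where z' [simp]: "z' \<in> arr T C Y" "Comp T C Y Z v z' = z"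
            by (rule tri_lift[OF t', of C z, rotated 2]) simp_all
          have "z' \<in> Comp T C X Y f ` arr T C X"
            using bij[of C] by (simp add: bij_betw_def)
          then obtain z'' where z'' [simp]: "z'' \<in> arr T C X"
              and eq: "z' = Comp T C X Y f z''" by (rule imageE)
          have "z = Comp T C X Z (Comp T X Y Z v f) z''"
            using z'(2) by (simp add: eq comp_assoc)
          then show ?thesis by (simp add: tri_comp_zero[OF t])
        qed
        then show "arr T C Z = {zero_arr T C Z}"
          using one_closed[of C Z] by auto
      qed
    qed simp
    then have "Comp T Y Y Z v (Idn T Y) = zero_arr T Y Z"
      by (intro zero_objectD(2)) simp_all
    then obtain g where "g \<in> arr T Y X" "Comp T Y X Y f g = Idn T Y"
      by (rule tri_lift[OF t, of Y "Idn T Y", rotated 2]) simp_all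
    then show ?thesis by (rule bexI[rotated])
  qed
  have "iso_arrow T X Y f"
    if X [simp]: "X \<in> Obj T" "Y \<in> Obj T" "f \<in> arr T X Y"
      and bij: "\<And>C. C \<in> ?S \<Longrightarrow> bij_betw (Comp T C X Y f) (arr T C X) (arr T C Y)"
    for X Y f
  proof -
    obtain g where g [simp]: "g \<in> arr T Y X" and fg: "Comp T Y X Y f g = Idn T Y"
      using split[OF X bij] by auto
    have "bij_betw (Comp T C Y X g) (arr T C Y) (arr T C X)" if C: "C \<in> ?S" for C
    proof -
      have [simp]: "C \<in> Obj T" using compact[OF C] by simp
      have fgx: "Comp T C X Y f (Comp T C Y X g x) = x" if "x \<in> arr T C Y" for x
        using that fg by (simp add: left_inverse_cancel)
      have inj: "inj_on (Comp T C X Y f) (arr T C X)"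
        using bij[OF C] by (simp add: bij_betw_def)
      show ?thesis
      proof (rule bij_betw_byWitness[where f' = "Comp T C X Y f"])
        show "\<forall>y\<in>arr T C X. Comp T C Y X g (Comp T C X Y f y) = y"
        proof
          fix y assume y: "y \<in> arr T C X"
          then have "Comp T C X Y f (Comp T C Y X g (Comp T C X Y f y)) = Comp T C X Y f y"
            using fgx by simp
          from inj_onD[OF inj this] show "Comp T C Y X g (Comp T C X Y f y) = y"
            using y by simp
        qed
      qed (use fgx in auto)
    qed
    from split[OF X(2,1) g this] obtain g' where g' [simp]: "g' \<in> arr T X Y"
      and gg': "Comp T X Y X g g' = Idn T X" by auto
    have "g' = Comp T X X Y f (Comp T X Y X g g')"
      using fg by (simp add: left_inverse_cancel del: comp_idn)
    then have "g' = f" by (simp add: gg')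
    then show ?thesis unfolding iso_arrow_def using fg gg' g by auto
  qed
  then have "detects_isos T ?S" by (simp add: detects_isos_def)
  with small compact show ?thesis by (rule that)
qed

text \<open>
  For a tower of maps \<open>a n\<close> that vanish on a conservative family of compact objects, the map
  \<open>1 - s\<close> on the coproduct of the tower acts as the identity on that family.
\<close>

lemma ghost_tower:
  assumes S: "\<And>C. C \<in> S \<Longrightarrow> compact_object T C"
    and cons: "detects_isos T S"
    and X [simp]: "\<And>n :: nat. X n \<in> Obj T" "\<And>n. a n \<in> arr T (X n) (X (Suc n))"
    and ghost: "\<And>n C x. \<lbrakk>C \<in> S; x \<in> arr T C (X n)\<rbrakk> \<Longrightarrow>
      Comp T C (X n) (X (Suc n)) (a n) x = zero_arr T C (X (Suc n))"
  obtains P \<iota> s where "is_coproduct T UNIV X P \<iota>" "s \<in> arr T P P"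
    "\<And>n. Comp T (X n) P P s (\<iota> n) = Comp T (X n) (X (Suc n)) P (\<iota> (Suc n)) (a n)"
    "\<forall>E\<in>Obj T. \<forall>f\<in>arr T P E. \<exists>h\<in>arr T P E. h = f \<otimes>\<^bsub>Hom T P E\<^esub> Comp T P P E h s"
    "\<forall>E\<in>Obj T. \<forall>h\<in>arr T P E. h = Comp T P P E h s \<longrightarrow> h = zero_arr T P E"
    "\<forall>C\<in>Obj T. \<forall>x\<in>arr T C P. \<exists>y\<in>arr T C P. y = x \<otimes>\<^bsub>Hom T C P\<^esub> Comp T C P P s y"
proof -
  obtain P \<iota> where P: "is_coproduct T (UNIV :: nat set) X P \<iota>"
    by (rule small_coproduct_exists[of UNIV X]) (simp_all add: small_nat universe)
  have [simp]: "P \<in> Obj T" "\<And>n. \<iota> n \<in> arr T (X n) P" using coproductD[OF P] by auto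
  obtain s where s [simp]: "s \<in> arr T P P"
    and s_\<iota>: "\<And>n. Comp T (X n) P P s (\<iota> n) = Comp T (X n) (X (Suc n)) P (\<iota> (Suc n)) (a n)"
    by (rule coproduct_lift[OF P, of P "\<lambda>n. Comp T (X n) (X (Suc n)) P (\<iota> (Suc n)) (a n)"]) simp_all
  let ?t = "Idn T P \<otimes>\<^bsub>Hom T P P\<^esub> inv\<^bsub>Hom T P P\<^esub> s"
  have "iso_arrow T P P ?t"
  proof (rule cons[unfolded detects_isos_def, rule_format])
    fix C assume C: "C \<in> S"
    have K: "compact_object T C" by (rule S[OF C])
    have [simp]: "C \<in> Obj T" using K by simp
    \<comment> \<open>On each summand \<open>s\<close> is a map of the tower followed by an
      injection, so it is zero on maps from \<open>C\<close>; compactness of \<open>C\<close>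
      extends this to the coproduct.\<close>
    have "Comp T C P P s x = zero_arr T C P" if "x \<in> arr T C P" for x
    proof (rule compact_comp_eqI[OF K small_nat[OF universe] P,
          where \<phi> = "Comp T C P P s" and \<psi> = "\<lambda>_. zero_arr T C P"])
      show "(\<lambda>x. zero_arr T C P) \<in> hom (Hom T C P) (Hom T C P)" by (simp add: hom_def)
      fix n g assume [simp]: "g \<in> arr T C (X n)"
      have "Comp T C P P s (Comp T C (X n) P (\<iota> n) g) =
          Comp T C (X n) P (Comp T (X n) P P s (\<iota> n)) g" by (simp add: comp_assoc)
      also have "\<dots> = Comp T C (X (Suc n)) P (\<iota> (Suc n)) (Comp T C (X n) (X (Suc n)) (a n) g)"
        by (simp add: s_\<iota> comp_assoc)
      also have "\<dots> = zero_arr T C P" by (simp add: ghost[OF C])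
      finally show "Comp T C P P s (Comp T C (X n) P (\<iota> n) g) = zero_arr T C P" .
    qed (use that in \<open>simp_all add: comp_hom_right\<close>)
    then have "Comp T C P P ?t x = x" if "x \<in> arr T C P" for x
      using that by (simp add: comp_diff)
    then show "bij_betw (Comp T C P P ?t) (arr T C P) (arr T C P)"
      by (intro bij_betw_byWitness[where f' = "\<lambda>x. x"]) auto
  qed simp_all
  then obtain t' where [simp]: "t' \<in> arr T P P" "Comp T P P P t' ?t = Idn T P"
      "Comp T P P P ?t t' = Idn T P"
    by (rule isoE)
  show ?thesis
  \<comment> \<open>The three conclusions come from the inverse \<open>t'\<close> of 1 - s: the
    solution f t', cancellation of 1 - s, and the solution t' x.\<close>
  proof (rule that[OF P s s_\<iota>]; intro ballI impI)
    show "\<exists>h\<in>arr T P E. h = f \<otimes>\<^bsub>Hom T P E\<^esub> Comp T P P E h s"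
      if [simp]: "E \<in> Obj T" "f \<in> arr T P E" for E f
    proof
      let ?h = "Comp T P P E f t'"
      show h: "?h \<in> arr T P E" by simp
      have "Comp T P P E ?h ?t = f" by (rule right_inverse_cancel) simp_all
      then have "?h \<otimes>\<^bsub>Hom T P E\<^esub> inv\<^bsub>Hom T P E\<^esub> Comp T P P E ?h s = f"
        using comp_diff(2)[of P P E ?h "Idn T P" s] by simp
      then show "?h = f \<otimes>\<^bsub>Hom T P E\<^esub> Comp T P P E ?h s"
        by (subst (asm) diff_eq_iff) simp_all
    qed
    show "h = zero_arr T P E"
      if [simp]: "E \<in> Obj T" "h \<in> arr T P E" and eq: "h = Comp T P P E h s" for E h
    proof -
      have "Comp T P P E h ?t = h \<otimes>\<^bsub>Hom T P E\<^esub> inv\<^bsub>Hom T P E\<^esub> Comp T P P E h s"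
        using comp_diff(2)[of P P E h "Idn T P" s] by simp
      also have "\<dots> = zero_arr T P E"
        using eq by (subst eq_iff_diff[symmetric]) simp_all
      finally have 1: "Comp T P P E h ?t = zero_arr T P E" .
      have "h = Comp T P P E (Comp T P P E h ?t) t'"
        by (rule right_inverse_cancel[symmetric]) simp_all
      also have "\<dots> = zero_arr T P E" by (simp only: 1) simp
      finally show ?thesis .
    qed
    show "\<exists>y\<in>arr T C P. y = x \<otimes>\<^bsub>Hom T C P\<^esub> Comp T C P P s y"
      if [simp]: "C \<in> Obj T" "x \<in> arr T C P" for C x
    proof
      let ?y = "Comp T C P P t' x"
      show h: "?y \<in> arr T C P" by simp
      have "Comp T C P P ?t ?y = x" by (rule left_inverse_cancel) simp_all
      then have "?y \<otimes>\<^bsub>Hom T C P\<^esub> inv\<^bsub>Hom T C P\<^esub> Comp T C P P s ?y = x"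
        using comp_diff(1)[of C P P ?y "Idn T P" s] by simp
      then show "?y = x \<otimes>\<^bsub>Hom T C P\<^esub> Comp T C P P s ?y"
        by (subst (asm) diff_eq_iff) simp_all
    qed
  qed
qed

text \<open>One copy of \<open>C\<close> for each map from \<open>C\<close> to \<open>X\<close>
  makes every such map factor through \<open>p\<close>, and \<open>a\<close> after \<open>p\<close>
  is zero. Starting the triangle at the fibre \<open>W\<close> makes \<Sigma>W the next stage of the
  tower and keeps both \<open>k\<close> and its shift at hand.\<close>

lemma ghost_cover:
  assumes S: "small TYPE('u) S" "\<And>C. C \<in> S \<Longrightarrow> compact_object T C" and [simp]: "X \<in> Obj T"
  obtains W X\<^sub>0 k p a F \<iota> and I :: "('o \<times> 'u) set"
  where "(W, X\<^sub>0, X, k, p, a) \<in> Tri T" "is_coproduct T I F X\<^sub>0 \<iota>" "small TYPE('u) I"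
    "\<And>i. i \<in> I \<Longrightarrow> compact_object T (F i)"
    "\<And>C x. \<lbrakk>C \<in> S; x \<in> arr T C X\<rbrakk> \<Longrightarrow> Comp T C X (ShO T W) a x = zero_arr T C (ShO T W)"
proof -
  let ?I = "SIGMA C:S. arr T C X"
  have I: "small TYPE('u) ?I"
    by (rule small_Sigma[OF universe S(1) small_hom]) (use S(2) in simp_all)
  obtain X\<^sub>0 \<iota> where X0: "is_coproduct T ?I fst X\<^sub>0 \<iota>"
    by (rule small_coproduct_exists[OF I, of fst]) (use S(2) in auto)
  note [simp] = coproductD[OF X0]
  obtain p where p [simp]: "p \<in> arr T X\<^sub>0 X" "\<And>i. i \<in> ?I \<Longrightarrow> Comp T (fst i) X\<^sub>0 X p (\<iota> i) = snd i"
    by (rule coproduct_lift[OF X0, of X snd]) auto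
  obtain W k a where t: "(W, X\<^sub>0, X, k, p, a) \<in> Tri T"
    by (rule tri_fibre[of X\<^sub>0 X p]) simp_all
  note [simp] = triD[OF t]
  show ?thesis
  proof (rule that[OF t X0 I])
    show "compact_object T (fst i)" if "i \<in> ?I" for i using that S(2) by auto
    fix C x assume "C \<in> S" and x [simp]: "x \<in> arr T C X"
    then have i: "(C, x) \<in> ?I" and [simp]: "C \<in> Obj T" using S(2) by auto
    have [simp]: "\<iota> (C, x) \<in> arr T C X\<^sub>0" using coproductD(3)[OF X0 i] by simp
    have "Comp T C X (ShO T W) a x = Comp T C X\<^sub>0 (ShO T W) (Comp T X\<^sub>0 X (ShO T W) a p) (\<iota> (C, x))"
      using p(2)[OF i] by (simp add: comp_assoc)
    then show "Comp T C X (ShO T W) a x = zero_arr T C (ShO T W)"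
      by (simp add: tri_comp_zero[OF tri_rotate[OF t]])
  qed
qed

text \<open>The kernel of the passage from morphisms to module maps, that is, its defect of
  injectivity. The test runs over all compact objects, not only over the family used for the
  cover.\<close>

definition phantom :: "'o \<Rightarrow> 'o \<Rightarrow> 'u \<Rightarrow> bool" where
  "phantom X Y f \<longleftrightarrow> f \<in> arr T X Y \<and>
     (\<forall>C x. compact_object T C \<and> x \<in> arr T C X \<longrightarrow> Comp T C X Y f x = zero_arr T C Y)"

section \<open>Moving the defects one stage up the tower\<close>

lemma module_map_extend:
  assumes "extends_module_maps T E" "(X, Y, Z, u, v, w) \<in> Tri T" "module_map T Y E \<psi>"
    and "\<And>C x. \<lbrakk>compact_object T C; x \<in> arr T C X\<rbrakk> \<Longrightarrow> \<psi> C (Comp T C X Y u x) = zero_arr T C E"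
  obtains \<psi>' where "module_map T Z E \<psi>'"
    "\<And>C y. \<lbrakk>compact_object T C; y \<in> arr T C Y\<rbrakk> \<Longrightarrow> \<psi>' C (Comp T C Y Z v y) = \<psi> C y"
proof -
  have "\<exists>\<psi>'. module_map T Z E \<psi>' \<and>
           (\<forall>C y. compact_object T C \<and> y \<in> arr T C Y \<longrightarrow> \<psi>' C (Comp T C Y Z v y) = \<psi> C y)"
    by (rule assms(1)[unfolded extends_module_maps_def, rule_format, of X Y Z u v w \<psi>])
      (use assms(2-4) in simp)
  then show ?thesis using that by auto
qed

text \<open>\<open>f\<close> vanishes on the cover, so it extends along \<open>a\<close> to some
  \<open>g\<close>, which need not be phantom. But \<open>g\<close> kills the image of
  \<open>a\<close> on compact objects, so as a module map it factors through the next map of the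
  triangle, into \<open>ShO T X\<^sub>0\<close>. That object is a coproduct of compact objects, so
  the factor is represented by a morphism \<open>t\<close>. Subtracting the corresponding composite
  from \<open>g\<close> leaves a phantom.\<close>

lemma phantom_factor:
  assumes E: "extends_module_maps T E" "E \<in> Obj T"
    and t: "(W, X\<^sub>0, X, k, p, a) \<in> Tri T" and X0: "is_coproduct T I F X\<^sub>0 \<iota>" "small TYPE('u) I"
      "\<And>i. i \<in> I \<Longrightarrow> compact_object T (F i)"
    and f: "phantom X E f"
  obtains g where "phantom (ShO T W) E g" "Comp T X (ShO T W) E g a = f"
proof -
  have f' [simp]: "f \<in> arr T X E"
    and f_zero: "\<And>C x. compact_object T C \<Longrightarrow> x \<in> arr T C X \<Longrightarrow> Comp T C X E f x = zero_arr T C E"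
    using f by (auto simp: phantom_def)
  note [simp] = triD[OF t] E(2)
  note X0' = coproductD[OF X0(1)]
  let ?W = "ShO T W"
  let ?b = "inv\<^bsub>Hom T ?W (ShO T X\<^sub>0)\<^esub> ShA T W X\<^sub>0 k"
  have t': "(X\<^sub>0, X, ?W, p, a, ?b) \<in> Tri T" by (rule tri_rotate[OF t])
  have t'': "(X, ?W, ShO T X\<^sub>0, a, ?b, inv\<^bsub>Hom T (ShO T X\<^sub>0) (ShO T X)\<^esub> ShA T X\<^sub>0 X p) \<in> Tri T"
    by (rule tri_rotate[OF t'])
  have "Comp T X\<^sub>0 X E f p = zero_arr T X\<^sub>0 E"
  proof (rule coproduct_eqI[OF X0(1)])
    fix i assume i: "i \<in> I"
    show "Comp T (F i) X\<^sub>0 E (Comp T X\<^sub>0 X E f p) (\<iota> i) =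
        Comp T (F i) X\<^sub>0 E (zero_arr T X\<^sub>0 E) (\<iota> i)"
      using i X0' X0(3) by (simp add: comp_assoc f_zero)
  qed simp_all
  then obtain g where g [simp]: "g \<in> arr T ?W E" "Comp T X ?W E g a = f"
    by (rule tri_extend[OF t', of E f, rotated 2]) simp_all
  obtain \<theta> where \<theta>: "module_map T (ShO T X\<^sub>0) E \<theta>"
    "\<And>C y. \<lbrakk>compact_object T C; y \<in> arr T C ?W\<rbrakk> \<Longrightarrow>
      \<theta> C (Comp T C ?W (ShO T X\<^sub>0) ?b y) = Comp T C ?W E g y"
  proof (rule module_map_extend[OF E(1) t'' module_map_comp[of ?W E g]])
    fix C x assume C: "compact_object T C" and x: "x \<in> arr T C X"
    have "Comp T C ?W E g (Comp T C X ?W a x) = Comp T C X E (Comp T X ?W E g a) x"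
      using C x by (subst comp_assoc) simp_all
    then show "Comp T C ?W E g (Comp T C X ?W a x) = zero_arr T C E"
      using f_zero[OF C x] by simp
  qed simp_all
  obtain t where t [simp]: "t \<in> arr T (ShO T X\<^sub>0) E"
    and \<theta>_eq: "\<And>C x. compact_object T C \<Longrightarrow> x \<in> arr T C (ShO T X\<^sub>0) \<Longrightarrow> \<theta> C x =
        Comp T C (ShO T X\<^sub>0) E t x"
    by (rule module_map_lift_coproduct[OF X0(2) Sh.preserves_coproduct[OF X0(1)] compact_shift[OF
        X0(3)] E(2) \<theta>(1)]) simp_all
  \<comment> \<open>The correction vanishes after \<open>a\<close>, so the composite with
    \<open>a\<close> is still \<open>f\<close>.\<close>
  let ?tb = "Comp T ?W (ShO T X\<^sub>0) E t ?b"
  let ?g = "g \<otimes>\<^bsub>Hom T ?W E\<^esub> inv\<^bsub>Hom T ?W E\<^esub> ?tb"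
  show ?thesis
  proof (rule that[of ?g])
    have tbz: "Comp T C ?W E ?tb z = Comp T C ?W E g z"
      if C [simp]: "compact_object T C" and z [simp]: "z \<in> arr T C ?W" for C z
    proof -
      have "Comp T C ?W E ?tb z = \<theta> C (Comp T C ?W (ShO T X\<^sub>0) ?b z)"
        by (simp add: \<theta>_eq comp_assoc del: comp_inv)
      then show ?thesis by (simp add: \<theta>(2))
    qed
    show "phantom ?W E ?g"
      unfolding phantom_def
    proof (intro conjI allI impI)
      fix C z assume "compact_object T C \<and> z \<in> arr T C ?W"
      then have C [simp]: "compact_object T C" and z [simp]: "z \<in> arr T C ?W" by auto
      show "Comp T C ?W E ?g z = zero_arr T C E"
        by (simp add: comp_diff tbz flip: eq_iff_diff)
    qed simp
    have "Comp T X ?W (ShO T X\<^sub>0) ?b a = zero_arr T X (ShO T X\<^sub>0)" by (rule tri_comp_zero[OF t''])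
    then show "Comp T X ?W E ?g a = f"
      by (simp add: comp_diff comp_assoc)
  qed
qed

text \<open>On the cover, \<phi> is represented by a morphism \<open>g\<close>. The obstruction to
  extending \<open>g\<close> along \<open>p\<close> is g k, which is phantom; this is why
  injectivity has to be known before surjectivity. What remains of \<phi> after subtracting
  \<open>f\<close> vanishes on the cover and passes to the next stage.\<close>

lemma module_map_factor:
  assumes E: "extends_module_maps T E" "E \<in> Obj T"
    and no_phantom: "\<And>Y g. Y \<in> Obj T \<Longrightarrow> phantom Y E g \<Longrightarrow> g = zero_arr T Y E"
    and t: "(W, X\<^sub>0, X, k, p, a) \<in> Tri T" and X0: "is_coproduct T I F X\<^sub>0 \<iota>" "small TYPE('u) I"
      "\<And>i. i \<in> I \<Longrightarrow> compact_object T (F i)"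
    and \<phi>: "module_map T X E \<phi>"
  obtains f \<psi> where "f \<in> arr T X E" "module_map T (ShO T W) E \<psi>"
    "\<And>C x. \<lbrakk>compact_object T C; x \<in> arr T C X\<rbrakk> \<Longrightarrow>
       \<phi> C x = Comp T C X E f x \<otimes>\<^bsub>Hom T C E\<^esub> \<psi> C (Comp T C X (ShO T W) a x)"
proof -
  note [simp] = triD[OF t] E(2)
  let ?W = "ShO T W"
  have t': "(X\<^sub>0, X, ?W, p, a, inv\<^bsub>Hom T ?W (ShO T X\<^sub>0)\<^esub> ShA T W X\<^sub>0 k) \<in> Tri T"
    by (rule tri_rotate[OF t])
  have \<phi>p: "module_map T X\<^sub>0 E (\<lambda>C x. \<phi> C (Comp T C X\<^sub>0 X p x))"
  proof -
    have "(\<lambda>x. \<phi> C (Comp T C X\<^sub>0 X p x)) \<in> hom (Hom T C X\<^sub>0) (Hom T C E)" if C: "compact_object T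
        C" for C
      using hom_compose[OF comp_hom_right[of C X\<^sub>0 X p] module_mapD(1)[OF \<phi> C]] C
        by (simp add: comp_def)
    then show ?thesis
      by (simp add: module_map_def comp_assoc[symmetric] module_mapD(3)[OF \<phi>])
  qed
  obtain g where g [simp]: "g \<in> arr T X\<^sub>0 E"
    and g_eq: "\<And>C x. compact_object T C \<Longrightarrow> x \<in> arr T C X\<^sub>0 \<Longrightarrow>
      \<phi> C (Comp T C X\<^sub>0 X p x) = Comp T C X\<^sub>0 E g x"
    by (rule module_map_lift_coproduct[OF X0(2,1,3) E(2) \<phi>p]) simp_all
  have "phantom W E (Comp T W X\<^sub>0 E g k)"
    unfolding phantom_def
  proof (intro conjI allI impI)
    fix C x assume "compact_object T C \<and> x \<in> arr T C W"
    then have C [simp]: "compact_object T C" and x [simp]: "x \<in> arr T C W" by auto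
    have "Comp T C W E (Comp T W X\<^sub>0 E g k) x = \<phi> C (Comp T C X\<^sub>0 X p (Comp T C W X\<^sub>0 k x))"
      by (simp add: g_eq comp_assoc)
    also have "Comp T C X\<^sub>0 X p (Comp T C W X\<^sub>0 k x) = Comp T C W X (Comp T W X\<^sub>0 X p k) x"
      by (simp add: comp_assoc)
    also have "\<phi> C \<dots> = zero_arr T C E"
      by (simp add: tri_comp_zero[OF t] module_map_one[OF \<phi>])
    finally show "Comp T C W E (Comp T W X\<^sub>0 E g k) x = zero_arr T C E" .
  qed simp
  then have "Comp T W X\<^sub>0 E g k = zero_arr T W E" by (intro no_phantom) simp_all
  then obtain f where f [simp]: "f \<in> arr T X E" "Comp T X\<^sub>0 X E f p = g"
    by (rule tri_extend[OF t, of E g, rotated 2]) simp_all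
  let ?\<psi> = "\<lambda>C x. \<phi> C x \<otimes>\<^bsub>Hom T C E\<^esub> inv\<^bsub>Hom T C E\<^esub> Comp T C X E f x"
  have \<phi>_closed [simp]: "\<phi> C x \<in> arr T C E" if "compact_object T C" "x \<in> arr T C X" for C x
    using module_mapD(2)[OF \<phi>] that by simp
  have \<psi>: "module_map T X E ?\<psi>"
  proof -
    have "?\<psi> C \<in> hom (Hom T C X) (Hom T C E)" if C [simp]: "compact_object T C" for C
    proof (rule homI)
      interpret G: comm_group "Hom T C E" by (rule hom_comm_group) simp_all
      fix x y assume [simp]: "x \<in> arr T C X" "y \<in> arr T C X"
      have "\<phi> C (x \<otimes>\<^bsub>Hom T C X\<^esub> y) = \<phi> C x \<otimes>\<^bsub>Hom T C E\<^esub> \<phi> C y"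
        by (rule hom_mult[OF module_mapD(1)[OF \<phi> C]]) simp_all
      then show "?\<psi> C (x \<otimes>\<^bsub>Hom T C X\<^esub> y) = ?\<psi> C x \<otimes>\<^bsub>Hom T C E\<^esub> ?\<psi> C y"
        by (simp add: comp_mult G.inv_mult G.m_ac)
    qed simp
    then show ?thesis
      by (simp add: module_map_def module_mapD(3)[OF \<phi>] comp_diff comp_assoc)
  qed
  obtain \<psi>' where \<psi>': "module_map T ?W E \<psi>'"
    "\<And>C y. \<lbrakk>compact_object T C; y \<in> arr T C X\<rbrakk> \<Longrightarrow> \<psi>' C (Comp T C X ?W a y) = ?\<psi> C y"
  proof (rule module_map_extend[OF E(1) t' \<psi>])
    fix C x assume [simp]: "compact_object T C" "x \<in> arr T C X\<^sub>0"
    have "Comp T C X E f (Comp T C X\<^sub>0 X p x) = Comp T C X\<^sub>0 E (Comp T X\<^sub>0 X E f p) x"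
      by (subst comp_assoc) simp_all
    then show "?\<psi> C (Comp T C X\<^sub>0 X p x) = zero_arr T C E"
      by (simp add: g_eq flip: eq_iff_diff)
  qed simp_all
  show ?thesis
  proof (rule that[OF f(1) \<psi>'(1)])
    fix C x assume [simp]: "compact_object T C" "x \<in> arr T C X"
    interpret G: comm_group "Hom T C E" by (rule hom_comm_group) simp_all
    show "\<phi> C x = Comp T C X E f x \<otimes>\<^bsub>Hom T C E\<^esub> \<psi>' C (Comp T C X ?W a x)"
      by (simp add: \<psi>'(2) G.m_comm[of "Comp T C X E f x"] G.m_assoc)
  qed
qed

text \<open>One step of the tower without the triangle that it comes from, so that a choice over all
  objects can be iterated. The last clause takes the absence of phantoms as a premise because the
  same kind of tower serves first to prove that absence.\<close>

definition ghost_step :: "'o set \<Rightarrow> 'o \<Rightarrow> 'o \<Rightarrow> 'o \<Rightarrow> 'u \<Rightarrow> bool" where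
  "ghost_step S E X N a \<longleftrightarrow> N \<in> Obj T \<and> a \<in> arr T X N \<and>
     (\<forall>C x. C \<in> S \<and> x \<in> arr T C X \<longrightarrow> Comp T C X N a x = zero_arr T C N) \<and>
     (\<forall>f. phantom X E f \<longrightarrow> (\<exists>g. phantom N E g \<and> Comp T X N E g a = f)) \<and>
     (\<forall>\<phi>. module_map T X E \<phi> \<and> (\<forall>Y g. Y \<in> Obj T \<and> phantom Y E g \<longrightarrow> g = zero_arr T Y E) \<longrightarrow>
       (\<exists>f \<psi>. f \<in> arr T X E \<and> module_map T N E \<psi> \<and>
         (\<forall>C x. compact_object T C \<and> x \<in> arr T C X \<longrightarrow>
            \<phi> C x = Comp T C X E f x \<otimes>\<^bsub>Hom T C E\<^esub> \<psi> C (Comp T C X N a x))))"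

lemma ghost_steps:
  assumes S: "small TYPE('u) S" "\<And>C. C \<in> S \<Longrightarrow> compact_object T C"
    and E: "extends_module_maps T E" "E \<in> Obj T"
  obtains N a where "\<forall>X\<in>Obj T. ghost_step S E X (N X) (a X)"
proof -
  have "\<exists>N a. ghost_step S E X N a" if X: "X \<in> Obj T" for X
  proof -
    obtain W X\<^sub>0 k p a F \<iota> and I :: "('o \<times> 'u) set" where
      t: "(W, X\<^sub>0, X, k, p, a) \<in> Tri T" and X0: "is_coproduct T I F X\<^sub>0 \<iota>" "small TYPE('u) I"
      "\<And>i. i \<in> I \<Longrightarrow> compact_object T (F i)"
      and ghost: "\<And>C x. \<lbrakk>C \<in> S; x \<in> arr T C X\<rbrakk> \<Longrightarrow> Comp T C X (ShO T W) a x = zero_arr T C (ShO T W)"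
      by (rule ghost_cover[OF S X]) simp_all
    have "ghost_step S E X (ShO T W) a"
      unfolding ghost_step_def
    proof (intro conjI allI impI)
      show "ShO T W \<in> Obj T" "a \<in> arr T X (ShO T W)" using triD[OF t] by simp_all
      show "Comp T C X (ShO T W) a x = zero_arr T C (ShO T W)" if "C \<in> S \<and> x \<in> arr T C X" for C x
        using ghost that by simp
      show "\<exists>g. phantom (ShO T W) E g \<and> Comp T X (ShO T W) E g a = f" if "phantom X E f" for f
        by (rule phantom_factor[OF E t X0 that]) auto
      show "\<exists>f \<psi>. f \<in> arr T X E \<and> module_map T (ShO T W) E \<psi> \<and>
         (\<forall>C x. compact_object T C \<and> x \<in> arr T C X \<longrightarrow>
            \<phi> C x = Comp T C X E f x \<otimes>\<^bsub>Hom T C E\<^esub> \<psi> C (Comp T C X (ShO T W) a x))"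
        if "module_map T X E \<phi> \<and> (\<forall>Y g. Y \<in> Obj T \<and> phantom Y E g \<longrightarrow> g = zero_arr T Y E)" for \<phi>
        by (rule module_map_factor[OF E _ t X0, of \<phi>]) (use that in auto)
    qed
    then show ?thesis by blast
  qed
  then show ?thesis using that by metis
qed

section \<open>The infinite tower and the comparison of morphisms with module maps\<close>

lemma ghost_sequence:
  assumes E: "extends_module_maps T E" "E \<in> Obj T" and X: "X \<in> Obj T"
  obtains Xs S a P \<iota> s where "Xs 0 = X" "\<And>n. Xs n \<in> Obj T"
      "\<And>n. ghost_step S E (Xs n) (Xs (Suc n)) (a n)"
    "is_coproduct T (UNIV :: nat set) Xs P \<iota>" "s \<in> arr T P P"
    "\<And>n. Comp T (Xs n) P P s (\<iota> n) = Comp T (Xs n) (Xs (Suc n)) P (\<iota> (Suc n)) (a n)"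
    "\<forall>E\<in>Obj T. \<forall>f\<in>arr T P E. \<exists>h\<in>arr T P E. h = f \<otimes>\<^bsub>Hom T P E\<^esub> Comp T P P E h s"
    "\<forall>E\<in>Obj T. \<forall>h\<in>arr T P E. h = Comp T P P E h s \<longrightarrow> h = zero_arr T P E"
    "\<forall>C\<in>Obj T. \<forall>x\<in>arr T C P. \<exists>y\<in>arr T C P. y = x \<otimes>\<^bsub>Hom T C P\<^esub> Comp T C P P s y"
proof -
  obtain S where S: "small TYPE('u) S" "\<And>C. C \<in> S \<Longrightarrow> compact_object T C" and cons: "detects_isos T S"
    by (rule conservative_family) simp_all
  obtain N a where step: "\<forall>X\<in>Obj T. ghost_step S E (X) (N X) (a X)"
    by (rule ghost_steps[OF S E])
  define Xs where "Xs n = (N ^^ n) X" for n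
  have Xs: "Xs n \<in> Obj T" for n
    by (induction n) (use step X in \<open>simp_all add: Xs_def ghost_step_def\<close>)
  have gs: "ghost_step S E (Xs n) (Xs (Suc n)) (a (Xs n))" for n
    using step Xs[of n] by (simp add: Xs_def)
  show thesis
    by (rule ghost_tower[OF S(2) cons, of Xs "\<lambda>n. a (Xs n)"])
      (use gs Xs in \<open>simp_all add: ghost_step_def\<close>, rule that[of Xs S
          "\<lambda>n. a (Xs n)"], simp_all add: Xs_def[of 0] gs Xs)
qed

text \<open>Factoring \<open>f\<close> through stage after stage gives phantoms \<open>fs n\<close>
  compatible with the tower. Together they form a map \<open>h\<close> out of the coproduct with h =
  h s, and invertibility of 1 - s forces it to be zero.\<close>

lemma no_phantom:
  assumes E: "extends_module_maps T E" "E \<in> Obj T" and X: "X \<in> Obj T" and f: "phantom X E f"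
  shows "f = zero_arr T X E"
proof -
  show ?thesis
  proof (rule ghost_sequence[OF E X])
    fix Xs S a P \<iota> s
    assume Xs0: "Xs 0 = X" and Xs [simp]: "\<And>n. Xs n \<in> Obj T"
      and gs: "\<And>n. ghost_step S E (Xs n) (Xs (Suc n)) (a n)"
      and P: "is_coproduct T UNIV Xs P \<iota>" and s [simp]: "s \<in> arr T P P"
      and s_\<iota>: "\<And>n. Comp T (Xs n) P P s (\<iota> n) = Comp T (Xs n) (Xs (Suc n)) P (\<iota> (Suc n)) (a n)"
      and solve_left: "\<forall>E\<in>Obj T. \<forall>f\<in>arr T P E. \<exists>h\<in>arr T P E. h = f \<otimes>\<^bsub>Hom T P E\<^esub> Comp T P P E h s"
      and fix_one: "\<forall>E\<in>Obj T. \<forall>h\<in>arr T P E. h = Comp T P P E h s \<longrightarrow> h = zero_arr T P E"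
      and solve_right: "\<forall>C\<in>Obj T. \<forall>x\<in>arr T C P. \<exists>y\<in>arr T C P. y = x \<otimes>\<^bsub>Hom T C P\<^esub> Comp T C P P s y"
    have a [simp]: "a n \<in> arr T (Xs n) (Xs (Suc n))"
      and step: "phantom (Xs n) E f \<Longrightarrow> \<exists>g. phantom (Xs (Suc n)) E g \<and>
          Comp T (Xs n) (Xs (Suc n)) E g (a n) = f" for n f
      using gs[of n] by (simp_all add: ghost_step_def)
    have [simp]: "P \<in> Obj T" "\<And>n. \<iota> n \<in> arr T (Xs n) P" using coproductD[OF P] by auto
    note [simp] = E(2)
    \<comment> \<open>The clause for n = 0 pins the start of the dependent choice to the given
      \<open>f\<close>.\<close>
    have "\<exists>fs. \<forall>n. (phantom (Xs n) E (fs n) \<and> (n = 0 \<longrightarrow> fs n = f)) \<and>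
        Comp T (Xs n) (Xs (Suc n)) E (fs (Suc n)) (a n) = fs n"
    proof (rule dependent_nat_choice)
      show "\<exists>g. phantom (Xs 0) E g \<and> (0 = (0::nat) \<longrightarrow> g = f)" using f by (simp add: Xs0)
      show "\<exists>g'. (phantom (Xs (Suc n)) E g' \<and> (Suc n = 0 \<longrightarrow> g' = f)) \<and>
          Comp T (Xs n) (Xs (Suc n)) E g' (a n) = g"
        if "phantom (Xs n) E g \<and> (n = 0 \<longrightarrow> g = f)" for g n
        using step[of n g] that by simp
    qed
    then obtain fs where fs: "\<And>n. phantom (Xs n) E (fs n)" "fs 0 = f"
      and fs_Suc: "\<And>n. Comp T (Xs n) (Xs (Suc n)) E (fs (Suc n)) (a n) = fs n" by auto
    have fs' [simp]: "fs n \<in> arr T (Xs n) E" for n using fs(1)[of n] by (simp add: phantom_def)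
    obtain h where h [simp]: "h \<in> arr T P E" and h_\<iota>: "\<And>n. Comp T (Xs n) P E h (\<iota> n) = fs n"
      by (rule coproduct_lift[OF P E(2), of fs]) simp_all
    have hs: "h = Comp T P P E h s"
    proof (rule coproduct_eqI[OF P])
      fix n
      have "Comp T (Xs n) P E (Comp T P P E h s) (\<iota> n) =
          Comp T (Xs n) (Xs (Suc n)) E (Comp T (Xs (Suc n)) P E h (\<iota> (Suc n))) (a n)"
        by (simp add: comp_assoc s_\<iota>)
      then show "Comp T (Xs n) P E h (\<iota> n) = Comp T (Xs n) P E (Comp T P P E h s) (\<iota> n)"
        by (simp add: h_\<iota> fs_Suc)
    qed simp_all
    have "h = zero_arr T P E" by (rule fix_one[rule_format, OF E(2) h hs])
    then have "f = Comp T (Xs 0) P E (zero_arr T P E) (\<iota> 0)" using h_\<iota>[of 0] fs(2) by simp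
    then show ?thesis by (simp add: Xs0[symmetric])
  qed
qed

text \<open>A generator of Hom(K, P) passes through one summand \<open>i\<close> and so has no
  component from index i + 1 on; for a sum the larger of the two bounds works.\<close>

lemma coproduct_finite_support:
  assumes K: "compact_object T K" and P: "is_coproduct T (UNIV :: nat set) X P \<iota>"
    and \<pi> [simp]: "\<And>i. \<pi> i \<in> arr T P (X i)"
    and \<pi>\<iota>: "\<And>i j. i \<noteq> j \<Longrightarrow> Comp T (X i) P (X j) (\<pi> j) (\<iota> i) = zero_arr T (X i) (X j)"
    and y: "y \<in> arr T K P"
  shows "\<exists>n. \<forall>m\<ge>n. Comp T K P (X m) (\<pi> m) y = zero_arr T K (X m)"
proof -
  have [simp]: "P \<in> Obj T" "\<And>n. \<iota> n \<in> arr T (X n) P" "\<And>n. X n \<in> Obj T" "K \<in> Obj T"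
    using coproductD[OF P] K by auto
  have "y \<in> generate (Hom T K P) (coproduct_maps T K UNIV X P \<iota>)"
    using compact_object_generate[OF K small_nat[OF universe] P] y by (rule subsetD)
  then have "y \<in> arr T K P \<and> (\<exists>n. \<forall>m\<ge>n. Comp T K P (X m) (\<pi> m) y = zero_arr T K (X m))"
  proof induction
    case (incl h)
    then obtain i g where [simp]: "g \<in> arr T K (X i)" and h: "h = Comp T K (X i) P (\<iota> i) g"
      by (auto simp: coproduct_maps_def)
    have "Comp T K P (X m) (\<pi> m) h = zero_arr T K (X m)" if "m \<ge> Suc i" for m
      using that by (simp add: h \<pi>\<iota> flip: comp_assoc)
    then show ?case by (auto simp: h)
  next
    case (inv h)
    then obtain i g where [simp]: "g \<in> arr T K (X i)" and h: "h = Comp T K (X i) P (\<iota> i) g"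
      by (auto simp: coproduct_maps_def)
    have "Comp T K P (X m) (\<pi> m) h = zero_arr T K (X m)" if "m \<ge> Suc i" for m
      using that by (simp add: h \<pi>\<iota> flip: comp_assoc)
    then have "Comp T K P (X m) (\<pi> m) (inv\<^bsub>Hom T K P\<^esub> h) = zero_arr T K (X m)" if "m \<ge> Suc i" for m
      using that by (simp add: h comp_inv)
    then show ?case by (auto simp: h)
  next
    case (eng g h)
    then obtain n k where n: "\<And>m. m \<ge> n \<Longrightarrow> Comp T K P (X m) (\<pi> m) g = zero_arr T K (X m)"
      and k: "\<And>m. m \<ge> k \<Longrightarrow> Comp T K P (X m) (\<pi> m) h = zero_arr T K (X m)"
      and [simp]: "g \<in> arr T K P" "h \<in> arr T K P" by auto
    then have "Comp T K P (X m) (\<pi> m) (g \<otimes>\<^bsub>Hom T K P\<^esub> h) = zero_arr T K (X m)" if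
        "m \<ge> max n k" for m
      using that by (simp add: comp_mult)
    then show ?case by (intro conjI exI[of _ "max n k"] allI impI) simp_all
  qed simp
  then show ?thesis ..
qed

text \<open>Splitting off a morphism at each stage writes \<phi> formally as fs 0 + fs 1 a 0 + fs 2
  a 1 a 0 + ... . The infinite sum gets a meaning through the solution \<open>h\<close> of h = f + h
  s. On a map from a compact object only finitely many terms remain, because the tower kills that
  map at a finite stage.\<close>

theorem module_map_representable:
  assumes E: "extends_module_maps T E" "E \<in> Obj T" and X: "X \<in> Obj T" and \<phi>: "module_map T X E \<phi>"
  shows "\<exists>f\<in>arr T X E. \<forall>C x. compact_object T C \<and> x \<in> arr T C X \<longrightarrow>
    \<phi> C x = Comp T C X E f x"
proof -
  show ?thesis
  proof (rule ghost_sequence[OF E X])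
    fix Xs S a P \<iota> s
    assume Xs0: "Xs 0 = X" and Xs [simp]: "\<And>n. Xs n \<in> Obj T"
      and gs: "\<And>n. ghost_step S E (Xs n) (Xs (Suc n)) (a n)"
      and P: "is_coproduct T UNIV Xs P \<iota>" and s [simp]: "s \<in> arr T P P"
      and s_\<iota>: "\<And>n. Comp T (Xs n) P P s (\<iota> n) = Comp T (Xs n) (Xs (Suc n)) P (\<iota> (Suc n)) (a n)"
      and solve_left: "\<forall>E\<in>Obj T. \<forall>f\<in>arr T P E. \<exists>h\<in>arr T P E. h = f \<otimes>\<^bsub>Hom T P E\<^esub> Comp T P P E h s"
      and fix_one: "\<forall>E\<in>Obj T. \<forall>h\<in>arr T P E. h = Comp T P P E h s \<longrightarrow> h = zero_arr T P E"
      and solve_right: "\<forall>C\<in>Obj T. \<forall>x\<in>arr T C P. \<exists>y\<in>arr T C P. y = x \<otimes>\<^bsub>Hom T C P\<^esub> Comp T C P P s y"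
    have a [simp]: "a n \<in> arr T (Xs n) (Xs (Suc n))" for n
      using gs[of n] by (simp add: ghost_step_def)
    have [simp]: "P \<in> Obj T" "\<And>n. \<iota> n \<in> arr T (Xs n) P" using coproductD[OF P] by auto
    note [simp] = E(2)
    let ?R = "\<lambda>n \<phi> f \<psi>. f \<in> arr T (Xs n) E \<and>
        (\<forall>C x. compact_object T C \<and> x \<in> arr T C (Xs n) \<longrightarrow>
           \<phi> C x = Comp T C (Xs n) E f x \<otimes>\<^bsub>Hom T C E\<^esub> \<psi> C (Comp T C (Xs n) (Xs (Suc n)) (a n) x))"
    have "\<exists>\<phi>s. \<forall>n. (module_map T (Xs n) E (\<phi>s n) \<and> (n = 0 \<longrightarrow> \<phi>s n = \<phi>)) \<and>
        (\<exists>f. ?R n (\<phi>s n) f (\<phi>s (Suc n)))"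
    proof (rule dependent_nat_choice)
      show "\<exists>\<psi>. module_map T (Xs 0) E \<psi> \<and> (0 = (0::nat) \<longrightarrow> \<psi> = \<phi>)" using \<phi> by (simp add: Xs0)
      fix \<psi> n assume "module_map T (Xs n) E \<psi> \<and> (n = 0 \<longrightarrow> \<psi> = \<phi>)"
      then have "\<exists>f \<psi>'. f \<in> arr T (Xs n) E \<and> module_map T (Xs (Suc n)) E \<psi>' \<and>
          (\<forall>C x. compact_object T C \<and> x \<in> arr T C (Xs n) \<longrightarrow>
             \<psi> C x = Comp T C (Xs n) E f x \<otimes>\<^bsub>Hom T C E\<^esub> \<psi>' C (Comp T C (Xs n) (Xs (Suc n)) (a n)
                 x))"
        using gs[of n, unfolded ghost_step_def, THEN conjunct2, THEN conjunct2, THEN conjunct2,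
            THEN conjunct2,
            THEN spec[of _ \<psi>]] no_phantom[OF E] by simp
      then obtain f \<psi>' where f: "?R n \<psi> f \<psi>'" and \<psi>': "module_map T (Xs (Suc n)) E \<psi>'" by auto
      show "\<exists>\<psi>'. (module_map T (Xs (Suc n)) E \<psi>' \<and> (Suc n = 0 \<longrightarrow> \<psi>' = \<phi>)) \<and> (\<exists>f. ?R n \<psi> f \<psi>')"
        by (rule exI[of _ \<psi>']) (use \<psi>' in simp, rule exI[of _ f], rule f)
    qed
    then obtain \<phi>s where \<phi>s: "\<And>n. module_map T (Xs n) E (\<phi>s n)" "\<phi>s 0 = \<phi>"
      and "\<forall>n. \<exists>f. ?R n (\<phi>s n) f (\<phi>s (Suc n))" by auto
    from choice[OF this(3)] obtain fs where fs [simp]: "\<And>n. fs n \<in> arr T (Xs n) E"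
      and \<phi>s_eq: "\<And>n C x. \<lbrakk>compact_object T C; x \<in> arr T C (Xs n)\<rbrakk> \<Longrightarrow> \<phi>s n C x =
         Comp T C (Xs n) E (fs n) x \<otimes>\<^bsub>Hom T C E\<^esub> \<phi>s (Suc n) C (Comp T C (Xs n) (Xs (Suc n)) (a n)
             x)"
      by auto
    obtain f where f [simp]: "f \<in> arr T P E" and f_\<iota>: "\<And>n. Comp T (Xs n) P E f (\<iota> n) = fs n"
      by (rule coproduct_lift[OF P E(2), of fs]) simp_all
    \<comment> \<open>\<open>h\<close> collects the tails of the formal sum: \<open>?h n\<close> is
      the part from stage \<open>n\<close> on, so \<open>?h 0\<close> is the representing
      morphism.\<close>
    obtain h where h [simp]: "h \<in> arr T P E" and h_eq: "h = f \<otimes>\<^bsub>Hom T P E\<^esub> Comp T P P E h s"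
      using solve_left E(2) f by blast
    let ?h = "\<lambda>n. Comp T (Xs n) P E h (\<iota> n)"
    have h_step: "?h n = fs n \<otimes>\<^bsub>Hom T (Xs n) E\<^esub> Comp T (Xs n) (Xs (Suc n)) E (?h (Suc n)) (a n)"
        for n
    proof -
      have "?h n = Comp T (Xs n) P E (f \<otimes>\<^bsub>Hom T P E\<^esub> Comp T P P E h s) (\<iota> n)"
        using h_eq by simp
      also have "\<dots> = fs n \<otimes>\<^bsub>Hom T (Xs n) E\<^esub> Comp T (Xs n) P E h (Comp T (Xs n) P P s (\<iota> n))"
        by (simp add: comp_mult f_\<iota> comp_assoc)
      finally show ?thesis by (simp add: s_\<iota> comp_assoc)
    qed
    obtain \<pi> where \<pi> [simp]: "\<And>i. \<pi> i \<in> arr T P (Xs i)"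
      and \<pi>\<iota>: "\<And>i. Comp T (Xs i) P (Xs i) (\<pi> i) (\<iota> i) = Idn T (Xs i)"
      "\<And>i j. i \<noteq> j \<Longrightarrow> Comp T (Xs i) P (Xs j) (\<pi> j) (\<iota> i) = zero_arr T (Xs i) (Xs j)"
      using coproduct_proj[OF P] by (metis UNIV_I)
    \<comment> \<open>Together with the next fact this says that \<open>s\<close> moves each
      component one stage up and leaves nothing in component 0.\<close>
    have \<pi>s0: "Comp T P P (Xs 0) (\<pi> 0) s = zero_arr T P (Xs 0)"
    proof (rule coproduct_eqI[OF P])
      fix n
      have "Comp T (Xs n) P (Xs 0) (Comp T P P (Xs 0) (\<pi> 0) s) (\<iota> n) =
          Comp T (Xs n) (Xs (Suc n)) (Xs 0) (Comp T (Xs (Suc n)) P (Xs 0) (\<pi> 0) (\<iota> (Suc n))) (a n)"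
        by (simp add: comp_assoc s_\<iota>)
      then show "Comp T (Xs n) P (Xs 0) (Comp T P P (Xs 0) (\<pi> 0) s) (\<iota> n) =
          Comp T (Xs n) P (Xs 0) (zero_arr T P (Xs 0)) (\<iota> n)"
        by (simp add: \<pi>\<iota>)
    qed simp_all
    have \<pi>s: "Comp T P P (Xs (Suc m)) (\<pi> (Suc m)) s =
        Comp T P (Xs m) (Xs (Suc m)) (a m) (\<pi> m)" for m
    proof (rule coproduct_eqI[OF P])
      fix n
      have "Comp T (Xs n) P (Xs (Suc m)) (Comp T P P (Xs (Suc m)) (\<pi> (Suc m)) s) (\<iota> n) =
          Comp T (Xs n) (Xs (Suc n)) (Xs (Suc m)) (Comp T (Xs (Suc n)) P (Xs (Suc m)) (\<pi> (Suc m))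
              (\<iota> (Suc n))) (a n)"
        by (simp add: comp_assoc s_\<iota>)
      then show "Comp T (Xs n) P (Xs (Suc m)) (Comp T P P (Xs (Suc m)) (\<pi> (Suc m)) s) (\<iota> n) =
          Comp T (Xs n) P (Xs (Suc m)) (Comp T P (Xs m) (Xs (Suc m)) (a m) (\<pi> m)) (\<iota> n)"
        by (cases "n = m") (simp_all add: \<pi>\<iota> comp_assoc)
    qed simp_all
    show ?thesis
    proof (intro bexI allI impI)
      show "?h 0 \<in> arr T X E" by (simp add: Xs0[symmetric])
      fix C x assume "compact_object T C \<and> x \<in> arr T C X"
      then have C [simp]: "compact_object T C"
          and x [simp]: "x \<in> arr T C (Xs 0)" by (simp_all add: Xs0)
      \<comment> \<open>The components of \<open>y\<close> are the successive images of
        \<open>x\<close> in the tower, and its finite support provides a stage at which the image is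
        zero.\<close>
      obtain y where y [simp]: "y \<in> arr T C P"
        and y_eq: "y = Comp T C (Xs 0) P (\<iota> 0) x \<otimes>\<^bsub>Hom T C P\<^esub> Comp T C P P s y"
        using bspec[OF bspec[OF solve_right, of C], of "Comp T C (Xs 0) P (\<iota> 0) x"] by auto
      let ?y = "\<lambda>n. Comp T C P (Xs n) (\<pi> n) y"
      have y_n: "?y n = Comp T C P (Xs n) (\<pi> n) (Comp T C (Xs 0) P (\<iota> 0) x) \<otimes>\<^bsub>Hom T C (Xs n)\<^esub>
          Comp T C P (Xs n) (Comp T P P (Xs n) (\<pi> n) s) y" for n
      proof -
        have "?y n = Comp T C P (Xs n) (\<pi> n) (Comp T C (Xs 0) P (\<iota> 0) x \<otimes>\<^bsub>Hom T C P\<^esub> Comp T C P P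
            s y)"
          using y_eq by simp
        then show ?thesis by (simp add: comp_mult comp_assoc)
      qed
      have y0: "?y 0 = x"
        using y_n[of 0] by (simp add: \<pi>s0 \<pi>\<iota> left_inverse_cancel)
      have y_Suc: "?y (Suc n) = Comp T C (Xs n) (Xs (Suc n)) (a n) (?y n)" for n
        using y_n[of "Suc n"] by (simp add: \<pi>s \<pi>\<iota> comp_assoc[symmetric])
      obtain n where n: "?y n = zero_arr T C (Xs n)"
        using coproduct_finite_support[OF C P \<pi> \<pi>\<iota>(2) y] by auto
      have "\<phi>s 0 C (?y 0) = Comp T C (Xs 0) E (?h 0) (?y 0)"
      \<comment> \<open>Downward induction from the stage where the image of \<open>x\<close> is
        zero: there both sides vanish, and each earlier stage adds the same term, that of
        \<open>fs m\<close>.\<close>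
      proof (rule inc_induct[of 0 n "\<lambda>m. \<phi>s m C (?y m) = Comp T C (Xs m) E (?h m) (?y m)"])
        show "\<phi>s n C (?y n) = Comp T C (Xs n) E (?h n) (?y n)"
          by (simp add: n module_map_one[OF \<phi>s(1)])
        fix m assume IH: "\<phi>s (Suc m) C (?y (Suc m)) =
            Comp T C (Xs (Suc m)) E (?h (Suc m)) (?y (Suc m))"
        have "\<phi>s m C (?y m) = Comp T C (Xs m) E (fs m) (?y m) \<otimes>\<^bsub>Hom T C E\<^esub> \<phi>s (Suc m) C
            (?y (Suc m))"
          by (subst \<phi>s_eq) (simp_all add: y_Suc)
        also have "\<dots> = Comp T C (Xs m) E (fs m \<otimes>\<^bsub>Hom T (Xs m) E\<^esub>
            Comp T (Xs m) (Xs (Suc m)) E (?h (Suc m)) (a m)) (?y m)"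
          unfolding IH by (simp add: comp_mult comp_assoc y_Suc)
        also have "\<dots> = Comp T C (Xs m) E (?h m) (?y m)"
          by (simp only: h_step[of m])
        finally show "\<phi>s m C (?y m) = Comp T C (Xs m) E (?h m) (?y m)" .
      qed simp
      then have "\<phi>s 0 C x = Comp T C (Xs 0) E (?h 0) x" by (simp only: y0)
      then show "\<phi> C x = Comp T C X E (?h 0) x" by (simp only: \<phi>s(2) Xs0)
    qed
  qed
qed

end

section \<open>Module categories\<close>

lemma carrier_hom_group [simp]: "carrier (hom_group G H) = hom G H \<inter> extensional (carrier G)"
  by (simp add: hom_group_def)

lemma mult_hom_group [simp]: "mult (hom_group G H) = (\<lambda>f g. \<lambda>x\<in>carrier G. f x \<otimes>\<^bsub>H\<^esub> g x)"
  by (simp add: hom_group_def)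

lemma Ab_simps [simp]:
  "G \<in> Obj Ab \<longleftrightarrow> comm_group G \<and> small TYPE('u) (carrier G)"
  "Hom Ab = hom_group"
  "Idn Ab G = (\<lambda>x\<in>carrier G. x)"
  "Comp Ab G H K g f = (\<lambda>x\<in>carrier G. g (f x))"
  for G :: "'u monoid"
  by (simp_all add: Ab_def)

lemma opposite_simps [simp]:
  "Obj (opposite C) = Obj C" "Hom (opposite C) X Y = Hom C Y X" "Idn (opposite C) = Idn C"
  "Comp (opposite C) X Y Z g f = Comp C Z Y X f g"
  by (simp_all add: opposite_def)

lemma opposite_functor_simps [simp]:
  "FObj (opposite_functor F) = FObj F" "FArr (opposite_functor F) X Y = FArr F Y X"
  by (simp_all add: opposite_functor_def)

lemma Mod_simps:
  "Obj (Mod_category C) = {F. additive_functor C (opposite Ab) F}"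
  "Idn (Mod_category C) F = (\<lambda>X\<in>Obj C. Idn Ab (FObj F X))"
  "Comp (Mod_category C) F G H \<beta> \<alpha> = (\<lambda>X\<in>Obj C. Comp Ab (FObj F X) (FObj G X) (FObj H X) (\<beta> X)
      (\<alpha> X))"
  "arr (Mod_category C) F G = {\<eta> \<in> extensional (Obj C).
     nat_trans (opposite C) Ab (opposite_functor F) (opposite_functor G) \<eta>}"
  by (simp_all add: Mod_category_def)

definition mk_map ::
    "('o, 'u, 'z) precat_scheme \<Rightarrow> ('o, 'u) module \<Rightarrow> ('o \<Rightarrow> 'u \<Rightarrow> 'u) \<Rightarrow> 'o \<Rightarrow> 'u \<Rightarrow> 'u" where
  "mk_map C F \<phi> = (\<lambda>X\<in>Obj C. \<lambda>x\<in>carrier (FObj F X). \<phi> X x)"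

lemma mk_map_apply [simp]:
  "X \<in> Obj C \<Longrightarrow> x \<in> carrier (FObj F X) \<Longrightarrow> mk_map C F \<phi> X x = \<phi> X x"
  by (simp add: mk_map_def)

definition submodule :: "('o, 'u) module \<Rightarrow> ('o \<Rightarrow> 'u set) \<Rightarrow> ('o, 'u) module" where
  "submodule F S =
     \<lparr>FObj = (\<lambda>X. (FObj F X)\<lparr>carrier := S X\<rparr>), FArr = (\<lambda>X Y f. restrict (FArr F X Y f) (S Y))\<rparr>"

lemma submodule_simps [simp]:
  "carrier (FObj (submodule F S) X) = S X"
  "mult (FObj (submodule F S) X) = mult (FObj F X)"
  "one (FObj (submodule F S) X) = one (FObj F X)"
  "FArr (submodule F S) X Y f = restrict (FArr F X Y f) (S Y)"
  by (simp_all add: submodule_def)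

locale module_category = preadd C
  for C :: "('o, 'u, 'z) precat_scheme"
begin

abbreviation M where "M \<equiv> Mod_category C"

text \<open>Elementwise form: an equation between arrows of \<open>Ab\<close> is an equation of
  values together with extensionality of both sides.\<close>

lemma module_iff:
  fixes F :: "('o, 'u) module"
  shows "F \<in> Obj M \<longleftrightarrow>
    (\<forall>X\<in>Obj C. comm_group (FObj F X) \<and> small TYPE('u) (carrier (FObj F X))) \<and>
    (\<forall>X\<in>Obj C. \<forall>Y\<in>Obj C. \<forall>f\<in>arr C X Y.
       FArr F X Y f \<in> hom (FObj F Y) (FObj F X) \<and> FArr F X Y f \<in> extensional (carrier (FObj F Y))) \<and>
    (\<forall>X\<in>Obj C. \<forall>x\<in>carrier (FObj F X). FArr F X X (Idn C X) x = x) \<and>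
    (\<forall>X\<in>Obj C. \<forall>Y\<in>Obj C. \<forall>Z\<in>Obj C. \<forall>f\<in>arr C X Y. \<forall>g\<in>arr C Y Z.
       \<forall>x\<in>carrier (FObj F Z). FArr F X Z (Comp C X Y Z g f) x = FArr F X Y f (FArr F Y Z g x)) \<and>
    (\<forall>X\<in>Obj C. \<forall>Y\<in>Obj C. \<forall>f\<in>arr C X Y. \<forall>g\<in>arr C X Y. \<forall>x\<in>carrier (FObj F Y).
       FArr F X Y (f \<otimes>\<^bsub>Hom C X Y\<^esub> g) x = FArr F X Y f x \<otimes>\<^bsub>FObj F X\<^esub> FArr F X Y g x)"
    (is "_ \<longleftrightarrow> ?O \<and> ?A \<and> ?I \<and> ?C \<and> ?M")
proof
  assume "F \<in> Obj M"
  then have F: "is_functor C (opposite Ab) F"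
    "\<forall>X\<in>Obj C. \<forall>Y\<in>Obj C. FArr F X Y \<in> hom (Hom C X Y) (hom_group (FObj F Y) (FObj F X))"
    by (simp_all add: Mod_simps additive_functor_def)
  have F1: "\<forall>X\<in>Obj C. FObj F X \<in> Obj Ab \<and> FArr F X X (Idn C X) = Idn Ab (FObj F X)"
    and F2: "\<forall>X\<in>Obj C. \<forall>Y\<in>Obj C. \<forall>f\<in>arr C X Y. FArr F X Y f \<in> carrier (hom_group (FObj F Y)
        (FObj F X))"
    and F3: "\<forall>X\<in>Obj C. \<forall>Y\<in>Obj C. \<forall>Z\<in>Obj C. \<forall>f\<in>arr C X Y. \<forall>g\<in>arr C Y Z.
        FArr F X Z (Comp C X Y Z g f) =
        Comp Ab (FObj F Z) (FObj F Y) (FObj F X) (FArr F X Y f) (FArr F Y Z g)"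
    using F(1) by (simp_all add: is_functor_def)
  show "?O \<and> ?A \<and> ?I \<and> ?C \<and> ?M"
  proof (intro conjI)
    show ?M using F(2) by (simp add: hom_def)
  qed (use F1 F2 F3 in simp_all)
next
  assume F: "?O \<and> ?A \<and> ?I \<and> ?C \<and> ?M"
  then have O: ?O and A: ?A and I: ?I and CC: ?C and M: ?M by blast+
  have "is_functor C (opposite Ab) F"
    unfolding is_functor_def
  proof (intro conjI ballI)
    fix X assume X: "X \<in> Obj C"
    then show "FObj F X \<in> Obj (opposite Ab)" using O by simp
    have "FArr F X X (Idn C X) \<in> extensional (carrier (FObj F X))" using A X by simp
    then show "FArr F X X (Idn C X) = Idn (opposite Ab) (FObj F X)"
      using I X by (intro extensionalityI[of _ "carrier (FObj F X)"]) simp_all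
  next
    fix X Y f assume "X \<in> Obj C" "Y \<in> Obj C" "f \<in> arr C X Y"
    then show "FArr F X Y f \<in> arr (opposite Ab) (FObj F X) (FObj F Y)"
      using A by simp
  next
    fix X Y Z f g
    assume [simp]: "X \<in> Obj C" "Y \<in> Obj C" "Z \<in> Obj C" "f \<in> arr C X Y" "g \<in> arr C Y Z"
    have "FArr F X Z (Comp C X Y Z g f) \<in> extensional (carrier (FObj F Z))" using A by simp
    then show "FArr F X Z (Comp C X Y Z g f) =
        Comp (opposite Ab) (FObj F X) (FObj F Y) (FObj F Z) (FArr F Y Z g) (FArr F X Y f)"
      using CC by (intro extensionalityI[of _ "carrier (FObj F Z)"]) simp_all
  qed
  moreover have "FArr F X Y \<in> hom (Hom C X Y) (hom_group (FObj F Y) (FObj F X))"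
    if [simp]: "X \<in> Obj C" "Y \<in> Obj C" for X Y
  proof (rule homI)
    fix f assume "f \<in> arr C X Y"
    then show "FArr F X Y f \<in> carrier (hom_group (FObj F Y) (FObj F X))" using A by simp
  next
    fix f g assume [simp]: "f \<in> arr C X Y" "g \<in> arr C X Y"
    have "FArr F X Y (f \<otimes>\<^bsub>Hom C X Y\<^esub> g) \<in> extensional (carrier (FObj F Y))" using A by simp
    then show "FArr F X Y (f \<otimes>\<^bsub>Hom C X Y\<^esub> g) = FArr F X Y f \<otimes>\<^bsub>hom_group (FObj F Y) (FObj F X)\<^esub>
        FArr F X Y g"
      using M by (intro extensionalityI[of _ "carrier (FObj F Y)"]) simp_all
  qed
  ultimately show "F \<in> Obj M" by (simp add: Mod_simps additive_functor_def)
qed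

lemma moduleD:
  fixes F :: "('o, 'u) module"
  assumes F: "F \<in> Obj M"
  shows "X \<in> Obj C \<Longrightarrow> comm_group (FObj F X)" "X \<in> Obj C \<Longrightarrow> small TYPE('u) (carrier (FObj F X))"
    and "\<lbrakk>X \<in> Obj C; Y \<in> Obj C; f \<in> arr C X Y\<rbrakk> \<Longrightarrow> FArr F X Y f \<in> hom (FObj F Y) (FObj F X)"
    and "\<lbrakk>X \<in> Obj C; Y \<in> Obj C; f \<in> arr C X Y\<rbrakk> \<Longrightarrow> FArr F X Y f \<in> extensional (carrier (FObj F Y))"
    and "\<lbrakk>X \<in> Obj C; x \<in> carrier (FObj F X)\<rbrakk> \<Longrightarrow> FArr F X X (Idn C X) x = x"
    and "\<lbrakk>X \<in> Obj C; Y \<in> Obj C; Z \<in> Obj C; f \<in> arr C X Y; g \<in> arr C Y Z;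
       z \<in> carrier (FObj F Z)\<rbrakk> \<Longrightarrow> FArr F X Z (Comp C X Y Z g f) z = FArr F X Y f (FArr F Y Z g z)"
    and "\<lbrakk>X \<in> Obj C; Y \<in> Obj C; f \<in> arr C X Y; g \<in> arr C X Y; y \<in> carrier (FObj F Y)\<rbrakk> \<Longrightarrow>
       FArr F X Y (f \<otimes>\<^bsub>Hom C X Y\<^esub> g) y = FArr F X Y f y \<otimes>\<^bsub>FObj F X\<^esub> FArr F X Y g y"
  using F[unfolded module_iff] by simp_all

lemma module_group: "F \<in> Obj M \<Longrightarrow> X \<in> Obj C \<Longrightarrow> group (FObj F X)"
  using moduleD(1) comm_group_def by blast

lemma module_arr_group_hom:
  "\<lbrakk>F \<in> Obj M; X \<in> Obj C; Y \<in> Obj C; f \<in> arr C X Y\<rbrakk> \<Longrightarrow>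
    group_hom (FObj F Y) (FObj F X) (FArr F X Y f)"
  by (simp add: group_hom_def group_hom_axioms_def module_group moduleD(3))

lemma module_arr_closed:
  "\<lbrakk>F \<in> Obj M; X \<in> Obj C; Y \<in> Obj C; f \<in> arr C X Y; y \<in> carrier (FObj F Y)\<rbrakk> \<Longrightarrow>
    FArr F X Y f y \<in> carrier (FObj F X)"
  by (rule hom_in_carrier[OF moduleD(3)])

section \<open>Morphisms of modules\<close>

lemma mod_hom_iff:
  assumes "F \<in> Obj M" "G \<in> Obj M"
  shows "\<eta> \<in> arr M F G \<longleftrightarrow> \<eta> \<in> extensional (Obj C) \<and>
    (\<forall>X\<in>Obj C. \<eta> X \<in> hom (FObj F X) (FObj G X) \<and> \<eta> X \<in> extensional (carrier (FObj F X))) \<and>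
    (\<forall>X\<in>Obj C. \<forall>Y\<in>Obj C. \<forall>f\<in>arr C X Y. \<forall>y\<in>carrier (FObj F Y).
       \<eta> X (FArr F X Y f y) = FArr G X Y f (\<eta> Y y))"
proof -
  have "(\<lambda>x\<in>A. h x) = (\<lambda>x\<in>A. k x) \<longleftrightarrow> (\<forall>x\<in>A. h x = k x)" for A :: "'u set" and h k :: "'u \<Rightarrow> 'u"
    by (metis restrict_apply' restrict_ext)
  then show ?thesis
    by (auto simp: Mod_simps nat_trans_def)
qed

lemma mod_homD:
  assumes "F \<in> Obj M" "G \<in> Obj M" "\<eta> \<in> arr M F G"
  shows "\<eta> \<in> extensional (Obj C)" "X \<in> Obj C \<Longrightarrow> \<eta> X \<in> hom (FObj F X) (FObj G X)"
    and "X \<in> Obj C \<Longrightarrow> \<eta> X \<in> extensional (carrier (FObj F X))"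
    and "X \<in> Obj C \<Longrightarrow> x \<in> carrier (FObj F X) \<Longrightarrow> \<eta> X x \<in> carrier (FObj G X)"
    and "\<lbrakk>X \<in> Obj C; Y \<in> Obj C; f \<in> arr C X Y; y \<in> carrier (FObj F Y)\<rbrakk> \<Longrightarrow>
       \<eta> X (FArr F X Y f y) = FArr G X Y f (\<eta> Y y)"
  using assms(3)[unfolded mod_hom_iff[OF assms(1,2)]] by (simp_all add: hom_def Pi_iff)

lemma mod_hom_mult:
  assumes "F \<in> Obj M" "G \<in> Obj M" "\<eta> \<in> arr M F G" "X \<in> Obj C"
    "x \<in> carrier (FObj F X)" "y \<in> carrier (FObj F X)"
  shows "\<eta> X (x \<otimes>\<^bsub>FObj F X\<^esub> y) = \<eta> X x \<otimes>\<^bsub>FObj G X\<^esub> \<eta> X y"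
  using mod_homD(2)[OF assms(1-4)] assms(5,6) by (simp add: hom_def)

lemma mod_hom_group_hom:
  assumes "F \<in> Obj M" "G \<in> Obj M" "\<eta> \<in> arr M F G" "X \<in> Obj C"
  shows "group_hom (FObj F X) (FObj G X) (\<eta> X)"
  using assms by (simp add: group_hom_def group_hom_axioms_def module_group mod_homD)

lemma mod_hom_eqI:
  assumes "F \<in> Obj M" "G \<in> Obj M" "\<eta> \<in> arr M F G" "\<theta> \<in> arr M F G"
    and eq: "\<And>X x. X \<in> Obj C \<Longrightarrow> x \<in> carrier (FObj F X) \<Longrightarrow> \<eta> X x = \<theta> X x"
  shows "\<eta> = \<theta>"
proof (rule extensionalityI)
  show "\<eta> \<in> extensional (Obj C)" "\<theta> \<in> extensional (Obj C)" using mod_homD(1) assms by blast+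
  fix X assume X: "X \<in> Obj C"
  show "\<eta> X = \<theta> X"
    by (rule extensionalityI[OF mod_homD(3)[OF assms(1-3) X] mod_homD(3)[OF assms(1,2,4) X]])
        (rule eq[OF X])
qed

lemma mk_map_closed:
  assumes "F \<in> Obj M" "G \<in> Obj M"
    and hom: "\<And>X. X \<in> Obj C \<Longrightarrow> \<phi> X \<in> hom (FObj F X) (FObj G X)"
    and nat: "\<And>X Y f y. \<lbrakk>X \<in> Obj C; Y \<in> Obj C; f \<in> arr C X Y; y \<in> carrier (FObj F Y)\<rbrakk> \<Longrightarrow>
      \<phi> X (FArr F X Y f y) = FArr G X Y f (\<phi> Y y)"
  shows "mk_map C F \<phi> \<in> arr M F G"
proof -
  have "(\<lambda>x\<in>carrier (FObj F X). \<phi> X x) \<in> hom (FObj F X) (FObj G X)" if X: "X \<in> Obj C" for X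
  proof -
    interpret group "FObj F X" using module_group[OF assms(1) X] .
    show ?thesis using hom[OF X] by (auto simp: hom_def)
  qed
  moreover have "FArr F X Y f y \<in> carrier (FObj F X)"
    if "X \<in> Obj C" "Y \<in> Obj C" "f \<in> arr C X Y" "y \<in> carrier (FObj F Y)" for X Y f y
    using module_arr_closed[OF assms(1)] that by simp
  ultimately show ?thesis
    unfolding mod_hom_iff[OF assms(1,2)] using nat by (simp add: mk_map_def)
qed

lemma mod_comp_apply [simp]:
  "X \<in> Obj C \<Longrightarrow> x \<in> carrier (FObj F X) \<Longrightarrow> Comp M F G H \<beta> \<alpha> X x = \<beta> X (\<alpha> X x)"
  by (simp add: Mod_simps)

lemma mod_idn_apply [simp]:
  "X \<in> Obj C \<Longrightarrow> x \<in> carrier (FObj F X) \<Longrightarrow> Idn M F X x = x"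
  by (simp add: Mod_simps)

lemma mod_idn_closed: "F \<in> Obj M \<Longrightarrow> Idn M F \<in> arr M F F"
  using mk_map_closed[of F F "\<lambda>X x. x"] by (simp add: mk_map_def Mod_simps hom_def)

lemma mod_comp_closed:
  assumes "F \<in> Obj M" "G \<in> Obj M" "H \<in> Obj M" "\<alpha> \<in> arr M F G" "\<beta> \<in> arr M G H"
  shows "Comp M F G H \<beta> \<alpha> \<in> arr M F H"
proof -
  have "mk_map C F (\<lambda>X x. \<beta> X (\<alpha> X x)) \<in> arr M F H"
  proof (rule mk_map_closed)
    fix X assume X: "X \<in> Obj C"
    show "(\<lambda>x. \<beta> X (\<alpha> X x)) \<in> hom (FObj F X) (FObj H X)"
      using hom_compose[OF mod_homD(2)[OF assms(1,2,4) X] mod_homD(2)[OF assms(2,3,5) X]]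
        by (simp add: comp_def)
  qed (use assms in \<open>simp_all add: mod_homD[of F G \<alpha>] mod_homD[of G H \<beta>]\<close>)
  then show ?thesis by (simp add: Mod_simps mk_map_def)
qed

lemma mod_cat: "cat M"
proof
  show "category M"
    unfolding category_def
  proof (intro conjI ballI)
    show "Idn M F \<in> arr M F F" if "F \<in> Obj M" for F
      using mod_idn_closed that .
    show "Comp M F G H \<beta> \<alpha> \<in> arr M F H"
      if "F \<in> Obj M" "G \<in> Obj M" "H \<in> Obj M" "\<alpha> \<in> arr M F G" "\<beta> \<in> arr M G H"
      for F G H \<alpha> \<beta>
      using mod_comp_closed that .
    show "Comp M F F G \<alpha> (Idn M F) = \<alpha>" "Comp M F G G (Idn M G) \<alpha> = \<alpha>"
      if [simp]: "F \<in> Obj M" "G \<in> Obj M" "\<alpha> \<in> arr M F G" for F G \<alpha>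
      by (rule mod_hom_eqI[of F G]; simp add: mod_comp_closed mod_idn_closed mod_homD[of F G])+
    show "Comp M E F H (Comp M F G H \<gamma> \<beta>) \<alpha> = Comp M E G H \<gamma> (Comp M E F G \<beta> \<alpha>)"
      if [simp]: "E \<in> Obj M" "F \<in> Obj M" "G \<in> Obj M" "H \<in> Obj M" "\<alpha> \<in> arr M E F"
        "\<beta> \<in> arr M F G" "\<gamma> \<in> arr M G H" for E F G H \<alpha> \<beta> \<gamma>
      by (rule mod_hom_eqI[of E H]) (simp_all add: mod_comp_closed mod_homD(4)[of E F])
  qed
qed

end

sublocale module_category \<subseteq> Mod: cat "Mod_category C"
  by (rule mod_cat)

section \<open>Submodules and summands of modules\<close>

context module_category
begin

lemma submodule_closed:
  assumes F: "F \<in> Obj M" and S: "\<And>X. X \<in> Obj C \<Longrightarrow> subgroup (S X) (FObj F X)"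
    and arr: "\<And>X Y f y. \<lbrakk>X \<in> Obj C; Y \<in> Obj C; f \<in> arr C X Y; y \<in> S Y\<rbrakk> \<Longrightarrow> FArr F X Y f y \<in> S X"
  shows "submodule F S \<in> Obj M"
proof -
  have sub: "y \<in> carrier (FObj F X)" if "X \<in> Obj C" "y \<in> S X" for X y
    using subgroup.mem_carrier[OF S] that by simp
  have "comm_group (FObj (submodule F S) X)" if X: "X \<in> Obj C" for X
  proof -
    interpret comm_group "FObj F X" by (rule moduleD(1)[OF F X])
    show ?thesis
      using subgroup_imp_group[OF S[OF X]] sub[OF X]
      by (auto simp: submodule_def comm_group_def comm_monoid_def comm_monoid_axioms_def group_def
          intro!: m_comm)
  qed
  moreover have "small TYPE('u) (S X)" if X: "X \<in> Obj C" for X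
    using small_subset[OF moduleD(2)[OF F X]] sub[OF X] by blast
  moreover have "restrict (FArr F X Y f) (S Y) \<in> hom (FObj (submodule F S) Y)
      (FObj (submodule F S) X)"
    if f: "X \<in> Obj C" "Y \<in> Obj C" "f \<in> arr C X Y" for X Y f
  proof (rule homI)
    show "restrict (FArr F X Y f) (S Y) x \<in> carrier (FObj (submodule F S) X)"
      if "x \<in> carrier (FObj (submodule F S) Y)" for x using that arr[OF f] by simp
    show "restrict (FArr F X Y f) (S Y) (x \<otimes>\<^bsub>FObj (submodule F S) Y\<^esub> y) =
       restrict (FArr F X Y f) (S Y) x \<otimes>\<^bsub>FObj (submodule F S) X\<^esub> restrict (FArr F X Y f) (S Y) y"
      if "x \<in> carrier (FObj (submodule F S) Y)" "y \<in> carrier (FObj (submodule F S) Y)" for x y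
      using that subgroup.m_closed[OF S[OF f(2)]] hom_mult[OF moduleD(3)[OF F f]] sub[OF f(2)]
        by simp
  qed
  ultimately show ?thesis
    unfolding module_iff using arr sub
    by (simp add: moduleD[OF F])
qed

lemma submodule_inclusion:
  assumes F: "F \<in> Obj M" and N: "submodule F S \<in> Obj M"
      and S: "\<And>X. X \<in> Obj C \<Longrightarrow> S X \<subseteq> carrier (FObj F X)"
  shows "mk_map C (submodule F S) (\<lambda>X x. x) \<in> arr M (submodule F S) F"
    and "mono_arrow M (submodule F S) F (mk_map C (submodule F S) (\<lambda>X x. x))"
proof -
  show *: "mk_map C (submodule F S) (\<lambda>X x. x) \<in> arr M (submodule F S) F"
    by (rule mk_map_closed[OF N F]) (use S in \<open>auto simp: hom_def\<close>)
  show "mono_arrow M (submodule F S) F (mk_map C (submodule F S) (\<lambda>X x. x))"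
    unfolding mono_arrow_def
  proof (intro conjI * ballI inj_onI)
    fix W \<alpha> \<beta>
    assume W: "W \<in> Obj M" and \<alpha>: "\<alpha> \<in> arr M W (submodule F S)" and \<beta>: "\<beta> \<in> arr M W (submodule F S)"
      and eq: "Comp M W (submodule F S) F (mk_map C (submodule F S) (\<lambda>X x. x)) \<alpha> =
          Comp M W (submodule F S) F (mk_map C (submodule F S) (\<lambda>X x. x)) \<beta>"
    show "\<alpha> = \<beta>"
    proof (rule mod_hom_eqI[OF W N \<alpha> \<beta>])
      fix X x assume X: "X \<in> Obj C" and x: "x \<in> carrier (FObj W X)"
      from fun_cong[OF fun_cong[OF eq, of X], of x] show "\<alpha> X x = \<beta> X x"
        using X x mod_homD(4)[OF W N \<alpha> X x] mod_homD(4)[OF W N \<beta> X x] by simp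
    qed
  qed
qed

text \<open>The retraction is the map out of the coproduct that is the identity on \<open>F\<close>
  and zero on the complement.\<close>

lemma summand_imp_retract:
  assumes "summand_of M F G"
  shows "retract_of M F G"
proof -
  obtain N \<iota> where P: "is_coproduct M (UNIV :: bool set) (\<lambda>b. if b then F else N) G \<iota>"
    using assms by (auto simp: summand_of_def)
  note PD = Mod.coproductD[OF P]
  have F: "F \<in> Obj M" and N: "N \<in> Obj M" and \<iota>: "\<iota> True \<in> arr M F G"
    using PD(2)[of True] PD(2)[of False] PD(3)[of True] by simp_all
  let ?z = "mk_map C N (\<lambda>X x. \<one>\<^bsub>FObj F X\<^esub>)"
  have 0: "?z \<in> arr M N F"
  proof (rule mk_map_closed[OF N F])
    show "(\<lambda>x. \<one>\<^bsub>FObj F X\<^esub>) \<in> hom (FObj N X) (FObj F X)" if X: "X \<in> Obj C" for X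
    proof -
      interpret group "FObj F X" by (rule module_group[OF F X])
      show ?thesis by (simp add: hom_def)
    qed
    show "\<one>\<^bsub>FObj F X\<^esub> = FArr F X Y f \<one>\<^bsub>FObj F Y\<^esub>"
      if "X \<in> Obj C" "Y \<in> Obj C" "f \<in> arr C X Y" for X Y f
      using group_hom.hom_one[OF module_arr_group_hom[OF F that]] by simp
  qed
  obtain r where r: "r \<in> arr M G F"
    "\<And>b. b \<in> UNIV \<Longrightarrow> Comp M (if b then F else N) G F r (\<iota> b) = (if b then Idn M F else ?z)"
    by (rule Mod.coproduct_lift[OF P F, of "\<lambda>b. if b then Idn M F else ?z"])
      (use F 0 in \<open>simp_all add: mod_idn_closed split: if_splits\<close>)
  show ?thesis
    by (rule Mod.retract_ofI[OF F PD(1) \<iota> r(1)]) (use r(2)[of True] in simp)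
qed

end

section \<open>The restricted Yoneda functor\<close>

lemma compacts_simps [simp]:
  "Obj (compacts T) = {C. compact_object T C}" "Hom (compacts T) = Hom T"
  "Idn (compacts T) = Idn T" "Comp (compacts T) = Comp T"
  by (simp_all add: compacts_def full_subcategory_def)

lemma yon_simps [simp]:
  "FObj (yon T X) C = Hom T C X"
  "FArr (yon T X) C C' c = (\<lambda>f\<in>arr T C' X. Comp T C C' X f c)"
  by (simp_all add: yon_def)

lemma (in preadd) preadd_compacts: "preadd (compacts C)"
proof
  show "preadditive (compacts C)"
    unfolding preadditive_def category_def
    by (simp add: comp_assoc hom_comm_group comp_hom_left comp_hom_right)
qed

sublocale comp_gen \<subseteq> Cpt: module_category "compacts T"
  by (rule module_category.intro[OF preadd_compacts])

lemma (in group_hom) hom_finprod: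
  assumes "comm_group G" "comm_group H" "f \<in> A \<rightarrow> carrier G"
  shows "h (finprod G f A) = finprod H (\<lambda>i. h (f i)) A"
proof -
  interpret G: comm_group G by fact
  interpret H: comm_group H by fact
  show ?thesis
    using assms(3)
  proof (induction A rule: infinite_finite_induct)
    case (insert a A)
    then have "f \<in> A \<rightarrow> carrier G" "f a \<in> carrier G" by auto
    moreover have "(\<lambda>i. h (f i)) \<in> A \<rightarrow> carrier H" using calculation by (simp add: Pi_iff)
    ultimately show ?case using insert by simp
  qed simp_all
qed

context comp_gen
begin

lemma yon_module: "X \<in> Obj T \<Longrightarrow> yon T X \<in> Obj (ModC T)"
  unfolding Cpt.module_iff
  by (auto simp: hom_comm_group small_hom comp_assoc comp_mult hom_def)

lemma yon_arr_eq: "yon_arr T X Y g = mk_map (compacts T) (yon T X) (\<lambda>C. Comp T C X Y g)"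
  by (simp add: yon_arr_def mk_map_def)

lemma yon_arr_apply [simp]:
  "compact_object T C \<Longrightarrow> x \<in> arr T C X \<Longrightarrow> yon_arr T X Y g C x = Comp T C X Y g x"
  by (simp add: yon_arr_def)

lemma yon_arr_closed:
  assumes "X \<in> Obj T" "Y \<in> Obj T" "g \<in> arr T X Y"
  shows "yon_arr T X Y g \<in> arr (ModC T) (yon T X) (yon T Y)"
  unfolding yon_arr_eq
  by (rule Cpt.mk_map_closed) (use assms in \<open>simp_all add: yon_module comp_hom_right comp_assoc\<close>)

lemma yon_functor: "cat_functor T (ModC T) \<lparr>FObj = yon T, FArr = yon_arr T\<rparr>"
proof (intro cat_functor.intro cat_functor_axioms.intro)
  show "cat T" "cat (ModC T)" by unfold_locales
  show "is_functor T (ModC T) \<lparr>FObj = yon T, FArr = yon_arr T\<rparr>"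
    unfolding is_functor_def
  proof (simp, intro conjI ballI)
    fix X assume X: "X \<in> Obj T"
    show "yon T X \<in> Obj (ModC T)" by (rule yon_module[OF X])
    show "yon_arr T X X (Idn T X) = Idn (ModC T) (yon T X)"
      by (rule Cpt.mod_hom_eqI[of "yon T X" "yon T X"])
        (use X in \<open>simp_all add: yon_module yon_arr_closed Cpt.mod_idn_closed\<close>)
  next
    fix X Y f assume "X \<in> Obj T" "Y \<in> Obj T" "f \<in> arr T X Y"
    then show "yon_arr T X Y f \<in> arr (ModC T) (yon T X) (yon T Y)" by (rule yon_arr_closed)
  next
    fix X Y Z f g
    assume [simp]: "X \<in> Obj T" "Y \<in> Obj T" "Z \<in> Obj T" "f \<in> arr T X Y" "g \<in> arr T Y Z"
    show "yon_arr T X Z (Comp T X Y Z g f) =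
        Comp (ModC T) (yon T X) (yon T Y) (yon T Z) (yon_arr T Y Z g) (yon_arr T X Y f)"
      by (rule Cpt.mod_hom_eqI[of "yon T X" "yon T Z"])
        (simp_all add: yon_module yon_arr_closed Cpt.mod_comp_closed comp_assoc)
  qed
qed

lemma yon_retract: "retract_of T X Y \<Longrightarrow> retract_of (ModC T) (yon T X) (yon T Y)"
  using cat_functor.preserves_retract[OF yon_functor] by simp

lemma mod_hom_module_map:
  assumes "X \<in> Obj T" "Y \<in> Obj T" "\<eta> \<in> arr (ModC T) (yon T X) (yon T Y)"
  shows "module_map T X Y \<eta>"
  unfolding module_map_def
proof (intro conjI allI impI)
  note D = Cpt.mod_homD[OF yon_module[OF assms(1)] yon_module[OF assms(2)] assms(3)]
  show "\<eta> C \<in> hom (Hom T C X) (Hom T C Y)" if "compact_object T C" for C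
    using D(2)[of C] that by simp
  show "\<eta> C (Comp T C C' X x c) = Comp T C C' Y (\<eta> C' x) c"
    if "compact_object T C \<and> compact_object T C' \<and> c \<in> arr T C C' \<and> x \<in> arr T C' X" for C C' c x
    using D(5)[of C C' c x] D(4)[of C' x] that by simp
qed

text \<open>The mediating map sends \<open>x\<close> to the sum of the values of the
  \<open>f i\<close> at the components of \<open>x\<close>. The decomposition of \<open>x\<close>
  into its components, recorded in \<open>sum\<close>, shows that it is the only one.\<close>

lemma yon_finite_coproduct:
  assumes P: "is_coproduct T I X P \<iota>" and I: "finite I"
  shows "is_coproduct (ModC T) I (\<lambda>i. yon T (X i)) (yon T P) (\<lambda>i. yon_arr T (X i) P (\<iota> i))"
proof -
  note [simp] = coproductD[OF P] yon_module
  obtain \<pi> where \<pi>: "\<And>i. i \<in> I \<Longrightarrow> \<pi> i \<in> arr T P (X i)"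
    "\<And>i. i \<in> I \<Longrightarrow> Comp T (X i) P (X i) (\<pi> i) (\<iota> i) = Idn T (X i)"
    "\<And>i j. i \<in> I \<Longrightarrow> j \<in> I \<Longrightarrow> i \<noteq> j \<Longrightarrow>
      Comp T (X i) P (X j) (\<pi> j) (\<iota> i) = zero_arr T (X i) (X j)"
    using coproduct_proj[OF P] by metis
  note [simp] = \<pi>(1)
  have sum: "finprod (Hom T C P) (\<lambda>i. Comp T C (X i) P (\<iota> i) (Comp T C P (X i) (\<pi> i) x)) I = x"
    if [simp]: "C \<in> Obj T" "x \<in> arr T C P" for C x
  proof -
    interpret G: comm_group "Hom T C P" by (rule hom_comm_group) simp_all
    have "x = Comp T C P P (finprod (Hom T P P) (\<lambda>i. Comp T P (X i) P (\<iota> i) (\<pi> i)) I) x"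
      by (subst finite_coproduct_sum[OF P I \<pi>]) simp_all
    also have "\<dots> = finprod (Hom T C P) (\<lambda>i. Comp T C P P (Comp T P (X i) P (\<iota> i) (\<pi> i)) x) I"
      by (rule comp_finprod) auto
    also have "\<dots> = finprod (Hom T C P) (\<lambda>i. Comp T C (X i) P (\<iota> i) (Comp T C P (X i) (\<pi> i) x)) I"
      by (rule G.finprod_cong') (auto simp: comp_assoc)
    finally show ?thesis ..
  qed
  have "\<exists>!h. h \<in> arr (ModC T) (yon T P) Z \<and>
      (\<forall>i\<in>I. Comp (ModC T) (yon T (X i)) (yon T P) Z h (yon_arr T (X i) P (\<iota> i)) = f i)"
    if Z: "Z \<in> Obj (ModC T)" and "\<forall>i\<in>I. f i \<in> arr (ModC T) (yon T (X i)) Z" for Z f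
  proof -
    have f: "\<And>i. i \<in> I \<Longrightarrow> f i \<in> arr (ModC T) (yon T (X i)) Z" using that by blast
    have f_gh: "group_hom (Hom T C (X i)) (FObj Z C) (f i C)" if "i \<in> I"
        "compact_object T C" for i C
      using Cpt.mod_hom_group_hom[OF _ Z f[OF that(1)], of C] that by simp
    have f_closed: "f i C x \<in> carrier (FObj Z C)" if "i \<in> I" "compact_object T C"
        "x \<in> arr T C (X i)" for i C x
      using group_hom.hom_closed[OF f_gh[OF that(1,2)] that(3)] .
    let ?f = "\<lambda>C x i. f i C (Comp T C P (X i) (\<pi> i) x)"
    let ?h = "\<lambda>C x. finprod (FObj Z C) (?f C x) I"
    have fx: "?f C x \<in> I \<rightarrow> carrier (FObj Z C)" if "compact_object T C" "x \<in> arr T C P" for C x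
      using that by (auto intro: f_closed)
    have Zc: "comm_group (FObj Z C)" if "compact_object T C" for C
      using Cpt.moduleD(1)[OF Z] that by simp
    have h: "mk_map (compacts T) (yon T P) ?h \<in> arr (ModC T) (yon T P) Z"
    proof (rule Cpt.mk_map_closed[OF _ Z])
      fix C assume "C \<in> Obj (compacts T)"
      then have C [simp]: "compact_object T C" by simp
      interpret Z: comm_group "FObj Z C" by (rule Zc[OF C])
      show "?h C \<in> hom (FObj (yon T P) C) (FObj Z C)"
      proof (rule homI)
        fix x y assume "x \<in> carrier (FObj (yon T P) C)" "y \<in> carrier (FObj (yon T P) C)"
        then have xy [simp]: "x \<in> arr T C P" "y \<in> arr T C P" by simp_all
        show "?h C x \<in> carrier (FObj Z C)" by (rule Z.finprod_closed[OF fx[OF C xy(1)]])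
        have "?h C (x \<otimes>\<^bsub>Hom T C P\<^esub> y) = finprod (FObj Z C) (\<lambda>i. ?f C x i \<otimes>\<^bsub>FObj Z C\<^esub> ?f C y i) I"
        proof (rule Z.finprod_cong')
          fix i assume i: "i \<in> I"
          interpret fi: group_hom "Hom T C (X i)" "FObj Z C" "f i C" by (rule f_gh[OF i C])
          show "?f C (x \<otimes>\<^bsub>Hom T C P\<^esub> y) i = ?f C x i \<otimes>\<^bsub>FObj Z C\<^esub> ?f C y i"
            using i by (simp add: comp_mult)
        qed (use fx[OF C xy(1)] fx[OF C xy(2)] in auto)
        also have "\<dots> = ?h C x \<otimes>\<^bsub>FObj Z C\<^esub> ?h C y"
          by (rule Z.finprod_multf[OF fx[OF C xy(1)] fx[OF C xy(2)]])
        finally show "?h C (x \<otimes>\<^bsub>FObj (yon T P) C\<^esub> y) = ?h C x \<otimes>\<^bsub>FObj Z C\<^esub> ?h C y" by simp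
      qed
    next
      fix C C' c x
      assume "C \<in> Obj (compacts T)" "C' \<in> Obj (compacts T)" "c \<in> arr (compacts T) C C'"
        "x \<in> carrier (FObj (yon T P) C')"
      then have C [simp]: "compact_object T C" "compact_object T C'" "c \<in> arr T C C'"
        and x [simp]: "x \<in> arr T C' P" by simp_all
      interpret Z: group_hom "FObj Z C'" "FObj Z C" "FArr Z C C' c"
        by (rule Cpt.module_arr_group_hom[OF Z]) simp_all
      interpret Z': comm_group "FObj Z C" by (rule Zc) simp
      have "?h C (Comp T C C' P x c) = finprod (FObj Z C) (\<lambda>i. FArr Z C C' c (?f C' x i)) I"
      proof (rule Z'.finprod_cong')
        fix i assume i: "i \<in> I"
        have "f i C (FArr (yon T (X i)) C C' c (Comp T C' P (X i) (\<pi> i) x)) =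
            FArr Z C C' c (?f C' x i)"
          by (rule Cpt.mod_homD(5)[OF _ Z f[OF i]]) (use i in simp_all)
        then show "?f C (Comp T C C' P x c) i = FArr Z C C' c (?f C' x i)"
          using i by (simp add: comp_assoc)
      qed (use fx[OF C(2) x] in \<open>simp_all add: Pi_iff\<close>)
      also have "\<dots> = FArr Z C C' c (?h C' x)"
        by (rule Z.hom_finprod[OF Zc Zc fx, symmetric]) simp_all
      finally show "?h C (FArr (yon T P) C C' c x) = FArr Z C C' c (?h C' x)" by simp
    qed simp
    show ?thesis
    proof (rule ex1I[of _ "mk_map (compacts T) (yon T P) ?h"], intro conjI h ballI)
      fix j assume j [simp]: "j \<in> I"
      show "Comp (ModC T) (yon T (X j)) (yon T P) Z (mk_map (compacts T) (yon T P) ?h)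
          (yon_arr T (X j) P (\<iota> j)) = f j"
      proof (rule Cpt.mod_hom_eqI[OF _ Z Cpt.mod_comp_closed[OF _ _ Z yon_arr_closed h] f[OF j]])
        fix C x assume "C \<in> Obj (compacts T)" "x \<in> carrier (FObj (yon T (X j)) C)"
        then have C [simp]: "compact_object T C" and x [simp]: "x \<in> arr T C (X j)" by simp_all
        interpret Z: comm_group "FObj Z C" by (rule Zc) simp
        have "?h C (Comp T C (X j) P (\<iota> j) x) =
            finprod (FObj Z C) (\<lambda>i. if j = i then f j C x else \<one>\<^bsub>FObj Z C\<^esub>) I"
        proof (rule Z.finprod_cong')
          fix i assume i [simp]: "i \<in> I"
          have "?f C (Comp T C (X j) P (\<iota> j) x) i =
              f i C (Comp T C (X j) (X i) (Comp T (X j) P (X i) (\<pi> i) (\<iota> j)) x)"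
            by (simp add: comp_assoc)
          also have "\<dots> = (if j = i then f j C x else \<one>\<^bsub>FObj Z C\<^esub>)"
            using group_hom.hom_one[OF f_gh[OF i C]] x
              by (cases "j = i") (auto simp del: x simp: \<pi>(2,3))
          finally show "?f C (Comp T C (X j) P (\<iota> j) x) i =
              (if j = i then f j C x else \<one>\<^bsub>FObj Z C\<^esub>)" .
        qed (use f_closed[OF j C x] in auto)
        also have "\<dots> = f j C x"
          using Z.finprod_singleton[OF j I, of "\<lambda>_. f j C x"] f_closed[OF j C x] by simp
        finally show "Comp (ModC T) (yon T (X j)) (yon T P) Z (mk_map (compacts T) (yon T P) ?h)
            (yon_arr T (X j) P (\<iota> j)) C x = f j C x"
          by simp
      qed simp_all
    next
      fix k assume k: "k \<in> arr (ModC T) (yon T P) Z \<and>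
        (\<forall>i\<in>I. Comp (ModC T) (yon T (X i)) (yon T P) Z k (yon_arr T (X i) P (\<iota> i)) = f i)"
      then have k': "k \<in> arr (ModC T) (yon T P) Z" by simp
      show "k = mk_map (compacts T) (yon T P) ?h"
      proof (rule Cpt.mod_hom_eqI[OF _ Z k' h])
        fix C x assume "C \<in> Obj (compacts T)" "x \<in> carrier (FObj (yon T P) C)"
        then have C [simp]: "compact_object T C" and x [simp]: "x \<in> arr T C P" by simp_all
        interpret Z: comm_group "FObj Z C" by (rule Zc) simp
        interpret k: group_hom "Hom T C P" "FObj Z C" "k C"
          using Cpt.mod_hom_group_hom[OF _ Z k', of C] by simp
        have kf: "k C (Comp T C (X i) P (\<iota> i) (Comp T C P (X i) (\<pi> i) x)) =
            ?f C x i" if i: "i \<in> I" for i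
        proof -
          have "Comp (ModC T) (yon T (X i)) (yon T P) Z k (yon_arr T (X i) P (\<iota> i)) = f i"
            using k i by blast
          from fun_cong[OF fun_cong[OF this, of C], of "Comp T C P (X i) (\<pi> i) x"] show ?thesis
            using i by simp
        qed
        have "k C x = k C (finprod (Hom T C P) (\<lambda>i. Comp T C (X i) P (\<iota> i) (Comp T C P (X i) (\<pi> i)
            x)) I)"
          by (simp add: sum)
        also have "\<dots> = finprod (FObj Z C) (\<lambda>i. k C (Comp T C (X i) P (\<iota> i) (Comp T C P (X i) (\<pi> i)
            x))) I"
          by (rule k.hom_finprod) (auto simp: hom_comm_group Zc)
        also have "\<dots> = ?h C x"
          by (rule Z.finprod_cong'[OF refl fx[OF C x] kf])
        finally show "k C x = mk_map (compacts T) (yon T P) ?h C x" by simp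
      qed simp
    qed
  qed
  then show ?thesis by (simp add: is_coproduct_def yon_arr_closed)
qed

text \<open>Each component of \<open>f\<close> is extended along \<open>m\<close>, and the
  extensions are added up. With the corresponding fact for retracts this makes all of add(Q\<X>)
  pure injective.\<close>

lemma yon_injective_finite_coproduct:
  assumes P: "is_coproduct T I X P \<iota>" and I: "finite I"
    and inj: "\<And>i. i \<in> I \<Longrightarrow> injective_object (ModC T) (yon T (X i))"
  shows "injective_object (ModC T) (yon T P)"
  unfolding injective_object_def
proof (intro conjI ballI allI impI)
  note [simp] = coproductD[OF P] yon_module
  show "yon T P \<in> Obj (ModC T)" by simp
  obtain \<pi> where \<pi>: "\<And>i. i \<in> I \<Longrightarrow> \<pi> i \<in> arr T P (X i)"
    "\<And>i. i \<in> I \<Longrightarrow> Comp T (X i) P (X i) (\<pi> i) (\<iota> i) = Idn T (X i)"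
    "\<And>i j. i \<in> I \<Longrightarrow> j \<in> I \<Longrightarrow> i \<noteq> j \<Longrightarrow>
      Comp T (X i) P (X j) (\<pi> j) (\<iota> i) = zero_arr T (X i) (X j)"
    using coproduct_proj[OF P] by metis
  note [simp] = \<pi>(1)
  fix A B m f
  assume A: "A \<in> Obj (ModC T)" and B: "B \<in> Obj (ModC T)" and m: "mono_arrow (ModC T) A B m"
    and f: "f \<in> arr (ModC T) A (yon T P)"
  have m': "m \<in> arr (ModC T) A B" using m by (simp add: mono_arrow_def)
  let ?\<pi> = "\<lambda>i. yon_arr T P (X i) (\<pi> i)"
  have "\<exists>g. g \<in> arr (ModC T) B (yon T (X i)) \<and>
      Comp (ModC T) A B (yon T (X i)) g m = Comp (ModC T) A (yon T P) (yon T (X i)) (?\<pi> i) f" if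
          i: "i \<in> I" for i
  proof -
    have "Comp (ModC T) A (yon T P) (yon T (X i)) (?\<pi> i) f \<in> arr (ModC T) A (yon T (X i))"
      by (rule Cpt.mod_comp_closed[OF A _ _ f yon_arr_closed]) (use i in simp_all)
    with inj[OF i, unfolded injective_object_def] A B m show ?thesis by blast
  qed
  then obtain g where g: "\<And>i. i \<in> I \<Longrightarrow> g i \<in> arr (ModC T) B (yon T (X i))"
    and gm: "\<And>i. i \<in> I \<Longrightarrow> Comp (ModC T) A B (yon T (X i)) (g i) m =
      Comp (ModC T) A (yon T P) (yon T (X i)) (?\<pi> i) f" by metis
  have g_closed: "g i C b \<in> arr T C (X i)" if "i \<in> I" "compact_object T C"
      "b \<in> carrier (FObj B C)" for i C b
    using Cpt.mod_homD(4)[OF B _ g[OF that(1)], of C b] that by simp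
  let ?c = "\<lambda>C b i. Comp T C (X i) P (\<iota> i) (g i C b)"
  let ?h = "\<lambda>C b. finprod (Hom T C P) (?c C b) I"
  have c: "?c C b \<in> I \<rightarrow> arr T C P" if "compact_object T C" "b \<in> carrier (FObj B C)" for C b
    using that g_closed by simp
  have h: "mk_map (compacts T) B ?h \<in> arr (ModC T) B (yon T P)"
  proof (rule Cpt.mk_map_closed[OF B])
    fix C assume "C \<in> Obj (compacts T)"
    then have C [simp]: "compact_object T C" by simp
    interpret G: comm_group "Hom T C P" by (rule hom_comm_group) simp_all
    show "?h C \<in> hom (FObj B C) (FObj (yon T P) C)"
    proof (rule homI)
      fix x y assume x: "x \<in> carrier (FObj B C)" and y: "y \<in> carrier (FObj B C)"
      show "?h C x \<in> carrier (FObj (yon T P) C)" using G.finprod_closed[OF c[OF C x]] by simp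
      have "?h C (x \<otimes>\<^bsub>FObj B C\<^esub> y) = finprod (Hom T C P) (\<lambda>i. ?c C x i \<otimes>\<^bsub>Hom T C P\<^esub> ?c C y i) I"
      proof (rule G.finprod_cong')
        fix i assume i: "i \<in> I"
        have "g i C (x \<otimes>\<^bsub>FObj B C\<^esub> y) = g i C x \<otimes>\<^bsub>Hom T C (X i)\<^esub> g i C y"
          using Cpt.mod_hom_mult[OF B _ g[OF i] _ x y] i by simp
        then show "?c C (x \<otimes>\<^bsub>FObj B C\<^esub> y) i = ?c C x i \<otimes>\<^bsub>Hom T C P\<^esub> ?c C y i"
          using i g_closed[OF i C x] g_closed[OF i C y] by (simp add: comp_mult)
      qed (use c[OF C x] c[OF C y] in auto)
      also have "\<dots> = ?h C x \<otimes>\<^bsub>Hom T C P\<^esub> ?h C y"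
        by (rule G.finprod_multf[OF c[OF C x] c[OF C y]])
      finally show "?h C (x \<otimes>\<^bsub>FObj B C\<^esub> y) = ?h C x \<otimes>\<^bsub>FObj (yon T P) C\<^esub> ?h C y" by simp
    qed
  next
    fix C C' k x
    assume "C \<in> Obj (compacts T)" "C' \<in> Obj (compacts T)" "k \<in> arr (compacts T) C C'"
      and x: "x \<in> carrier (FObj B C')"
    then have C [simp]: "compact_object T C" "compact_object T C'" "k \<in> arr T C C'" by simp_all
    interpret G: comm_group "Hom T C P" by (rule hom_comm_group) simp_all
    interpret G': comm_group "Hom T C' P" by (rule hom_comm_group) simp_all
    have "Comp T C C' P (?h C' x) k = finprod (Hom T C P) (\<lambda>i. Comp T C C' P (?c C' x i) k) I"
      by (rule comp_finprod) (use c[OF C(2) x] in simp_all)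
    also have "\<dots> = ?h C (FArr B C C' k x)"
    proof (rule G.finprod_cong')
      have x': "FArr B C C' k x \<in> carrier (FObj B C)"
        by (rule Cpt.module_arr_closed[OF B _ _ _ x]) simp_all
      then show "?c C (FArr B C C' k x) \<in> I \<rightarrow> arr T C P" by (rule c[OF C(1)])
      fix i assume i: "i \<in> I"
      have "g i C (FArr B C C' k x) = FArr (yon T (X i)) C C' k (g i C' x)"
        by (rule Cpt.mod_homD(5)[OF B _ g[OF i] _ _ _ x]) (use i in simp_all)
      then show "Comp T C C' P (?c C' x i) k = ?c C (FArr B C C' k x) i"
        using i g_closed[OF i C(2) x] by (simp add: comp_assoc)
    qed simp
    finally show "?h C (FArr B C C' k x) = FArr (yon T P) C C' k (?h C' x)"
      using G'.finprod_closed[OF c[OF C(2) x]] by simp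
  qed simp
  show "\<exists>h\<in>arr (ModC T) B (yon T P). Comp (ModC T) A B (yon T P) h m = f"
  proof (rule bexI[OF _ h], rule Cpt.mod_hom_eqI[OF A _ Cpt.mod_comp_closed[OF A B _ m' h] f])
    fix C a assume "C \<in> Obj (compacts T)" and a: "a \<in> carrier (FObj A C)"
    then have C [simp]: "compact_object T C" by simp
    interpret G: comm_group "Hom T C P" by (rule hom_comm_group) simp_all
    have fa [simp]: "f C a \<in> arr T C P"
      using Cpt.mod_homD(4)[OF A _ f, of C a] a by simp
    have ma: "m C a \<in> carrier (FObj B C)"
      using Cpt.mod_homD(4)[OF A B m', of C a] a by simp
    have "?h C (m C a) = finprod (Hom T C P) (\<lambda>i. Comp T C P P (Comp T P (X i) P (\<iota> i) (\<pi> i))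
        (f C a)) I"
    proof (rule G.finprod_cong')
      fix i assume i: "i \<in> I"
      have "g i C (m C a) = Comp T C P (X i) (\<pi> i) (f C a)"
        using fun_cong[OF fun_cong[OF gm[OF i], of C], of a] a by simp
      then show "?c C (m C a) i = Comp T C P P (Comp T P (X i) P (\<iota> i) (\<pi> i)) (f C a)"
        using i by (simp add: comp_assoc)
    qed simp_all
    also have "\<dots> = Comp T C P P (finprod (Hom T P P) (\<lambda>i. Comp T P (X i) P (\<iota> i) (\<pi> i)) I) (f C a)"
      by (rule comp_finprod(1)[symmetric]) simp_all
    also have "\<dots> = f C a"
      by (subst finite_coproduct_sum[OF P I \<pi>]) simp_all
    finally show "Comp (ModC T) A B (yon T P) (mk_map (compacts T) B ?h) m C a = f C a"
      using a ma by simp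
  qed simp_all
qed

text \<open>Exactness identifies the image of \<open>u\<close> on compact objects with the kernel of
  \<open>v\<close>, so \<psi> descends to the image of \<open>v\<close>, a submodule of
  \<open>yon T Z\<close>. Injectivity extends it from there to \<open>yon T Z\<close>.\<close>

lemma injective_extends_module_maps:
  assumes inj: "injective_object (ModC T) (yon T E)" and E [simp]: "E \<in> Obj T"
  shows "extends_module_maps T E"
  unfolding extends_module_maps_def
proof (intro allI impI)
  fix X Y Z u v w \<psi>
  assume asm: "(X, Y, Z, u, v, w) \<in> Tri T \<and> module_map T Y E \<psi> \<and>
    (\<forall>C x. compact_object T C \<and> x \<in> arr T C X \<longrightarrow> \<psi> C (Comp T C X Y u x) = zero_arr T C E)"
  then have t: "(X, Y, Z, u, v, w) \<in> Tri T" and \<psi>: "module_map T Y E \<psi>"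
    and kill: "\<And>C x. compact_object T C \<Longrightarrow> x \<in> arr T C X \<Longrightarrow> \<psi> C (Comp T C X Y u x) = zero_arr T C E"
    by auto
  note [simp] = triD[OF t] yon_module
  let ?S = "\<lambda>C. Comp T C Y Z v ` arr T C Y"
  have \<psi>_gh: "group_hom (Hom T C Y) (Hom T C E) (\<psi> C)" if "compact_object T C" for C
    using module_mapD(1)[OF \<psi> that] that by (simp add: group_hom_def group_hom_axioms_def hom_group)
  have \<psi>_eq: "\<psi> C y = \<psi> C y'"
    if C [simp]: "compact_object T C" and y [simp]: "y \<in> arr T C Y" "y' \<in> arr T C Y"
      and eq: "Comp T C Y Z v y = Comp T C Y Z v y'" for C y y'
  proof -
    interpret g: group_hom "Hom T C Y" "Hom T C E" "\<psi> C" by (rule \<psi>_gh[OF C])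
    let ?d = "y \<otimes>\<^bsub>Hom T C Y\<^esub> inv\<^bsub>Hom T C Y\<^esub> y'"
    have "Comp T C Y Z v ?d = zero_arr T C Z"
      by (simp add: comp_diff eq flip: eq_iff_diff)
    then obtain x where "x \<in> arr T C X" "Comp T C X Y u x = ?d"
      by (rule tri_lift[OF t, of C ?d, rotated 2]) simp_all
    then have "\<psi> C ?d = zero_arr T C E" using kill[OF C] by metis
    then show ?thesis by (subst eq_iff_diff[of C E]) simp_all
  qed
  define N where "N = submodule (yon T Z) ?S"
  have S: "subgroup (?S C) (FObj (yon T Z) C)" if "C \<in> Obj (compacts T)" for C
    using group_hom.img_is_subgroup[OF comp_group_hom_right[of C Y Z v]] that by simp
  have N: "N \<in> Obj (ModC T)"
    unfolding N_def
  proof (rule Cpt.submodule_closed[OF _ S])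
    fix C C' c z
    assume "C \<in> Obj (compacts T)" "C' \<in> Obj (compacts T)" "c \<in> arr (compacts T) C C'" "z \<in> ?S C'"
    then show "FArr (yon T Z) C C' c z \<in> ?S C"
      by (auto simp: comp_assoc)
  qed simp_all
  let ?i = "mk_map (compacts T) N (\<lambda>C x. x)"
  have mono: "mono_arrow (ModC T) N (yon T Z) ?i"
    unfolding N_def
    by (rule Cpt.submodule_inclusion(2)[OF _ N[unfolded N_def]]) auto
  have N_simps: "carrier (FObj N C) = ?S C" "mult (FObj N C) = mult (Hom T C Z)"
    "FArr N C C' c = restrict (FArr (yon T Z) C C' c) (?S C')" for C C' c
    by (simp_all add: N_def)
  \<comment> \<open>A preimage under \<open>v\<close> is chosen arbitrarily; by
    \<open>\<psi>_eq\<close> the value of \<psi> does not depend on the choice.\<close>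
  let ?y = "\<lambda>C. inv_into (arr T C Y) (Comp T C Y Z v)"
  let ?g = "\<lambda>C z. \<psi> C (?y C z)"
  have g_v: "?g C (Comp T C Y Z v y) = \<psi> C y" if "compact_object T C" "y \<in> arr T C Y" for C y
    by (rule \<psi>_eq) (use that in \<open>auto intro: inv_into_into f_inv_into_f\<close>)
  have g: "mk_map (compacts T) N ?g \<in> arr (ModC T) N (yon T E)"
  proof (rule Cpt.mk_map_closed[OF N])
    fix C assume "C \<in> Obj (compacts T)"
    then have C [simp]: "compact_object T C" by simp
    interpret g: group_hom "Hom T C Y" "Hom T C E" "\<psi> C" by (rule \<psi>_gh[OF C])
    show "?g C \<in> hom (FObj N C) (FObj (yon T E) C)"
    proof (rule homI)
      fix z z' assume "z \<in> carrier (FObj N C)" "z' \<in> carrier (FObj N C)"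
      then obtain y y' where y [simp]: "y \<in> arr T C Y" "y' \<in> arr T C Y"
        and z: "z = Comp T C Y Z v y" "z' = Comp T C Y Z v y'" by (auto simp: N_simps)
      show "?g C z \<in> carrier (FObj (yon T E) C)" by (simp add: z g_v)
      have "z \<otimes>\<^bsub>FObj N C\<^esub> z' = Comp T C Y Z v (y \<otimes>\<^bsub>Hom T C Y\<^esub> y')"
        by (simp add: z N_simps comp_mult)
      then show "?g C (z \<otimes>\<^bsub>FObj N C\<^esub> z') = ?g C z \<otimes>\<^bsub>FObj (yon T E) C\<^esub> ?g C z'"
        by (simp add: z g_v)
    qed
  next
    fix C C' c z
    assume "C \<in> Obj (compacts T)" "C' \<in> Obj (compacts T)" "c \<in> arr (compacts T) C C'"
        "z \<in> carrier (FObj N C')"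
    then have C [simp]: "compact_object T C" "compact_object T C'" "c \<in> arr T C C'"
      and "z \<in> ?S C'" by (simp_all add: N_simps)
    then obtain y where y [simp]: "y \<in> arr T C' Y" and z: "z = Comp T C' Y Z v y" by auto
    have "FArr N C C' c z = Comp T C Y Z v (Comp T C C' Y y c)"
      by (simp add: N_simps z comp_assoc)
    then have "?g C (FArr N C C' c z) = \<psi> C (Comp T C C' Y y c)" by (simp add: g_v)
    also have "\<dots> = Comp T C C' E (\<psi> C' y) c"
      by (rule module_mapD(3)[OF \<psi>]) simp_all
    finally show "?g C (FArr N C C' c z) = FArr (yon T E) C C' c (?g C' z)"
      by (simp add: z g_v module_mapD(2)[OF \<psi>])
  qed simp
  obtain \<theta> where \<theta>: "\<theta> \<in> arr (ModC T) (yon T Z) (yon T E)"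
    and \<theta>_eq: "Comp (ModC T) N (yon T Z) (yon T E) \<theta> ?i = mk_map (compacts T) N ?g"
    using inj[unfolded injective_object_def, THEN conjunct2, rule_format, OF N _ mono g] by auto
  show "\<exists>\<psi>'. module_map T Z E \<psi>' \<and>
    (\<forall>C y. compact_object T C \<and> y \<in> arr T C Y \<longrightarrow> \<psi>' C (Comp T C Y Z v y) = \<psi> C y)"
  proof (intro exI[of _ \<theta>] conjI allI impI)
    show "module_map T Z E \<theta>" by (rule mod_hom_module_map[OF _ _ \<theta>]) simp_all
    fix C y assume y: "compact_object T C \<and> y \<in> arr T C Y"
    then have "Comp T C Y Z v y \<in> carrier (FObj N C)" by (simp add: N_simps)
    with fun_cong[OF fun_cong[OF \<theta>_eq, of C], of "Comp T C Y Z v y"] y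
    show "\<theta> C (Comp T C Y Z v y) = \<psi> C y" by (simp add: g_v)
  qed
qed

text \<open>Section and retraction lift to morphisms \<open>f\<close> and \<open>g\<close>. Their
  composite agrees with the identity on all maps from compact objects, so the difference is phantom,
  and phantoms into a pure injective object are zero.\<close>

lemma retract_of_pure_injective:
  assumes inj: "injective_object (ModC T) (yon T Y)" and X: "X \<in> Obj T" and Y: "Y \<in> Obj T"
    and r: "retract_of (ModC T) (yon T X) (yon T Y)"
  shows "retract_of T X Y"
proof -
  \<comment> \<open>\<open>X\<close> inherits injectivity from \<open>Y\<close>; it is needed to
    lift the retraction and to exclude phantoms into \<open>X\<close>.\<close>
  have injX: "injective_object (ModC T) (yon T X)"
    by (rule Cpt.Mod.injective_retract[OF r inj])
  have extX: "extends_module_maps T X" and extY: "extends_module_maps T Y"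
    using injective_extends_module_maps inj injX X Y by auto
  obtain s r where s: "s \<in> arr (ModC T) (yon T X) (yon T Y)"
    and r: "r \<in> arr (ModC T) (yon T Y) (yon T X)"
    and rs: "Comp (ModC T) (yon T X) (yon T Y) (yon T X) r s = Idn (ModC T) (yon T X)"
    using r by (rule Cpt.Mod.retract_ofE)
  obtain f where f: "f \<in> arr T X Y"
    "\<And>C x. \<lbrakk>compact_object T C; x \<in> arr T C X\<rbrakk> \<Longrightarrow> s C x = Comp T C X Y f x"
    using module_map_representable[OF extY Y X mod_hom_module_map[OF X Y s]] by metis
  obtain g where g: "g \<in> arr T Y X"
    "\<And>C x. \<lbrakk>compact_object T C; x \<in> arr T C Y\<rbrakk> \<Longrightarrow> r C x = Comp T C Y X g x"
    using module_map_representable[OF extX X Y mod_hom_module_map[OF Y X r]] by metis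
  let ?e = "Comp T X Y X g f"
  have "Comp T C X X ?e x = x" if C: "compact_object T C" and x: "x \<in> arr T C X" for C x
    using fun_cong[OF fun_cong[OF rs, of C], of x] C x f g X Y by (simp add: comp_assoc)
  then have "phantom X X (?e \<otimes>\<^bsub>Hom T X X\<^esub> inv\<^bsub>Hom T X X\<^esub> Idn T X)"
    using X Y f g by (simp add: phantom_def comp_diff flip: eq_iff_diff)
  from no_phantom[OF extX X X this] have "?e = Idn T X"
    using X Y f g by (subst eq_iff_diff[of X X]) simp_all
  then show ?thesis using X Y f g by (intro retract_ofI[of _ _ f g]) simp_all
qed

end

section \<open>Character duals of representable modules\<close>

lemma QZ_comm_group: "comm_group QZ"
proof -
  let ?Q = "\<lparr>carrier = UNIV :: rat set, mult = (+), one = 0\<rparr>"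
  have Q: "comm_group ?Q"
    by (rule comm_groupI) (auto intro!: exI[of _ "- _"])
  interpret comm_group ?Q by (rule Q)
  have inv: "inv\<^bsub>?Q\<^esub> x = - x" for x
    by (rule inv_equality) simp_all
  have "subgroup \<int> ?Q"
    by (rule subgroupI) (auto simp: inv)
  then show ?thesis unfolding QZ_def by (rule abelian_FactGroup)
qed

lemma hom_group_comm_group:
  assumes G: "group G" and H: "comm_group H"
  shows "comm_group (hom_group G H)"
proof -
  interpret G: group G by (rule G)
  interpret H: comm_group H by (rule H)
  have one: "\<one>\<^bsub>hom_group G H\<^esub> = (\<lambda>x\<in>carrier G. \<one>\<^bsub>H\<^esub>)" by (simp add: hom_group_def)
  have D: "x \<in> carrier G \<Longrightarrow> f x \<in> carrier H" "f \<in> extensional (carrier G)"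
    "\<lbrakk>x \<in> carrier G; y \<in> carrier G\<rbrakk> \<Longrightarrow> f (x \<otimes>\<^bsub>G\<^esub> y) = f x \<otimes>\<^bsub>H\<^esub> f y"
    if "f \<in> carrier (hom_group G H)" for f x y
    using that by (auto simp: hom_def)
  show ?thesis
  proof (rule comm_groupI)
    fix f g assume "f \<in> carrier (hom_group G H)" "g \<in> carrier (hom_group G H)"
    note f = D[OF this(1)] and g = D[OF this(2)]
    show "f \<otimes>\<^bsub>hom_group G H\<^esub> g \<in> carrier (hom_group G H)"
      by (simp add: hom_def f g H.m_ac)
    show "f \<otimes>\<^bsub>hom_group G H\<^esub> g = g \<otimes>\<^bsub>hom_group G H\<^esub> f"
      by (simp add: f g H.m_comm cong: restrict_cong)
    fix h assume "h \<in> carrier (hom_group G H)"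
    note h = D[OF this]
    show "f \<otimes>\<^bsub>hom_group G H\<^esub> g \<otimes>\<^bsub>hom_group G H\<^esub> h = f \<otimes>\<^bsub>hom_group G H\<^esub> (g \<otimes>\<^bsub>hom_group G H\<^esub> h)"
      by (simp add: f g h H.m_assoc cong: restrict_cong)
  next
    show "\<one>\<^bsub>hom_group G H\<^esub> \<in> carrier (hom_group G H)" by (simp add: one hom_def)
    fix f assume "f \<in> carrier (hom_group G H)"
    note f = D[OF this]
    show "\<one>\<^bsub>hom_group G H\<^esub> \<otimes>\<^bsub>hom_group G H\<^esub> f = f"
      by (rule extensionalityI[of _ "carrier G"]) (simp_all add: one f)
    show "\<exists>h\<in>carrier (hom_group G H). h \<otimes>\<^bsub>hom_group G H\<^esub> f = \<one>\<^bsub>hom_group G H\<^esub>"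
    proof (rule bexI[of _ "\<lambda>x\<in>carrier G. inv\<^bsub>H\<^esub> f x"])
      show "(\<lambda>x\<in>carrier G. inv\<^bsub>H\<^esub> f x) \<otimes>\<^bsub>hom_group G H\<^esub> f = \<one>\<^bsub>hom_group G H\<^esub>"
        by (simp add: one f cong: restrict_cong)
      show "(\<lambda>x\<in>carrier G. inv\<^bsub>H\<^esub> f x) \<in> carrier (hom_group G H)"
        by (simp add: hom_def f H.inv_mult)
    qed
  qed
qed

text \<open>The shape of \<open>char_dual\<close>, whose structure is transported along a chosen
  injection.\<close>

lemma comm_group_copy:
  assumes A: "comm_group A" and e: "inj_on e (carrier A)"
    and B: "carrier B = e ` carrier A" "\<one>\<^bsub>B\<^esub> = e \<one>\<^bsub>A\<^esub>"
      "\<And>x y. x \<otimes>\<^bsub>B\<^esub> y = e (inv_into (carrier A) e x \<otimes>\<^bsub>A\<^esub> inv_into (carrier A) e y)"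
  shows "comm_group B" "inv_into (carrier A) e \<in> iso B A"
proof -
  interpret comm_group A by (rule A)
  have p: "inv_into (carrier A) e (e x) = x" if "x \<in> carrier A" for x using e that by simp
  show "comm_group B"
  proof (rule comm_groupI)
    fix x assume "x \<in> carrier B"
    then obtain a where a: "a \<in> carrier A" "x = e a" by (auto simp: B)
    then show "\<exists>y\<in>carrier B. y \<otimes>\<^bsub>B\<^esub> x = \<one>\<^bsub>B\<^esub>"
      by (intro bexI[of _ "e (inv\<^bsub>A\<^esub> a)"]) (simp_all add: B p)
  qed (auto simp: B p m_ac)
  show "inv_into (carrier A) e \<in> iso B A"
    unfolding iso_def
  proof (intro CollectI conjI homI)
    show "bij_betw (inv_into (carrier A) e) (carrier B) (carrier A)"
      unfolding B using e by (simp add: bij_betw_inv_into inj_on_imp_bij_betw)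
  qed (auto simp: B p)
qed

text \<open>\<open>emb\<close> picks an injection only if there is one, and \<Phi> is the witness.
  In the application it is the isomorphism of the duality triple, so that the character group fits
  into \<open>'u\<close> by duality instead of a cardinality count.\<close>

lemma char_dual_group:
  fixes G :: "'u monoid"
  assumes G: "group G" and \<Phi>: "inj_on (\<Phi> :: _ \<Rightarrow> 'u) (carrier (hom_group G QZ))"
  shows "comm_group (char_dual G)" "char_proj G \<in> iso (char_dual G) (hom_group G QZ)"
    and "\<chi> \<in> carrier (hom_group G QZ) \<Longrightarrow> char_emb G \<chi> \<in> carrier (char_dual G)"
    and "\<chi> \<in> carrier (hom_group G QZ) \<Longrightarrow> char_proj G (char_emb G \<chi>) = \<chi>"
proof -
  have e: "inj_on (char_emb G) (carrier (hom_group G QZ))"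
    unfolding char_emb_def emb_def by (rule someI[of _ \<Phi>]) (rule \<Phi>)
  note copy = comm_group_copy[OF hom_group_comm_group[OF G QZ_comm_group] e, of "char_dual G"]
  show "comm_group (char_dual G)"
    by (rule copy(1)) (simp_all add: char_dual_def char_proj_def)
  show "char_proj G \<in> iso (char_dual G) (hom_group G QZ)"
    unfolding char_proj_def by (rule copy(2)) (simp_all add: char_dual_def char_proj_def)
  show "\<chi> \<in> carrier (hom_group G QZ) \<Longrightarrow> char_emb G \<chi> \<in> carrier (char_dual G)"
    by (simp add: char_dual_def)
  show "\<chi> \<in> carrier (hom_group G QZ) \<Longrightarrow> char_proj G (char_emb G \<chi>) = \<chi>"
    unfolding char_proj_def using e by (rule inv_into_f_f)
qed

context module_category
begin

text \<open>Every module axiom for \<open>F\<close> is checked after applying the injective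
  \<theta>, where it becomes an axiom for \<open>G\<close>. In this way the dual of a representable
  module is seen to be a module and identified at the same time.\<close>

lemma module_transport:
  fixes F G :: "('o, 'u) module"
  assumes G: "G \<in> Obj M" and F: "\<And>X. X \<in> Obj C \<Longrightarrow> comm_group (FObj F X)"
    and \<theta>: "\<And>X. X \<in> Obj C \<Longrightarrow> \<theta> X \<in> iso (FObj F X) (FObj G X)"
    and arr: "\<And>X Y f. \<lbrakk>X \<in> Obj C; Y \<in> Obj C; f \<in> arr C X Y\<rbrakk> \<Longrightarrow>
      FArr F X Y f \<in> extensional (carrier (FObj F Y))"
    and arr_closed: "\<And>X Y f y. \<lbrakk>X \<in> Obj C; Y \<in> Obj C; f \<in> arr C X Y; y \<in> carrier (FObj F Y)\<rbrakk> \<Longrightarrow>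
      FArr F X Y f y \<in> carrier (FObj F X)"
    and nat: "\<And>X Y f y. \<lbrakk>X \<in> Obj C; Y \<in> Obj C; f \<in> arr C X Y; y \<in> carrier (FObj F Y)\<rbrakk> \<Longrightarrow>
      \<theta> X (FArr F X Y f y) = FArr G X Y f (\<theta> Y y)"
  shows "F \<in> Obj M" "iso_arrow M F G (mk_map C F \<theta>)"
proof -
  have bij: "bij_betw (\<theta> X) (carrier (FObj F X)) (carrier (FObj G X))" if "X \<in> Obj C" for X
    using \<theta>[OF that] by (simp add: iso_def)
  have \<theta>_hom: "\<theta> X \<in> hom (FObj F X) (FObj G X)" if "X \<in> Obj C" for X
    using \<theta>[OF that] by (simp add: iso_def)
  have \<theta>_closed: "\<theta> X x \<in> carrier (FObj G X)" if "X \<in> Obj C" "x \<in> carrier (FObj F X)" for X x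
    using hom_in_carrier[OF \<theta>_hom] that by blast
  have eqI: "x = y" if "X \<in> Obj C" "x \<in> carrier (FObj F X)" "y \<in> carrier (FObj F X)" "\<theta> X x =
      \<theta> X y" for X x y
    using bij_betw_imp_inj_on[OF bij[OF that(1)]] that by (auto dest: inj_onD)
  have F_mult: "x \<otimes>\<^bsub>FObj F X\<^esub> y \<in> carrier (FObj F X)"
    if "X \<in> Obj C" "x \<in> carrier (FObj F X)" "y \<in> carrier (FObj F X)" for X x y
  proof -
    interpret comm_group "FObj F X" by (rule F[OF that(1)])
    show ?thesis using that by simp
  qed
  have \<theta>_mult: "\<theta> X (x \<otimes>\<^bsub>FObj F X\<^esub> y) = \<theta> X x \<otimes>\<^bsub>FObj G X\<^esub> \<theta> X y"
    if "X \<in> Obj C" "x \<in> carrier (FObj F X)" "y \<in> carrier (FObj F X)" for X x y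
    using hom_mult[OF \<theta>_hom] that by blast
  show FM: "F \<in> Obj M"
    unfolding module_iff
  proof (intro conjI ballI)
    fix X assume X: "X \<in> Obj C"
    show "comm_group (FObj F X)" by (rule F[OF X])
    have "small TYPE('u) (inv_into (carrier (FObj F X)) (\<theta> X) ` carrier (FObj G X))"
      by (rule small_image[OF moduleD(2)[OF G X]])
    then show "small TYPE('u) (carrier (FObj F X))"
      using bij_betw_imp_surj_on[OF bij_betw_inv_into[OF bij[OF X]]] by simp
    fix x assume x: "x \<in> carrier (FObj F X)"
    show "FArr F X X (Idn C X) x = x"
      by (rule eqI[OF X]) (use X x in \<open>simp_all add: arr_closed nat moduleD(5)[OF G] \<theta>_closed\<close>)
  next
    fix X Y f assume X: "X \<in> Obj C" "Y \<in> Obj C" "f \<in> arr C X Y"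
    show "FArr F X Y f \<in> extensional (carrier (FObj F Y))" by (rule arr[OF X])
    show "FArr F X Y f \<in> hom (FObj F Y) (FObj F X)"
    proof (rule homI)
      fix x y assume x: "x \<in> carrier (FObj F Y)" and y: "y \<in> carrier (FObj F Y)"
      show "FArr F X Y f x \<in> carrier (FObj F X)" by (rule arr_closed[OF X x])
      show "FArr F X Y f (x \<otimes>\<^bsub>FObj F Y\<^esub> y) = FArr F X Y f x \<otimes>\<^bsub>FObj F X\<^esub> FArr F X Y f y"
        by (rule eqI[OF X(1)]) (use X x y hom_mult[OF moduleD(3)[OF G X]] in
            \<open>simp_all add: arr_closed nat \<theta>_mult F_mult \<theta>_closed\<close>)
    qed
  next
    fix X Y Z f g z
    assume X: "X \<in> Obj C" "Y \<in> Obj C" "Z \<in> Obj C" "f \<in> arr C X Y" "g \<in> arr C Y Z"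
      and z: "z \<in> carrier (FObj F Z)"
    show "FArr F X Z (Comp C X Y Z g f) z = FArr F X Y f (FArr F Y Z g z)"
      by (rule eqI[OF X(1)]) (use X z in \<open>simp_all add: arr_closed nat moduleD(6)[OF G] \<theta>_closed\<close>)
  next
    fix X Y f g y
    assume X: "X \<in> Obj C" "Y \<in> Obj C" "f \<in> arr C X Y" "g \<in> arr C X Y"
      and y: "y \<in> carrier (FObj F Y)"
    show "FArr F X Y (f \<otimes>\<^bsub>Hom C X Y\<^esub> g) y = FArr F X Y f y \<otimes>\<^bsub>FObj F X\<^esub> FArr F X Y g y"
      by (rule eqI[OF X(1)]) (use X y in \<open>simp_all add: arr_closed nat moduleD(7)[OF G] \<theta>_closed
          \<theta>_mult F_mult\<close>)
  qed
  let ?t = "\<lambda>X. inv_into (carrier (FObj F X)) (\<theta> X)"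
  have t_closed: "?t X y \<in> carrier (FObj F X)" and \<theta>_t: "\<theta> X (?t X y) = y"
    if "X \<in> Obj C" "y \<in> carrier (FObj G X)" for X y
    using bij[OF that(1)] that(2) by (auto simp: bij_betw_def inv_into_into f_inv_into_f)
  have t_\<theta>: "?t X (\<theta> X x) = x" if "X \<in> Obj C" "x \<in> carrier (FObj F X)" for X x
    by (rule eqI[OF that(1)]) (use that in \<open>simp_all add: t_closed \<theta>_t \<theta>_closed\<close>)
  have \<theta>': "mk_map C F \<theta> \<in> arr M F G"
    by (rule mk_map_closed[OF FM G \<theta>_hom nat])
  have t': "mk_map C G ?t \<in> arr M G F"
  proof (rule mk_map_closed[OF G FM])
    fix X assume X: "X \<in> Obj C"
    interpret G: comm_group "FObj G X" by (rule moduleD(1)[OF G X])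
    show "?t X \<in> hom (FObj G X) (FObj F X)"
    proof (rule homI)
      fix x y assume x: "x \<in> carrier (FObj G X)" and y: "y \<in> carrier (FObj G X)"
      show "?t X x \<in> carrier (FObj F X)" by (rule t_closed[OF X x])
      show "?t X (x \<otimes>\<^bsub>FObj G X\<^esub> y) = ?t X x \<otimes>\<^bsub>FObj F X\<^esub> ?t X y"
        by (rule eqI[OF X]) (use X x y in \<open>simp_all add: t_closed \<theta>_t \<theta>_mult F_mult\<close>)
    qed
  next
    fix X Y f y assume X: "X \<in> Obj C" "Y \<in> Obj C" "f \<in> arr C X Y" and y: "y \<in> carrier (FObj G Y)"
    show "?t X (FArr G X Y f y) = FArr F X Y f (?t Y y)"
      by (rule eqI[OF X(1)]) (use X y in \<open>simp_all add: t_closed \<theta>_t nat arr_closed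
          module_arr_closed[OF G]\<close>)
  qed
  show "iso_arrow M F G (mk_map C F \<theta>)"
    unfolding iso_arrow_def
  proof (intro conjI \<theta>' bexI[OF _ t'])
    show "Comp M F G F (mk_map C G ?t) (mk_map C F \<theta>) = Idn M F"
      by (rule mod_hom_eqI[OF FM FM]) (simp_all add: mod_comp_closed[OF FM G FM \<theta>' t']
          mod_idn_closed FM \<theta>_closed t_\<theta>)
    show "Comp M G F G (mk_map C F \<theta>) (mk_map C G ?t) = Idn M G"
      by (rule mod_hom_eqI[OF G G]) (simp_all add: mod_comp_closed[OF G FM G t' \<theta>'] mod_idn_closed
          G t_closed \<theta>_t)
  qed
qed

end

text \<open>At a compact object K of U the isomorphism is \<Phi>, from characters of Hom(D'K, X) to
  Hom(DD'K, QX), followed by precomposition with \<epsilon>. Since \<epsilon> belongs to the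
  opposite category, it goes from K to DD'K.\<close>

lemma dual_yon:
  fixes T :: "('o, 'u, 'z) tricat_scheme" and U :: "('p, 'u, 'y) tricat_scheme"
  assumes T: "comp_gen T" and U: "comp_gen U"
    and D: "adjoint_equivalence (compacts T) (opposite (compacts U)) D (opposite_functor D')"
    and \<Phi>: "AGJ_isomorphism T U Q D \<Phi>"
    and X: "X \<in> Obj T" and QX: "FObj Q X \<in> Obj U"
  obtains \<theta> where "dual_module D' (yon T X) \<in> Obj (ModC U)"
    "iso_arrow (ModC U) (dual_module D' (yon T X)) (yon U (FObj Q X)) \<theta>"
proof -
  interpret T: comp_gen T by (rule T)
  interpret U: comp_gen U by (rule U)
  have D': "is_functor (opposite (compacts U)) (compacts T) (opposite_functor D')"
    and DF: "is_functor (compacts T) (opposite (compacts U)) D"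
    using D by (simp_all add: adjoint_equivalence_def)
  obtain \<epsilon> where \<epsilon>: "nat_iso (opposite (compacts U)) (opposite (compacts U))
      (comp_functor D (opposite_functor D')) id_functor \<epsilon>"
    using D by (auto simp: adjoint_equivalence_def)
  have D'_obj: "compact_object T (FObj D' K)" if "compact_object U K" for K
    using D' that by (simp add: is_functor_def)
  have D'_arr: "FArr D' K L k \<in> arr T (FObj D' L) (FObj D' K)"
    if "compact_object U K" "compact_object U L" "k \<in> arr U K L" for K L k
    using D' that by (simp add: is_functor_def)
  have D_obj: "compact_object U (FObj D C)" if "compact_object T C" for C
    using DF that by (simp add: is_functor_def)
  have D_arr: "FArr D B C c \<in> arr U (FObj D C) (FObj D B)"
    if "compact_object T B" "compact_object T C" "c \<in> arr T B C" for B C c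
    using DF that by (simp add: is_functor_def)
  let ?DD = "\<lambda>K. FObj D (FObj D' K)"
  have \<epsilon>_iso: "\<epsilon> K \<in> arr U K (?DD K)"
    "\<exists>g\<in>arr U (?DD K) K. Comp U (?DD K) K (?DD K) (\<epsilon> K) g = Idn U (?DD K) \<and>
       Comp U K (?DD K) K g (\<epsilon> K) = Idn U K" if "compact_object U K" for K
    using \<epsilon> that by (simp_all add: nat_iso_def iso_arrow_def comp_functor_def id_functor_def)
  have \<epsilon>_nat: "Comp U K (?DD K) (?DD L) (FArr D (FObj D' L) (FObj D' K) (FArr D' K L k)) (\<epsilon> K) =
      Comp U K L (?DD L) (\<epsilon> L) k"
    if "compact_object U K" "compact_object U L" "k \<in> arr U K L" for K L k
    using \<epsilon> that by (simp add: nat_iso_def nat_trans_def comp_functor_def id_functor_def)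
  let ?G = "\<lambda>K. Hom T (FObj D' K) X"
  have \<Phi>_iso: "\<Phi> C X \<in> iso (hom_group (Hom T C X) QZ) (Hom U (FObj D C) (FObj Q X))"
    if "compact_object T C" for C
    using \<Phi> that X by (simp add: AGJ_isomorphism_def)
  have \<Phi>_nat: "\<Phi> C' X (\<lambda>f\<in>arr T C' X. \<chi> (Comp T C C' X f c)) =
        Comp U (FObj D C') (FObj D C) (FObj Q X) (\<Phi> C X \<chi>) (FArr D C C' c)"
    if "compact_object T C" "compact_object T C'" "c \<in> arr T C C'"
      "\<chi> \<in> carrier (hom_group (Hom T C X) QZ)" for C C' c \<chi>
    using \<Phi>[unfolded AGJ_isomorphism_def, THEN conjunct2, THEN conjunct1] that X by simp
  have G: "group (?G K)" if "compact_object U K" for K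
    using D'_obj[OF that] X by (simp add: T.hom_group)
  have inj: "inj_on (\<Phi> (FObj D' K) X) (carrier (hom_group (?G K) QZ))" if "compact_object U K" for K
    using \<Phi>_iso[OF D'_obj[OF that]] by (simp add: iso_def bij_betw_def)
  note cd = char_dual_group[OF G inj]
  have proj_closed: "char_proj (?G K) \<xi> \<in> carrier (hom_group (?G K) QZ)"
    if "compact_object U K" "\<xi> \<in> carrier (char_dual (?G K))" for K \<xi>
    using cd(2)[OF that(1,1)] that(2) by (auto simp: iso_def dest: hom_in_carrier)
  let ?F = "dual_module D' (yon T X)"
  let ?\<theta> = "\<lambda>K \<xi>. Comp U K (?DD K) (FObj Q X) (\<Phi> (FObj D' K) X (char_proj (?G K) \<xi>)) (\<epsilon> K)"
  have F_obj: "FObj ?F K = char_dual (?G K)" for K by (simp add: dual_module_def)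
  \<comment> \<open>The pullback of a character along D'k has to be a character again for
    \<open>char_proj\<close> to undo \<open>char_emb\<close> on it.\<close>
  have pull: "(\<lambda>a\<in>carrier (?G K). \<chi> (Comp T (FObj D' L) (FObj D' K) X a (FArr D' K L k)))
      \<in> carrier (hom_group (?G K) QZ)"
    if K: "compact_object U K" "compact_object U L" "k \<in> arr U K L"
      and \<chi>: "\<chi> \<in> carrier (hom_group (?G L) QZ)" for K L k \<chi>
  proof -
    interpret group "?G K" by (rule G[OF K(1)])
    have \<chi>': "\<chi> \<in> hom (?G L) QZ" using \<chi> by simp
    have d: "(\<lambda>a. Comp T (FObj D' L) (FObj D' K) X a (FArr D' K L k)) \<in> hom (?G K) (?G L)"
      by (rule T.comp_hom_left) (use D'_arr[OF K] D'_obj[OF K(1)] D'_obj[OF K(2)] X in simp_all)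
    have "(\<lambda>a. \<chi> (Comp T (FObj D' L) (FObj D' K) X a (FArr D' K L k))) \<in> hom (?G K) QZ"
      using Group.hom_compose[OF d \<chi>'] by (simp add: comp_def)
    then show ?thesis by (auto simp: hom_def)
  qed
  have F_arr: "FArr ?F K L k = (\<lambda>\<xi>\<in>carrier (char_dual (?G L)). char_emb (?G K)
      (\<lambda>a\<in>carrier (?G K). char_proj (?G L) \<xi> (Comp T (FObj D' L) (FObj D' K) X a
          (FArr D' K L k))))" for K L k
    by (simp add: dual_module_def char_dual_arr_def cong: restrict_cong)
  show ?thesis
  proof (rule that)
    note tr = U.Cpt.module_transport[OF U.yon_module[OF QX], of ?F ?\<theta>]
    have c1: "comm_group (FObj ?F K)" if "K \<in> Obj (compacts U)" for K
      using cd(1)[of K] that by (simp add: F_obj)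
    have c2: "?\<theta> K \<in> iso (FObj ?F K) (FObj (yon U (FObj Q X)) K)" if "K \<in> Obj (compacts U)" for K
    proof -
      have K [simp]: "compact_object U K" using that by simp
      have [simp]: "?DD K \<in> Obj U" using D_obj[OF D'_obj[OF K]] by simp
      obtain g where g [simp]: "g \<in> arr U (?DD K) K" "Comp U (?DD K) K (?DD K) (\<epsilon> K) g =
          Idn U (?DD K)"
        "Comp U K (?DD K) K g (\<epsilon> K) = Idn U K" using \<epsilon>_iso(2)[OF K] by auto
      note [simp] = \<epsilon>_iso(1)[OF K] QX
      have "bij_betw (\<lambda>f. Comp U K (?DD K) (FObj Q X) f (\<epsilon> K)) (arr U (?DD K) (FObj Q X))
          (arr U K (FObj Q X))"
        by (rule bij_betw_byWitness[where f' = "\<lambda>f. Comp U (?DD K) K (FObj Q X) f g"])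
          (auto simp: U.right_inverse_cancel)
      then have "(\<lambda>f. Comp U K (?DD K) (FObj Q X) f (\<epsilon> K)) \<in> iso (Hom U (?DD K) (FObj Q X))
          (Hom U K (FObj Q X))"
        by (simp add: iso_def U.comp_hom_left)
      from iso_set_trans[OF iso_set_trans[OF cd(2)[OF K K] \<Phi>_iso[OF D'_obj[OF K]]] this]
      show ?thesis by (simp add: F_obj comp_def)
    qed
    have c3: "FArr ?F K L k \<in> extensional (carrier (FObj ?F L))" for K L k
      by (simp add: F_arr F_obj)
    have c4: "FArr ?F K L k \<xi> \<in> carrier (FObj ?F K)"
      if "K \<in> Obj (compacts U)" "L \<in> Obj (compacts U)" "k \<in> arr (compacts U) K L"
        "\<xi> \<in> carrier (FObj ?F L)" for K L k \<xi>
    proof -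
      have K: "compact_object U K" "compact_object U L" "k \<in> arr U K L"
        and \<xi>: "\<xi> \<in> carrier (char_dual (?G L))" using that by (simp_all add: F_obj)
      show ?thesis
        using cd(3)[OF K(1,1) pull[OF K proj_closed[OF K(2) \<xi>]]] \<xi> by (simp add: F_arr F_obj)
    qed
    have c5: "?\<theta> K (FArr ?F K L k \<xi>) = FArr (yon U (FObj Q X)) K L k (?\<theta> L \<xi>)"
      if "K \<in> Obj (compacts U)" "L \<in> Obj (compacts U)" "k \<in> arr (compacts U) K L"
        "\<xi> \<in> carrier (FObj ?F L)" for K L k \<xi>
    proof -
      have K [simp]: "compact_object U K" "compact_object U L" "k \<in> arr U K L"
        and \<xi> [simp]: "\<xi> \<in> carrier (char_dual (?G L))" using that by (simp_all add: F_obj)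
      let ?\<chi> = "char_proj (?G L) \<xi>"
      have \<chi>: "?\<chi> \<in> carrier (hom_group (?G L) QZ)" by (rule proj_closed[OF K(2) \<xi>])
      let ?d = "FArr D' K L k"
      have [simp]: "?DD K \<in> Obj U" "?DD L \<in> Obj U"
        using D_obj[OF D'_obj[OF K(1)]] D_obj[OF D'_obj[OF K(2)]] by simp_all
      have [simp]: "\<Phi> (FObj D' L) X ?\<chi> \<in> arr U (?DD L) (FObj Q X)"
        using \<Phi>_iso[OF D'_obj[OF K(2)]] \<chi> by (auto simp: iso_def dest: hom_in_carrier)
      have [simp]: "FArr D (FObj D' L) (FObj D' K) ?d \<in> arr U (?DD K) (?DD L)"
        by (rule D_arr[OF D'_obj[OF K(2)] D'_obj[OF K(1)] D'_arr[OF K]])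
      note [simp] = \<epsilon>_iso(1)[OF K(1)] \<epsilon>_iso(1)[OF K(2)] QX
      have "char_proj (?G K) (FArr ?F K L k \<xi>) =
          (\<lambda>a\<in>carrier (?G K). ?\<chi> (Comp T (FObj D' L) (FObj D' K) X a ?d))"
        using cd(4)[OF K(1,1) pull[OF K \<chi>]] by (simp add: F_arr)
      \<comment> \<open>Naturality of \<Phi> in its compact argument carries the action of
        \<open>k\<close> across \<Phi>; naturality of \<epsilon> then replaces DD'k by
        \<open>k\<close>.\<close>
      then have "?\<theta> K (FArr ?F K L k \<xi>) = Comp U K (?DD K) (FObj Q X)
          (Comp U (?DD K) (?DD L) (FObj Q X) (\<Phi> (FObj D' L) X ?\<chi>) (FArr D (FObj D' L) (FObj D' K)
              ?d)) (\<epsilon> K)"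
        using \<Phi>_nat[OF D'_obj[OF K(2)] D'_obj[OF K(1)] D'_arr[OF K] \<chi>] by simp
      also have "\<dots> = Comp U K (?DD L) (FObj Q X) (\<Phi> (FObj D' L) X ?\<chi>) (Comp U K L (?DD L) (\<epsilon> L) k)"
        by (simp add: U.comp_assoc \<epsilon>_nat[OF K])
      also have "\<dots> = FArr (yon U (FObj Q X)) K L k (?\<theta> L \<xi>)"
        by (simp add: U.comp_assoc)
      finally show ?thesis .
    qed
    show "?F \<in> Obj (ModC U)" by (rule tr(1)[OF c1 c2 c3 c4 c5])
    show "iso_arrow (ModC U) ?F (yon U (FObj Q X)) (mk_map (compacts U) ?F ?\<theta>)"
      by (rule tr(2)[OF c1 c2 c3 c4 c5])
  qed
qed

section \<open>Duality pairs\<close>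

lemma add_closure_least:
  "\<lbrakk>S \<subseteq> Y; Y \<subseteq> Obj C; closed_finite_coproducts C Y; closed_retracts C Y\<rbrakk> \<Longrightarrow> add_closure C S \<subseteq> Y"
  unfolding add_closure_def by blast

lemma add_closure_superset: "S \<subseteq> add_closure C S"
  unfolding add_closure_def by blast

lemma add_closure_closed:
  "closed_finite_coproducts C (add_closure C S)" "closed_retracts C (add_closure C S)"
proof -
  let ?\<Y> = "{Y. S \<subseteq> Y \<and> Y \<subseteq> Obj C \<and> closed_finite_coproducts C Y \<and> closed_retracts C Y}"
  show "closed_finite_coproducts C (add_closure C S)"
    unfolding closed_finite_coproducts_def
  proof (intro allI impI)
    fix I :: "nat set" and X P \<iota>
    assume *: "finite I \<and> (\<forall>i\<in>I. X i \<in> add_closure C S) \<and> is_coproduct C I X P \<iota>"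
    have "P \<in> Y" if "Y \<in> ?\<Y>" for Y
    proof -
      have "closed_finite_coproducts C Y" "\<forall>i\<in>I. X i \<in> Y" using that *
        by (auto simp: add_closure_def)
      then show ?thesis using * unfolding closed_finite_coproducts_def by metis
    qed
    then show "P \<in> add_closure C S" unfolding add_closure_def by blast
  qed
  show "closed_retracts C (add_closure C S)"
    unfolding closed_retracts_def
  proof (intro allI impI)
    fix M N assume *: "N \<in> add_closure C S \<and> retract_of C M N"
    have "M \<in> Y" if "Y \<in> ?\<Y>" for Y
    proof -
      have "closed_retracts C Y" "N \<in> Y" using that * by (auto simp: add_closure_def)
      then show ?thesis using * unfolding closed_retracts_def by metis
    qed
    then show "M \<in> add_closure C S" unfolding add_closure_def by blast
  qed
qed

section \<open>Restricting classes of modules along y, and summands of representable modules\<close>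

context comp_gen
begin

text \<open>Classes of modules are closed under summands, so a retract of objects has to be sent to
  more than a retract of modules. The complement in the triangulated category provides this, as y
  preserves the coproduct of the two pieces.\<close>

lemma yon_summand:
  assumes "retract_of T M N"
  shows "summand_of (ModC T) (yon T M) (yon T N)"
proof -
  obtain K \<iota> where "is_coproduct T UNIV (\<lambda>b. if b then M else K) N \<iota>"
    by (rule retract_imp_coproduct[OF assms])
  from yon_finite_coproduct[OF this] show ?thesis
    unfolding summand_of_def by (auto simp: if_distrib[of "yon T"])
qed

lemma preimage_yon_closed:
  assumes "closed_finite_coproducts (ModC T) \<B>" "closed_summands (ModC T) \<B>"
  shows "closed_finite_coproducts T (preimage_yon T \<B>)" "closed_retracts T (preimage_yon T \<B>)"
proof -
  show "closed_finite_coproducts T (preimage_yon T \<B>)"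
    unfolding closed_finite_coproducts_def
  proof (intro allI impI)
    fix I :: "nat set" and X P \<iota>
    assume *: "finite I \<and> (\<forall>i\<in>I. X i \<in> preimage_yon T \<B>) \<and> is_coproduct T I X P \<iota>"
    then have I: "finite I" and P: "is_coproduct T I X P \<iota>" by auto
    have "yon T P \<in> \<B>"
      by (rule Cpt.Mod.closed_finite_coproductsD[OF assms(1) I _ yon_finite_coproduct[OF P I]])
        (use * in \<open>simp add: preimage_yon_def\<close>)
    then show "P \<in> preimage_yon T \<B>" using coproductD(1)[OF P] by (simp add: preimage_yon_def)
  qed
  show "closed_retracts T (preimage_yon T \<B>)"
    unfolding closed_retracts_def
  proof (intro allI impI)
    fix M N assume *: "N \<in> preimage_yon T \<B> \<and> retract_of T M N"
    then have "summand_of (ModC T) (yon T M) (yon T N)" using yon_summand by blast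
    then have "yon T M \<in> \<B>" using assms(2) * unfolding closed_summands_def preimage_yon_def by blast
    moreover have "M \<in> Obj T" using * by (auto simp: retract_of_def)
    ultimately show "M \<in> preimage_yon T \<B>" by (simp add: preimage_yon_def)
  qed
qed

text \<open>Makes the class of pure injective objects one of the classes intersected in
  \<open>add_closure\<close>, so that add(Q\<X>) consists of pure injective objects.\<close>

lemma injective_yon_closed:
  "closed_finite_coproducts T {Y \<in> Obj T. injective_object (ModC T) (yon T Y)}"
  "closed_retracts T {Y \<in> Obj T. injective_object (ModC T) (yon T Y)}"
proof -
  show "closed_finite_coproducts T {Y \<in> Obj T. injective_object (ModC T) (yon T Y)}"
    unfolding closed_finite_coproducts_def using yon_injective_finite_coproduct coproductD(1)
      by blast
  show "closed_retracts T {Y \<in> Obj T. injective_object (ModC T) (yon T Y)}"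
    unfolding closed_retracts_def
  proof (intro allI impI)
    fix M N assume "N \<in> {Y \<in> Obj T. injective_object (ModC T) (yon T Y)} \<and> retract_of T M N"
    then have N: "injective_object (ModC T) (yon T N)" and r: "retract_of T M N" by auto
    have "injective_object (ModC T) (yon T M)"
      by (rule Cpt.Mod.injective_retract[OF yon_retract[OF r] N])
    moreover have "M \<in> Obj T" using r by (auto simp: retract_of_def)
    ultimately show "M \<in> {Y \<in> Obj T. injective_object (ModC T) (yon T Y)}" by simp
  qed
qed

text \<open>Written with retracts because they compose; \<open>summand_imp_retract\<close> then
  gives closure under summands.\<close>

definition yon_summands :: "'o set \<Rightarrow> ('o, 'u) module set" where
  "yon_summands \<Y> = {G. \<exists>Y\<in>\<Y>. retract_of (ModC T) G (yon T Y)}"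

text \<open>A coproduct of retracts is a retract of the coproduct, and a finite coproduct of modules
  y(Y i) is y of a coproduct in the class.\<close>

lemma yon_summands_closed:
  assumes \<Y>: "\<Y> \<subseteq> Obj T" "closed_finite_coproducts T \<Y>"
  shows "closed_finite_coproducts (ModC T) (yon_summands \<Y>)"
      "closed_summands (ModC T) (yon_summands \<Y>)"
proof -
  show "closed_finite_coproducts (ModC T) (yon_summands \<Y>)"
    unfolding closed_finite_coproducts_def
  proof (intro allI impI)
    fix I :: "nat set" and G P \<iota>
    assume *: "finite I \<and> (\<forall>i\<in>I. G i \<in> yon_summands \<Y>) \<and> is_coproduct (ModC T) I G P \<iota>"
    then have I: "finite I" and P: "is_coproduct (ModC T) I G P \<iota>"
      and "\<forall>i\<in>I. \<exists>Y. Y \<in> \<Y> \<and> retract_of (ModC T) (G i) (yon T Y)" by (auto simp: yon_summands_def)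
    then obtain Y where Y: "\<And>i. i \<in> I \<Longrightarrow> Y i \<in> \<Y>" "\<And>i. i \<in> I \<Longrightarrow>
        retract_of (ModC T) (G i) (yon T (Y i))"
      by metis
    obtain N \<kappa> where N: "is_coproduct T I Y N \<kappa>"
      by (rule finite_coproduct_exists[OF I, of Y]) (use Y(1) \<Y>(1) in auto)
    have "retract_of (ModC T) P (yon T N)"
      by (rule Cpt.Mod.coproduct_retract[OF P yon_finite_coproduct[OF N I] Y(2)])
    moreover have "N \<in> \<Y>" by (rule closed_finite_coproductsD[OF \<Y>(2) I Y(1) N])
    ultimately show "P \<in> yon_summands \<Y>" by (auto simp: yon_summands_def)
  qed
  show "closed_summands (ModC T) (yon_summands \<Y>)"
    unfolding closed_summands_def
  proof (intro allI impI)
    fix F G assume *: "G \<in> yon_summands \<Y> \<and> summand_of (ModC T) F G"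
    then obtain Y where Y: "Y \<in> \<Y>" "retract_of (ModC T) G (yon T Y)"
      by (auto simp: yon_summands_def)
    have "retract_of (ModC T) F (yon T Y)"
      using Cpt.Mod.retract_of_trans[OF Cpt.summand_imp_retract Y(2)] * by blast
    then show "F \<in> yon_summands \<Y>" using Y(1) by (auto simp: yon_summands_def)
  qed
qed

text \<open>Since the objects of the class are pure injective, a retract of modules between
  representables lifts to a retract of objects; so passing to retracts of modules adds no
  object.\<close>

lemma preimage_yon_summands:
  assumes \<Y>: "\<And>Y. Y \<in> \<Y> \<Longrightarrow> Y \<in> Obj T \<and> injective_object (ModC T) (yon T Y)" and "closed_retracts T \<Y>"
  shows "preimage_yon T (yon_summands \<Y>) = \<Y>"
proof
  show "preimage_yon T (yon_summands \<Y>) \<subseteq> \<Y>"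
  proof
    fix X assume "X \<in> preimage_yon T (yon_summands \<Y>)"
    then obtain Y where X: "X \<in> Obj T" and Y: "Y \<in> \<Y>" "retract_of (ModC T) (yon T X) (yon T Y)"
      by (auto simp: preimage_yon_def yon_summands_def)
    have "retract_of T X Y"
      by (rule retract_of_pure_injective[OF _ X _ Y(2)]) (use \<Y>[OF Y(1)] in simp_all)
    then show "X \<in> \<Y>" using assms(2) Y(1) unfolding closed_retracts_def by blast
  qed
  show "\<Y> \<subseteq> preimage_yon T (yon_summands \<Y>)"
  proof
    fix Y assume Y: "Y \<in> \<Y>"
    then have "retract_of (ModC T) (yon T Y) (yon T Y)"
      using \<Y>[OF Y] by (intro Cpt.Mod.retract_of_refl yon_module) simp
    then show "Y \<in> preimage_yon T (yon_summands \<Y>)"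
      using Y \<Y>[OF Y] by (auto simp: preimage_yon_def yon_summands_def)
  qed
qed

end

theorem proposition9p5:
  fixes T :: "('o, 'u) tricat" and U :: "('p, 'u) tricat"
    and Q :: "('o, 'u, 'p, 'u) fctr" and Q' :: "('p, 'u, 'o, 'u) fctr"
    and D :: "('o, 'u, 'p, 'u) fctr" and D' :: "('p, 'u, 'o, 'u) fctr"
  assumes "is_universe TYPE('u)"
    and "AGJ_duality_triple T U Q Q' D D'"
  shows "(\<forall>\<A> \<B>. Mod_duality_pair T U D' \<A> \<B> \<longrightarrow>
            duality_pair T U Q (preimage_yon T \<A>) (preimage_yon U \<B>)) \<and>
         (\<forall>\<X> \<Y>. duality_pair T U Q \<X> \<Y> \<longrightarrow>
            (\<exists>\<A> \<B>. Mod_duality_pair T U D' \<A> \<B> \<and>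
               preimage_yon T \<A> = \<X> \<and>
               preimage_yon U \<B> = add_closure U (FObj Q ` \<X>) \<and>
               add_closure U (FObj Q ` \<X>) \<subseteq> \<Y>))"
proof -
  have triple: "duality_triple T U Q Q'"
    and D: "adjoint_equivalence (compacts T) (opposite (compacts U)) D (opposite_functor D')"
    and "\<exists>\<Phi>. AGJ_isomorphism T U Q D \<Phi>"
    using assms(2) by (simp_all add: AGJ_duality_triple_def)
  then obtain \<Phi> where \<Phi>: "AGJ_isomorphism T U Q D \<Phi>" by blast
  have T: "comp_gen T" and U: "comp_gen U"
    using triple assms(1) by (simp_all add: comp_gen_def duality_triple_def)
  interpret T: comp_gen T by (rule T)
  interpret U: comp_gen U by (rule U)
  have "additive_functor T (opposite U) Q"
    using triple by (simp add: duality_triple_def contravariant_exact_def)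
  then have Q: "FObj Q X \<in> Obj U" if "X \<in> Obj T" for X
    using that by (simp add: additive_functor_def is_functor_def)
  have Q_inj: "injective_object (ModC U) (yon U (FObj Q X))" if "X \<in> Obj T" for X
    using triple that by (simp add: duality_triple_def pure_injective_def)
  have dual: "dual_module D' (yon T X) \<in> Obj (ModC U)"
    "\<exists>\<theta>. iso_arrow (ModC U) (dual_module D' (yon T X)) (yon U (FObj Q X)) \<theta>" if X: "X \<in> Obj T" for X
    using dual_yon[OF T U D \<Phi> X Q[OF X]] by metis+
  \<comment> \<open>The dual of yX and y(QX) are isomorphic, in general not equal; closure under
    finite coproducts bridges the difference.\<close>
  have dual_iff: "dual_module D' (yon T X) \<in> \<B> \<longleftrightarrow> yon U (FObj Q X) \<in> \<B>"
    if "closed_finite_coproducts (ModC U) \<B>" "X \<in> Obj T" for X \<B>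
    using U.Cpt.Mod.closed_finite_coproducts_iso[OF that(1) _ dual(1)[OF that(2)] U.yon_module[OF
        Q[OF that(2)]]]
      dual(2)[OF that(2)] by blast
  have first: "duality_pair T U Q (preimage_yon T \<A>) (preimage_yon U \<B>)"
    if "Mod_duality_pair T U D' \<A> \<B>" for \<A> \<B>
  proof -
    have AB: "\<And>F. F \<in> Obj (ModC T) \<Longrightarrow> F \<in> \<A> \<longleftrightarrow> dual_module D' F \<in> \<B>"
      and \<B>: "closed_finite_coproducts (ModC U) \<B>" "closed_summands (ModC U) \<B>"
      using that by (auto simp: Mod_duality_pair_def)
    have "M \<in> preimage_yon T \<A> \<longleftrightarrow> FObj Q M \<in> preimage_yon U \<B>" if M: "M \<in> Obj T" for M
      using AB[OF T.yon_module[OF M]] M Q[OF M] dual_iff[OF \<B>(1) M] by (simp add: preimage_yon_def)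
    then show ?thesis
      using U.preimage_yon_closed[OF \<B>] by (auto simp: duality_pair_def preimage_yon_def)
  qed
  have second: "\<exists>\<A> \<B>. Mod_duality_pair T U D' \<A> \<B> \<and> preimage_yon T \<A> = \<X> \<and>
      preimage_yon U \<B> = add_closure U (FObj Q ` \<X>) \<and> add_closure U (FObj Q ` \<X>) \<subseteq> \<Y>"
    if "duality_pair T U Q \<X> \<Y>" for \<X> \<Y>
  proof -
    have \<X>: "\<X> \<subseteq> Obj T" and \<Y>: "\<Y> \<subseteq> Obj U" "closed_finite_coproducts U \<Y>" "closed_retracts U \<Y>"
      and XY: "\<And>M. M \<in> Obj T \<Longrightarrow> M \<in> \<X> \<longleftrightarrow> FObj Q M \<in> \<Y>"
      using that by (auto simp: duality_pair_def)
    \<comment> \<open>The whole of \<Y> could contain objects that are not pure injective, and the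
      lifting of retracts of modules relies on pure injectivity. Inside add(Q\<X>) it is
      guaranteed.\<close>
    define K where "K = add_closure U (FObj Q ` \<X>)"
    have "FObj Q ` \<X> \<subseteq> \<Y>" using XY \<X> by auto
    then have KY: "K \<subseteq> \<Y>" unfolding K_def using \<Y> by (intro add_closure_least)
    have QK: "FObj Q ` \<X> \<subseteq> K" unfolding K_def by (rule add_closure_superset)
    have K: "closed_finite_coproducts U K" "closed_retracts U K"
      unfolding K_def by (rule add_closure_closed)+
    have "K \<subseteq> {Y \<in> Obj U. injective_object (ModC U) (yon U Y)}"
      unfolding K_def using U.injective_yon_closed Q Q_inj \<X> by (intro add_closure_least) auto
    then have inj: "\<And>Y. Y \<in> K \<Longrightarrow> Y \<in> Obj U \<and> injective_object (ModC U) (yon U Y)" by auto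
    let ?\<B> = "U.yon_summands K"
    \<comment> \<open>The only choice that the defining equivalence of a duality pair of modules
      allows.\<close>
    let ?\<A> = "{F \<in> Obj (ModC T). dual_module D' F \<in> ?\<B>}"
    have K_obj: "K \<subseteq> Obj U" using inj by auto
    have pre: "preimage_yon U ?\<B> = K" by (rule U.preimage_yon_summands[OF inj K(2)])
    have "Mod_duality_pair T U D' ?\<A> ?\<B>"
      using U.yon_summands_closed[OF K_obj K(1)]
      by (auto simp: Mod_duality_pair_def U.yon_summands_def retract_of_def)
    moreover have "preimage_yon T ?\<A> = \<X>"
    proof -
      have "yon T X \<in> ?\<A> \<longleftrightarrow> X \<in> \<X>" if X: "X \<in> Obj T" for X
      proof -
        have "yon T X \<in> ?\<A> \<longleftrightarrow> yon U (FObj Q X) \<in> ?\<B>"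
          using T.yon_module[OF X] dual_iff[OF U.yon_summands_closed(1)[OF K_obj K(1)] X] by simp
        also have "\<dots> \<longleftrightarrow> FObj Q X \<in> K" using pre Q[OF X] by (auto simp: preimage_yon_def)
        \<comment> \<open>If QX is in add(Q\<X>), it is in \<Y>, and the given duality pair returns
          \<open>X\<close> in \<X>; the other direction is the inclusion of Q\<X> in its
          closure.\<close>
        also have "\<dots> \<longleftrightarrow> X \<in> \<X>" using XY[OF X] KY QK by auto
        finally show ?thesis .
      qed
      then show ?thesis using \<X> by (auto simp: preimage_yon_def)
    qed
    ultimately show ?thesis using pre KY unfolding K_def by blast
  qed
  show ?thesis using first second by blast
qed

end
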